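(* Let $a,b,c\in\mathbb{R}$ and $1\le r\le\min\{p,q\}$ with $p,q<\infty$. Then $\widetilde W^{1,(q,p)}_{\{a,b\}}$ is continuously embedded into $L^r(\mathbb{R}^N;|x|^cdx)$ (and hence into $\widetilde W^{1,(r,p)}_{\{c,b\}}$) in each of the following cases: (i) $a$ and $b-p$ are on the same side of $-N$ (including $-N$), $\frac{a+N}q\ne\frac{b-p+N}p$, and $c$ lies in the open interval with endpoints $c^0$ and $c^1$; (ii) $a$ and $b-p$ are strictly on opposite sides of $-N$ and $c$ lies in the open interval with endpoints $c^0$ and $-N$; (iii) $r=q\le p$ and $c=a$; (iv) $r=p\le q$, either ($a\le-N$ and $b-p<-N$) or ($a\ge-N$ and $b-p>-N$), and $c=b-p$.
   Context: $N\ge1$, $\mathbb{R}^N_*:=\mathbb{R}^N\setminus\{0\}$. For $d\in\mathbb{R}$, $0<s<\infty$, $\|u\|_{d,s}:=(\int_{\mathbb{R}^N}|x|^d|u|^s dx)^{1/s}$ ($\{0\}$ of measure $0$), $L^s(\mathbb{R}^N;|x|^ddx)$ the measurable $u$ with $\|u\|_{d,s}<\infty$. $\partial_\rho u:=\nabla u\cdot x/|x|$ for distributions on $\mathbb{R}^N_*$; $\widetilde W^{1,(q,p)}_{\{a,b\}}$ is the set of $u\in L^1_{loc}(\mathbb{R}^N_* )$ with $\|u\|_{a,q}<\infty$, $\|\partial_\rho u\|_{b,p}<\infty$, normed by $\|u\|_{a,q}+\|\partial_\rho u\|_{b,p}$. $c^0:=\frac{r(a+N)}{q}-N$, $c^1:=\frac{r(b-p+N)}{p}-N$.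 *)

theory Defs
  imports "HOL-Analysis.Analysis"
begin

fun iter_deriv :: "'a::euclidean_space list \<Rightarrow> ('a \<Rightarrow> real) \<Rightarrow> 'a \<Rightarrow> real" where
  "iter_deriv [] f = f"
| "iter_deriv (v # vs) f = (\<lambda>x. frechet_derivative (iter_deriv vs f) (at x) v)"

text \<open>C-infinity functions on the whole space: all iterated partial derivatives exist
  (and are differentiable, hence continuous).\<close>
definition smooth_fun :: "('a::euclidean_space \<Rightarrow> real) \<Rightarrow> bool" where
  "smooth_fun f \<longleftrightarrow> (\<forall>vs. set vs \<subseteq> Basis \<longrightarrow> (\<forall>x. iter_deriv vs f differentiable (at x)))"

definition test_fun_punct :: "('a::euclidean_space \<Rightarrow> real) \<Rightarrow> bool" where
  "test_fun_punct \<phi> \<longleftrightarrow> smooth_fun \<phi> \<and> compact (closure {x. \<phi> x \<noteq> 0})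
      \<and> 0 \<notin> closure {x. \<phi> x \<noteq> 0}"

definition loc_int_punct :: "('a::euclidean_space \<Rightarrow> real) \<Rightarrow> bool" where
  "loc_int_punct u \<longleftrightarrow> u \<in> borel_measurable lebesgue \<and>
     (\<forall>K. compact K \<and> 0 \<notin> K \<longrightarrow> set_integrable lebesgue K u)"

text \<open>g is the distributional radial derivative of u on the punctured space:
  for every test function, the pairing of u with -div(phi x/|x|) equals the pairing of g with phi,
  where div(phi x/|x|) = (grad phi . x/|x|) + (N-1) phi/|x|.\<close>
definition radial_deriv :: "('a::euclidean_space \<Rightarrow> real) \<Rightarrow> ('a \<Rightarrow> real) \<Rightarrow> bool" where
  "radial_deriv u g \<longleftrightarrow> loc_int_punct g \<and>
     (\<forall>\<phi>. test_fun_punct \<phi> \<longrightarrow>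
        (LINT x|lebesgue. u x * (frechet_derivative \<phi> (at x) (x /\<^sub>R norm x)
             + (real DIM('a) - 1) / norm x * \<phi> x))
        = - (LINT x|lebesgue. g x * \<phi> x))"

definition wint :: "real \<Rightarrow> real \<Rightarrow> ('a::euclidean_space \<Rightarrow> real) \<Rightarrow> ennreal" where
  "wint d s u = (\<integral>\<^sup>+ x. ennreal (norm x powr d * \<bar>u x\<bar> powr s) \<partial>lebesgue)"

definition wnorm :: "real \<Rightarrow> real \<Rightarrow> ('a::euclidean_space \<Rightarrow> real) \<Rightarrow> real" where
  "wnorm d s u = enn2real (wint d s u) powr (1 / s)"

definition in_Wtilde :: "real \<Rightarrow> real \<Rightarrow> real \<Rightarrow> real \<Rightarrow> ('a::euclidean_space \<Rightarrow> real) \<Rightarrow> ('a \<Rightarrow> real) \<Rightarrow> bool" where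
  "in_Wtilde q p a b u g \<longleftrightarrow> loc_int_punct u \<and> radial_deriv u g \<and>
     wint a q u < \<infinity> \<and> wint b p g < \<infinity>"

end

theory Submission
  imports Defs
begin

text \<open>
  The dilations \<open>x \<mapsto> e\<^sup>s x\<close> replace polar coordinates. Testing the weak radial derivative \<open>g\<close> of \<open>u\<close>
  against dilated test functions and applying Fubini shows that, for almost every \<open>x\<close>, the increments of
  \<open>w(s) = u(e\<^sup>s x)\<close> are controlled by the integrals of \<open>h(s) = |x| e\<^sup>s g(e\<^sup>s x)\<close>. The shell
  \<open>1 \<le> |x| < e\<close> parametrises the rays, so the claim reduces to a one-dimensional estimate for the weights
  \<open>e\<^bsup>As\<^esup>, e\<^bsup>Bs\<^esup>, e\<^bsup>Cs\<^esup>\<close> with \<open>A = a + N\<close>, \<open>B = b - p + N\<close>, \<open>C = c + N\<close>, in which the reflection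
  \<open>s \<mapsto> -s\<close> exchanges the origin and infinity. On a half-line, Young's inequality lowers the exponent to \<open>r\<close>
  at the cost of a strict inequality between the weights, and Hardy's inequality, in the form of a
  convolution with an exponential kernel, bounds \<open>w\<close> by \<open>h\<close>. It suffices to prove the inhomogeneous bound
  by \<open>1 + \<integral>|x|\<^sup>a|u|\<^sup>q + \<integral>|x|\<^sup>b|g|\<^sup>p\<close>, since scaling \<open>u\<close> recovers the norm inequality.
\<close>

section \<open>Bump functions supported in boxes\<close>

text \<open>No representative of \<open>u\<close> that is absolutely continuous along rays is
  constructed: increments between almost all pairs of times suffice, since each one-dimensional
  argument needs only one good base point or decay at infinity. With \<open>C = c + N\<close> the
  critical values for \<open>c\<close> become rA/q, rB/p and 0. At the end of the line where the
  weight of \<open>u\<close> beats \<open>C\<close>, Young's inequality is enough. At the other end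
  the bound must come from \<open>h\<close>, and the obstacle is constants, which \<open>h\<close>
  does not see. Either a finite weighted integral forbids them (A \<ge> 0 at plus infinity), or C <
  0 makes them integrable there. This is why 0 takes the place of rB/p when A and B have opposite
  signs. Young's inequality leaves a remainder that does not depend on \<open>w\<close>, which is
  the origin of the additive 1. The test functions are explicit because smoothness is stated through
  iterated derivatives: the family below is closed under partial derivatives, its undifferentiated
  members are closed under dilations, and they approximate indicators of boxes.\<close>

definition bump :: "real \<Rightarrow> real \<Rightarrow> real \<Rightarrow> real poly \<Rightarrow> nat \<Rightarrow> real \<Rightarrow> real" where
  "bump l r c p k t = (if l < t \<and> t < r
     then poly p t / ((t - l) * (r - t)) ^ k * exp (- c / ((t - l) * (r - t))) else 0)"

lemma power_div_fact_le_exp: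
  fixes x :: real
  assumes "x \<ge> 0"
  shows "x ^ m / fact m \<le> exp x"
proof -
  have 1: "(\<lambda>n. x ^ n / fact n) sums exp x"
    using exp_converges[of x] by (simp add: divide_inverse mult.commute)
  have 2: "(\<lambda>n. if n = m then x ^ n / fact n else 0) sums (x ^ m / fact m)"
    by (rule sums_single)
  show ?thesis
    by (rule sums_le[OF _ 2 1]) (use assms in simp)
qed

lemma exp_minus_inverse_le:
  fixes c y :: real
  assumes "c > 0" "y > 0"
  shows "exp (- c / y) \<le> fact m * (y / c) ^ m"
proof -
  have "(c / y) ^ m / fact m \<le> exp (c / y)"
    using assms by (intro power_div_fact_le_exp) auto
  then have "1 / exp (c / y) \<le> 1 / ((c / y) ^ m / fact m)"
    using assms by (intro divide_left_mono) auto
  then show ?thesis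
    using assms by (simp add: exp_minus inverse_eq_divide power_divide mult.commute)
qed

text \<open>The exponential beats the pole \<open>1 / y ^ k\<close> with two powers of
  \<open>y\<close> to spare. The quadratic vanishing at \<open>l\<close> and \<open>r\<close> is
  what forces the derivative there to be 0.\<close>

lemma bump_le:
  assumes c: "c > 0" and lr: "l < r"
  shows "\<exists>K. \<forall>t\<in>{l..r}. \<bar>bump l r c p k t\<bar> \<le> K * ((t - l) * (r - t))\<^sup>2"
proof -
  have "compact (poly p ` {l..r})"
    by (intro compact_continuous_image continuous_intros) auto
  from compact_imp_bounded[OF this] obtain M where "\<forall>x\<in>poly p ` {l..r}. norm x \<le> M"
    unfolding bounded_iff by blast
  then have M: "\<And>t. t \<in> {l..r} \<Longrightarrow> \<bar>poly p t\<bar> \<le> M"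
    by simp
  \<comment> \<open>Comes from \<open>exp_minus_inverse_le\<close> with \<open>m = k + 2\<close>:
    \<open>k\<close> powers cancel the pole and two remain.\<close>
  define K where "K = M * (fact (k + 2) / c ^ (k + 2))"
  have "\<bar>bump l r c p k t\<bar> \<le> K * ((t - l) * (r - t))\<^sup>2" if t: "t \<in> {l..r}" for t
  proof (cases "l < t \<and> t < r")
    case True
    define y where "y = (t - l) * (r - t)"
    have y: "y > 0" using True by (simp add: y_def)
    have M0: "M \<ge> 0" using M[OF t] by linarith
    have "\<bar>bump l r c p k t\<bar> = \<bar>poly p t\<bar> / y ^ k * exp (- c / y)"
      using True y by (simp add: bump_def abs_mult flip: y_def)
    also have "\<dots> \<le> M / y ^ k * (fact (k + 2) * (y / c) ^ (k + 2))"
      using M[OF t] M0 y c by (intro mult_mono divide_right_mono exp_minus_inverse_le) auto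
    also have "\<dots> = K * y\<^sup>2"
      using y c by (simp add: K_def power_divide power_add power2_eq_square)
    finally show ?thesis by (simp add: y_def)
  next
    case False
    have "M \<ge> 0" using M[OF t] by linarith
    then have "K \<ge> 0" using c by (simp add: K_def)
    then show ?thesis unfolding bump_def if_not_P[OF False] by simp
  qed
  then show ?thesis by blast
qed

lemma DERIV_zero_quadratic:
  fixes f :: "real \<Rightarrow> real"
  assumes "eventually (\<lambda>t. \<bar>f t\<bar> \<le> K * (t - x)\<^sup>2) (at x)" "f x = 0"
  shows "(f has_real_derivative 0) (at x)"
proof -
  have "((\<lambda>t. (f t - f x) / (t - x)) \<longlongrightarrow> 0) (at x)"
  proof (rule Lim_null_comparison)
    show "eventually (\<lambda>t. norm ((f t - f x) / (t - x)) \<le> K * \<bar>t - x\<bar>) (at x)"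
      using assms(1) eventually_neq_at_within[of x x UNIV]
    proof eventually_elim
      case (elim t)
      then have "\<bar>f t\<bar> \<le> (K * \<bar>t - x\<bar>) * \<bar>t - x\<bar>"
        by (simp add: power2_eq_square flip: abs_mult)
      then show ?case
        using elim assms(2) by (simp add: pos_divide_le_eq)
    qed
    show "((\<lambda>t. K * \<bar>t - x\<bar>) \<longlongrightarrow> 0) (at x)"
      by (rule tendsto_eq_intros refl | simp)+
  qed
  then show ?thesis by (simp add: has_field_derivative_iff)
qed

text \<open>Differentiating changes only the polynomial and raises the order of the pole by two, so
  the family is closed under derivatives with \<open>l\<close>, \<open>r\<close>, \<open>c\<close>
  fixed. This is the purpose of the parameters \<open>p\<close> and \<open>k\<close>.\<close>

lemma DERIV_bump:
  assumes c: "c > 0"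
  shows "\<exists>p'. \<forall>t. (bump l r c p k has_real_derivative bump l r c p' (k + 2) t) (at t)"
proof -
  define Q where "Q = [:- l, 1:] * [:r, - 1:]"
  \<comment> \<open>The product rule for \<open>p * Q ^ (- k) * exp (- c / Q)\<close>, with its
    three terms brought over the common denominator \<open>Q ^ (k + 2)\<close>.\<close>
  define p' where "p' = pderiv p * Q\<^sup>2 - smult (real k) (p * pderiv Q * Q) + smult c (p * pderiv Q)"
  have Q: "poly Q t = (t - l) * (r - t)" for t by (simp add: Q_def algebra_simps)
  have "(bump l r c p k has_real_derivative bump l r c p' (k + 2) t) (at t)" for t
  proof -
    consider "l < t" "t < r" | "t < l \<or> t > r" | "l < r" "t = l \<or> t = r" | "\<not> l < r"
      by linarith
    then show ?thesis
    proof cases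
      case 1
      have y: "poly Q t > 0" using 1 by (simp add: Q)
      have "((\<lambda>t. poly p t / poly Q t ^ k * exp (- c / poly Q t)) has_real_derivative
               poly p' t / poly Q t ^ (k + 2) * exp (- c / poly Q t)) (at t)"
      proof -
        define q e where "q = poly (pderiv Q) t" and "e = exp (- c / poly Q t)"
        have D: "((\<lambda>t. poly p t / poly Q t ^ k) has_real_derivative
            (poly (pderiv p) t * poly Q t - real k * poly p t * q) / poly Q t ^ Suc k) (at t)"
        proof (cases k)
          case 0
          then show ?thesis using y by (auto intro!: derivative_eq_intros poly_DERIV)
        next
          case (Suc m)
          define z where "z = poly Q t ^ m"
          have z: "z \<noteq> 0" using y by (simp add: z_def)
          have "((\<lambda>t. poly p t / poly Q t ^ Suc m) has_real_derivative
              (poly (pderiv p) t * poly Q t ^ Suc m - poly p t * ((1 + real m) * (q * poly Q t ^ m)))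
                / (poly Q t ^ Suc m * poly Q t ^ Suc m)) (at t)"
            using y unfolding q_def
            by (intro DERIV_divide DERIV_power_Suc poly_DERIV) auto
          also have "(poly (pderiv p) t * poly Q t ^ Suc m - poly p t * ((1 + real m) * (q * poly Q t ^ m)))
                / (poly Q t ^ Suc m * poly Q t ^ Suc m)
              = (poly (pderiv p) t * poly Q t - real k * poly p t * q) / poly Q t ^ Suc k"
            unfolding Suc power_Suc z_def[symmetric]
            using y z by (simp add: divide_simps) (simp add: algebra_simps)
          finally show ?thesis unfolding Suc .
        qed
        have E: "((\<lambda>t. exp (- c / poly Q t)) has_real_derivative c * q / (poly Q t)\<^sup>2 * e) (at t)"
          using y by (auto intro!: derivative_eq_intros poly_DERIV simp: q_def e_def power2_eq_square)
        have "(poly (pderiv p) t * poly Q t - real k * poly p t * q) / poly Q t ^ Suc k * e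
            + c * q / (poly Q t)\<^sup>2 * e * (poly p t / poly Q t ^ k)
          = poly p' t / poly Q t ^ (k + 2) * e"
          unfolding p'_def power_add power_Suc q_def[symmetric]
          using y by (simp add: divide_simps flip: q_def) (simp add: algebra_simps power2_eq_square)
        with DERIV_mult[OF D E] show ?thesis by (simp add: e_def)
      qed
      then have "((\<lambda>t. poly p t / poly Q t ^ k * exp (- c / poly Q t)) has_real_derivative
               bump l r c p' (k + 2) t) (at t)"
        using 1 by (simp add: bump_def Q)
      then show ?thesis
        by (rule has_field_derivative_transform_within_open[where S = "{l<..<r}"])
           (use 1 in \<open>auto simp: bump_def Q\<close>)
    next
      case 2
      have "((\<lambda>_. 0) has_real_derivative bump l r c p' (k + 2) t) (at t)"
        using 2 by (auto simp: bump_def)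
      moreover have "open ({..<l} \<union> {r<..})" by auto
      ultimately show ?thesis
        by (rule has_field_derivative_transform_within_open) (use 2 in \<open>auto simp: bump_def\<close>)
    next
      case 3
      obtain K where K: "\<And>s. s \<in> {l..r} \<Longrightarrow> \<bar>bump l r c p k s\<bar> \<le> K * ((s - l) * (r - s))\<^sup>2"
        using bump_le[OF c 3(1)] by blast
      \<comment> \<open>\<open>bump_le\<close> says nothing about the sign of \<open>K\<close>; it
        is read off at the midpoint, where the quadratic factor is positive.\<close>
      have K0: "K \<ge> 0"
      proof -
        define y where "y = ((l + r) / 2 - l) * (r - (l + r) / 2)"
        have "y > 0" using 3(1) by (simp add: y_def)
        moreover have "0 \<le> K * y\<^sup>2"
          using order_trans[OF abs_ge_zero K[of "(l + r) / 2"]] 3(1) unfolding y_def by auto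
        ultimately show ?thesis by (simp add: zero_le_mult_iff)
      qed
      have "\<bar>bump l r c p k s\<bar> \<le> K * (r - l)\<^sup>2 * (s - t)\<^sup>2" for s
      proof (cases "s \<in> {l..r}")
        case True
        have "(s - l) * (r - s) \<le> (r - l) * \<bar>s - t\<bar>"
          using 3 True by (auto simp: mult_mono mult.commute[of "s - l"] abs_if intro: mult_mono)
        then have "((s - l) * (r - s))\<^sup>2 \<le> ((r - l) * \<bar>s - t\<bar>)\<^sup>2"
          using True by (intro power_mono) auto
        then have "((s - l) * (r - s))\<^sup>2 \<le> (r - l)\<^sup>2 * (s - t)\<^sup>2"
          by (simp add: power_mult_distrib)
        from mult_left_mono[OF this K0] show ?thesis
          using K[OF True] by (simp add: mult.assoc)
      next
        case False
        then have "bump l r c p k s = 0" by (auto simp: bump_def)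
        then show ?thesis using K0 by simp
      qed
      then have "(bump l r c p k has_real_derivative 0) (at t)"
        using 3 by (intro DERIV_zero_quadratic[where K = "K * (r - l)\<^sup>2"]) (auto simp: bump_def)
      then show ?thesis using 3 by (auto simp: bump_def)
    next
      case 4
      then have "bump l r c p k = (\<lambda>_. 0)" for p k by (auto simp: bump_def)
      then show ?thesis by simp
    qed
  qed
  then show ?thesis by blast
qed

definition bump_box :: "'a::euclidean_space \<Rightarrow> 'a \<Rightarrow> real \<Rightarrow> 'a \<Rightarrow> real" where
  "bump_box l r c x = (\<Prod>i\<in>Basis. bump (l \<bullet> i) (r \<bullet> i) c 1 0 (x \<bullet> i))"

text \<open>A derivative in a basis direction \<open>j\<close> touches only the \<open>j\<close>-th
  factor, so products with coordinate-dependent \<open>P\<close> and \<open>K\<close> are again a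
  closed family. Differentiability is asserted for every \<open>j\<close>, the formula only for
  basis vectors.\<close>

lemma has_derivative_prod_bump:
  fixes l r :: "'a::euclidean_space"
  assumes c: "c > 0"
  shows "\<exists>P' K'. \<forall>x. (\<lambda>x. \<Prod>i\<in>Basis. bump (l \<bullet> i) (r \<bullet> i) c (P i) (K i) (x \<bullet> i)) differentiable (at x) \<and>
     (j \<in> Basis \<longrightarrow> frechet_derivative (\<lambda>x. \<Prod>i\<in>Basis. bump (l \<bullet> i) (r \<bullet> i) c (P i) (K i) (x \<bullet> i)) (at x) j
       = (\<Prod>i\<in>Basis. bump (l \<bullet> i) (r \<bullet> i) c (P' i) (K' i) (x \<bullet> i)))"
proof -
  have "\<forall>i. \<exists>p'. \<forall>t. (bump (l \<bullet> i) (r \<bullet> i) c (P i) (K i) has_real_derivative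
          bump (l \<bullet> i) (r \<bullet> i) c p' (K i + 2) t) (at t)"
    using DERIV_bump[OF c] by blast
  then obtain D where D: "\<And>i t. (bump (l \<bullet> i) (r \<bullet> i) c (P i) (K i) has_real_derivative
          bump (l \<bullet> i) (r \<bullet> i) c (D i) (K i + 2) t) (at t)"
    by metis
  define P' where "P' = P(j := D j)"
  define K' where "K' = K(j := K j + 2)"
  let ?f = "\<lambda>i x. bump (l \<bullet> i) (r \<bullet> i) c (P i) (K i) (x \<bullet> i)"
  let ?d = "\<lambda>i x. bump (l \<bullet> i) (r \<bullet> i) c (D i) (K i + 2) (x \<bullet> i)"
  have "(?f i has_derivative (\<lambda>v. ?d i x * (v \<bullet> i))) (at x)" for i x
    using has_derivative_compose[OF bounded_linear.has_derivative[OF bounded_linear_inner_left has_derivative_ident]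
       D[of i "x \<bullet> i", unfolded has_field_derivative_def]]
    by simp
  then have der: "((\<lambda>x. \<Prod>i\<in>Basis. ?f i x) has_derivative
      (\<lambda>v. \<Sum>i\<in>Basis. ?d i x * (v \<bullet> i) * (\<Prod>m\<in>Basis - {i}. ?f m x))) (at x)" for x
    by (rule has_derivative_prod)
  have "frechet_derivative (\<lambda>x. \<Prod>i\<in>Basis. ?f i x) (at x) j
       = (\<Prod>i\<in>Basis. bump (l \<bullet> i) (r \<bullet> i) c (P' i) (K' i) (x \<bullet> i))" if j: "j \<in> Basis" for x
  proof -
    have "frechet_derivative (\<lambda>x. \<Prod>i\<in>Basis. ?f i x) (at x) j
       = (\<Sum>i\<in>Basis. ?d i x * (j \<bullet> i) * (\<Prod>m\<in>Basis - {i}. ?f m x))"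
      by (rule fun_cong[OF frechet_derivative_at[OF der[of x]], symmetric])
    also have "\<dots> = (\<Sum>i\<in>{j}. ?d i x * (j \<bullet> i) * (\<Prod>m\<in>Basis - {i}. ?f m x))"
      using j by (intro sum.mono_neutral_right) (auto simp: inner_Basis)
    also have "\<dots> = (\<Prod>i\<in>Basis. bump (l \<bullet> i) (r \<bullet> i) c (P' i) (K' i) (x \<bullet> i))"
      using j by (subst prod.remove[where x = j]) (auto simp: P'_def K'_def intro!: prod.cong)
    finally show ?thesis .
  qed
  then show ?thesis using der unfolding differentiable_def by blast
qed

lemma iter_deriv_prod_bump:
  fixes l r :: "'a::euclidean_space"
  assumes c: "c > 0" and "set vs \<subseteq> Basis"
  shows "\<exists>P' K'. iter_deriv vs (\<lambda>x. \<Prod>i\<in>Basis. bump (l \<bullet> i) (r \<bullet> i) c (P i) (K i) (x \<bullet> i))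
     = (\<lambda>x. \<Prod>i\<in>Basis. bump (l \<bullet> i) (r \<bullet> i) c (P' i) (K' i) (x \<bullet> i))"
  using assms(2)
proof (induction vs)
  case (Cons v vs)
  then obtain P' K' where "iter_deriv vs (\<lambda>x. \<Prod>i\<in>Basis. bump (l \<bullet> i) (r \<bullet> i) c (P i) (K i) (x \<bullet> i))
     = (\<lambda>x. \<Prod>i\<in>Basis. bump (l \<bullet> i) (r \<bullet> i) c (P' i) (K' i) (x \<bullet> i))" by auto
  moreover have "v \<in> Basis" using Cons.prems by simp
  ultimately show ?case
    using has_derivative_prod_bump[OF c, of l r P' K' v] by auto
qed auto

lemma smooth_bump_box:
  assumes "c > 0"
  shows "smooth_fun (bump_box l r c)"
  unfolding smooth_fun_def bump_box_def
proof (intro allI impI)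
  fix vs :: "'a list" and x
  assume "set vs \<subseteq> Basis"
  from iter_deriv_prod_bump[OF assms this, of l r "\<lambda>_. 1" "\<lambda>_. 0"] obtain P' K' where
    "iter_deriv vs (\<lambda>x. \<Prod>i\<in>Basis. bump (l \<bullet> i) (r \<bullet> i) c 1 0 (x \<bullet> i))
     = (\<lambda>x. \<Prod>i\<in>Basis. bump (l \<bullet> i) (r \<bullet> i) c (P' i) (K' i) (x \<bullet> i))" by auto
  then show "iter_deriv vs (\<lambda>x. \<Prod>i\<in>Basis. bump (l \<bullet> i) (r \<bullet> i) c 1 0 (x \<bullet> i)) differentiable (at x)"
    \<comment> \<open>The direction 0 is a placeholder: only the differentiability part is
      wanted.\<close>
    using has_derivative_prod_bump[OF assms, of l r P' K' 0] by auto
qed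

lemma bump_box_eq_0: "bump_box l r c x = 0" if "x \<notin> box l r"
  using that by (auto simp: bump_box_def bump_def box_def)

lemma bump_nonneg: "bump l r c 1 0 t \<ge> 0" and bump_le_1: "c > 0 \<Longrightarrow> bump l r c 1 0 t \<le> 1"
  by (auto simp: bump_def)

lemma bump_box_nonneg: "bump_box l r c x \<ge> 0" and bump_box_le_1: "c > 0 \<Longrightarrow> bump_box l r c x \<le> 1"
  by (auto simp: bump_box_def intro!: prod_nonneg prod_le_1 bump_nonneg bump_le_1)

lemma abs_bump_box_le: "c > 0 \<Longrightarrow> \<bar>bump_box l r c x\<bar> \<le> indicator (cbox l r) x"
  using bump_box_eq_0[of x l r c] box_subset_cbox[of l r] bump_box_nonneg[of l r c x] bump_box_le_1[of c l r x]
  by (cases "x \<in> box l r") auto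

lemma test_fun_punct_bump_box:
  assumes "c > 0" "0 \<notin> cbox l r"
  shows "test_fun_punct (bump_box l r c)"
proof -
  have "closure {x. bump_box l r c x \<noteq> 0} \<subseteq> cbox l r"
    using bump_box_eq_0[of _ l r c] box_subset_cbox[of l r]
    by (intro closure_minimal) (auto simp: closed_cbox)
  moreover from this have "compact (closure {x. bump_box l r c x \<noteq> 0})"
    using compact_Int_closed[OF compact_cbox[of l r] closed_closure, of "{x. bump_box l r c x \<noteq> 0}"]
    by (simp add: Int_absorb1)
  ultimately show ?thesis
    using assms smooth_bump_box[OF assms(1)] unfolding test_fun_punct_def by blast
qed

text \<open>Inside the box \<open>exp (- c / y)\<close> tends to 1 as \<open>c\<close> tends to 0,
  outside everything is 0. This is the purpose of the parameter \<open>c\<close>.\<close>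

lemma bump_box_tendsto:
  "(\<lambda>n. bump_box l r (1 / real (Suc n)) x) \<longlonglongrightarrow> indicator (box l r) x"
proof -
  have lim: "(\<lambda>n. 1 / real (Suc n)) \<longlonglongrightarrow> 0"
    using LIMSEQ_inverse_real_of_nat by (simp add: inverse_eq_divide)
  have "(\<lambda>n. bump a b (1 / real (Suc n)) 1 0 t) \<longlonglongrightarrow> indicator {a<..<b} t" for a b t
  proof (cases "a < t \<and> t < b")
    case True
    have "(\<lambda>n. exp (- (1 / real (Suc n)) / ((t - a) * (b - t)))) \<longlonglongrightarrow> exp (- 0 / ((t - a) * (b - t)))"
      by (intro tendsto_intros lim) (use True in auto)
    then show ?thesis using True by (simp add: bump_def)
  qed (auto simp: bump_def)
  then have "(\<lambda>n. bump_box l r (1 / real (Suc n)) x) \<longlonglongrightarrow> (\<Prod>i\<in>Basis. indicator {l \<bullet> i<..<r \<bullet> i} (x \<bullet> i))"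
    unfolding bump_box_def by (intro tendsto_prod)
  also have "(\<Prod>i\<in>Basis. indicator {l \<bullet> i<..<r \<bullet> i} (x \<bullet> i)) = (indicator (box l r) x :: real)"
    by (auto simp: box_def indicator_def)
  finally show ?thesis .
qed

lemma borel_measurable_bump_box [measurable]: "c > 0 \<Longrightarrow> bump_box l r c \<in> borel_measurable borel"
  using smooth_bump_box[of c l r] unfolding smooth_fun_def
  by (auto dest!: spec[of _ "[]"] intro!: borel_measurable_continuous_onI differentiable_imp_continuous_on
      simp: differentiable_on_def differentiable_at_withinI)

section \<open>The fundamental lemma on the punctured space\<close>

text \<open>Countability, from Lindelof's theorem, allows the exceptional null sets of the single
  boxes to be united.\<close>

lemma exists_open_boxes_cover_punctured:
  "\<exists>F. countable F \<and> (\<forall>X\<in>F. \<exists>l r. X = box l r \<and> 0 \<notin> cbox l r) \<and>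
    \<Union>F = UNIV - {0 :: 'a::euclidean_space}"
proof -
  define G where "G = {box l r | l r. (0::'a) \<notin> cbox l r}"
  obtain F where F: "F \<subseteq> G" "countable F" "\<Union>F = \<Union>G"
    using Lindelof[of G] by (auto simp: G_def open_box)
  have "\<Union>G = UNIV - {0}"
  proof (intro equalityI subsetI)
    fix x :: 'a assume x: "x \<in> UNIV - {0}"
    have "open (UNIV - {0 :: 'a})" by auto
    from this x obtain l r where "cbox l r \<subseteq> UNIV - {0}" "x \<in> box l r" "\<forall>i\<in>Basis. l \<bullet> i < r \<bullet> i"
      by (rule open_contains_cbox)
    then show "x \<in> \<Union>G" by (auto simp: G_def)
  qed (use box_subset_cbox in \<open>auto simp: G_def\<close>)
  moreover have "\<forall>X\<in>F. \<exists>l r. X = box l r \<and> 0 \<notin> cbox l r"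
    using F(1) unfolding G_def by blast
  ultimately show ?thesis using F(2,3) by metis
qed

text \<open>Open boxes are stable under intersection and generate the Borel sets, so the Dynkin
  argument extends the vanishing to all Borel sets. The total integral enters in the complement
  step.\<close>

lemma AE_eq_0_if_box_integrals_eq_0:
  fixes f :: "'a::euclidean_space \<Rightarrow> real"
  assumes f: "integrable lborel f" and total: "(LINT x|lborel. f x) = 0"
    and box: "\<And>l r. (LINT x:box l r|lborel. f x) = 0"
  shows "AE x in lborel. f x = 0"
proof (rule sigma_finite_measure.density_zero[OF sigma_finite_lborel f])
  fix A :: "'a set" assume "A \<in> sets lborel"
  then have A: "A \<in> sigma_sets UNIV (range (\<lambda>(a, b). box a b :: 'a set))"
    by (simp add: borel_eq_box)
  have "Int_stable (range (\<lambda>(a, b). box a b :: 'a set))"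
    by (auto simp: Int_stable_def box_Int_box)
  moreover have "range (\<lambda>(a, b). box a b :: 'a set) \<subseteq> Pow UNIV" by simp
  ultimately show "(LINT x:A|lborel. f x) = 0"
    using A
  proof (induction rule: sigma_sets_induct_disjoint)
    case (compl A)
    have A[measurable]: "A \<in> sets borel"
      using compl(1) by (simp add: borel_eq_box)
    have int: "integrable lborel (\<lambda>x. indicator A x *\<^sub>R f x)"
      by (intro integrable_mult_indicator f) simp
    have "(LINT x:UNIV - A|lborel. f x) = (LINT x|lborel. f x) - (LINT x:A|lborel. f x)"
      unfolding set_lebesgue_integral_def Bochner_Integration.integral_diff[OF f int, symmetric]
      by (intro Bochner_Integration.integral_cong) (auto simp: indicator_def)
    then show ?case using total compl by simp
  next
    case (union A)
    have A: "A i \<in> sets lborel" for i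
      using union(2) by (auto simp: borel_eq_box)
    have "set_integrable lborel (\<Union>i. A i) f"
      unfolding set_integrable_def using A by (intro integrable_mult_indicator f sets.countable_UN) auto
    then have "(LINT x:(\<Union>i. A i)|lborel. f x) = (\<Sum>i. LINT x:A i|lborel. f x)"
      using union(1) A by (intro lebesgue_integral_countable_add) (auto simp: disjoint_family_on_def)
    then show ?case using union(3) by simp
  qed (use box in \<open>auto simp: set_lebesgue_integral_def\<close>)
qed

text \<open>Dominated convergence replaces bumps by indicators of boxes. Cutting \<open>v\<close>
  off to one box whose closure avoids the origin gives a globally integrable function, to which the
  previous criterion applies; the countable cover then glues the boxes together.\<close>

lemma AE_eq_0_if_bump_integrals_eq_0:
  fixes v :: "'a::euclidean_space \<Rightarrow> real"
  assumes int: "\<And>l r. 0 \<notin> cbox l r \<Longrightarrow> set_integrable lborel (cbox l r) v"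
    and bump: "\<And>l r c. c > 0 \<Longrightarrow> 0 \<notin> cbox l r \<Longrightarrow> (LINT x|lborel. v x * bump_box l r c x) = 0"
    and v[measurable]: "v \<in> borel_measurable borel"
  shows "AE x in lborel. v x = 0"
proof -
  have box_zero: "(LINT x:box l r|lborel. v x) = 0" if lr: "0 \<notin> cbox l r" for l r :: 'a
  proof -
    have "(\<lambda>n. LINT x|lborel. v x * bump_box l r (1 / real (Suc n)) x)
        \<longlonglongrightarrow> (LINT x|lborel. v x * indicator (box l r) x)"
    proof (rule integral_dominated_convergence[where w = "\<lambda>x. norm (indicator (cbox l r) x *\<^sub>R v x)"])
      show "integrable lborel (\<lambda>x. norm (indicator (cbox l r) x *\<^sub>R v x))"
        using int[OF lr] unfolding set_integrable_def by (rule integrable_norm)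
      show "AE x in lborel. (\<lambda>n. v x * bump_box l r (1 / real (Suc n)) x) \<longlonglongrightarrow> v x * indicator (box l r) x"
        by (intro AE_I2 tendsto_mult tendsto_const bump_box_tendsto)
      show "AE x in lborel. norm (v x * bump_box l r (1 / real (Suc n)) x)
          \<le> norm (indicator (cbox l r) x *\<^sub>R v x)" for n
      proof (rule AE_I2)
        fix x
        have "\<bar>bump_box l r (1 / real (Suc n)) x\<bar> \<le> indicator (cbox l r) x"
          using bump_box_eq_0[of x l r] box_subset_cbox[of l r] bump_box_nonneg[of l r _ x]
            bump_box_le_1[of "1 / real (Suc n)" l r x]
          by (cases "x \<in> box l r") (auto simp: subset_iff)
        then show "norm (v x * bump_box l r (1 / real (Suc n)) x) \<le> norm (indicator (cbox l r) x *\<^sub>R v x)"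
          by (auto simp: abs_mult mult.commute[of "\<bar>v x\<bar>"] intro: mult_right_mono)
      qed
    qed (auto intro!: borel_measurable_times borel_measurable_bump_box)
    moreover have "(LINT x|lborel. v x * bump_box l r (1 / real (Suc n)) x) = 0" for n
      by (rule bump[OF _ lr]) simp
    ultimately have "(\<lambda>n. 0) \<longlonglongrightarrow> (LINT x|lborel. v x * indicator (box l r) x)"
      by (simp only:)
    then have "(LINT x|lborel. v x * indicator (box l r) x) = 0"
      by (simp add: LIMSEQ_const_iff)
    then show ?thesis by (simp add: set_lebesgue_integral_def mult.commute)
  qed
  have local_zero: "AE x in lborel. x \<in> box L R \<longrightarrow> v x = 0" if LR: "0 \<notin> cbox L R" for L R :: 'a
  proof -
    have "AE x in lborel. indicator (box L R) x * v x = 0"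
    proof (rule AE_eq_0_if_box_integrals_eq_0)
      have "set_integrable lborel (box L R) v"
        using int[OF LR] by (rule set_integrable_subset) (auto simp: box_subset_cbox)
      then show "integrable lborel (\<lambda>x. indicator (box L R) x * v x)"
        by (simp add: set_integrable_def)
      show "(LINT x|lborel. indicator (box L R) x * v x) = 0"
        using box_zero[OF LR] by (simp add: set_lebesgue_integral_def)
      fix l r :: 'a
      \<comment> \<open>Corners of the intersection of the two boxes. It stays inside
        \<open>cbox L R\<close> and hence away from the origin.\<close>
      define l' r' where "l' = (\<Sum>i\<in>Basis. max (l \<bullet> i) (L \<bullet> i) *\<^sub>R i)"
        and "r' = (\<Sum>i\<in>Basis. min (r \<bullet> i) (R \<bullet> i) *\<^sub>R i)"
      have eq: "box l r \<inter> box L R = box l' r'"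
        by (simp add: box_Int_box l'_def r'_def)
      have "cbox l' r' \<subseteq> cbox L R"
        by (auto simp: mem_box l'_def r'_def)
      then have "(LINT x:box l' r'|lborel. v x) = 0"
        using LR by (intro box_zero) auto
      then show "(LINT x:box l r|lborel. indicator (box L R) x * v x) = 0"
        unfolding eq[symmetric] by (simp add: set_lebesgue_integral_def indicator_inter_arith mult.assoc)
    qed
    then show ?thesis by eventually_elim (auto simp: indicator_def)
  qed
  obtain F where F: "countable F" "\<And>X. X \<in> F \<Longrightarrow> \<exists>l r. X = box l r \<and> 0 \<notin> cbox l r"
    "\<Union>F = (UNIV - {0 :: 'a})"
    using exists_open_boxes_cover_punctured by metis
  have "AE x in lborel. x \<in> X \<longrightarrow> v x = 0" if "X \<in> F" for X
    using F(2)[OF that] local_zero by auto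
  then have "AE x in lborel. \<forall>X\<in>F. x \<in> X \<longrightarrow> v x = 0"
    unfolding AE_ball_countable[OF F(1)] by blast
  moreover have "AE x in lborel. x \<noteq> (0::'a)"
    by (rule AE_lborel_singleton)
  ultimately show ?thesis
  proof eventually_elim
    case (elim x)
    then have "x \<in> \<Union>F" using F(3) by simp
    then show ?case using elim(1) by blast
  qed
qed

section \<open>Dilations\<close>

lemma nn_integral_lborel_dilation:
  fixes f :: "'a::euclidean_space \<Rightarrow> ennreal"
  assumes [measurable]: "f \<in> borel_measurable borel" and k: "k > 0"
  shows "(\<integral>\<^sup>+x. f x \<partial>lborel) = ennreal (k ^ DIM('a)) * (\<integral>\<^sup>+x. f (k *\<^sub>R x) \<partial>lborel)"
  using k by (subst lborel_affine[of k 0])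
    (auto simp: nn_integral_density nn_integral_distr nn_integral_cmult)

lemma AE_lborel_dilation:
  assumes "AE x in lborel. P (x :: 'a::euclidean_space)" and k: "k > 0"
  shows "AE x in lborel. P (k *\<^sub>R x)"
proof -
  have "density (distr lborel borel (\<lambda>x. 0 + k *\<^sub>R x)) (\<lambda>_. \<bar>k\<bar> ^ DIM('a)) = (lborel :: 'a measure)"
    using k by (intro lborel_affine[symmetric]) simp
  then have "AE x in density (distr lborel borel (\<lambda>x. 0 + k *\<^sub>R x)) (\<lambda>_. \<bar>k\<bar> ^ DIM('a)). P x"
    using assms(1) by (simp only:)
  then have "AE x in distr lborel borel (\<lambda>x. 0 + k *\<^sub>R x). P (x :: 'a)"
    using k by (subst (asm) AE_density) auto
  from AE_distrD[OF _ this] show ?thesis by simp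
qed

lemma lborel_integral_dilation:
  fixes f :: "'a::euclidean_space \<Rightarrow> real"
  assumes [measurable]: "f \<in> borel_measurable borel" and k: "k > 0"
  shows "(LINT x|lborel. f x) = k ^ DIM('a) * (LINT x|lborel. f (k *\<^sub>R x))"
  using k by (subst lborel_affine[of k 0])
    (auto simp: integral_density integral_distr)

lemma integrable_lborel_dilation:
  fixes f :: "'a::euclidean_space \<Rightarrow> real"
  assumes f: "integrable lborel f" and k: "k > 0"
  shows "integrable lborel (\<lambda>x. f (k *\<^sub>R x))"
proof (rule integrableI_bounded)
  have [measurable]: "f \<in> borel_measurable borel" using f by auto
  show "(\<lambda>x. f (k *\<^sub>R x)) \<in> borel_measurable lborel" by measurable
  have "ennreal (k ^ DIM('a)) * (\<integral>\<^sup>+x. norm (f (k *\<^sub>R x)) \<partial>lborel) < \<infinity>"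
    using f k by (subst nn_integral_lborel_dilation[symmetric]) (auto simp: integrable_iff_bounded)
  then show "(\<integral>\<^sup>+x. norm (f (k *\<^sub>R x)) \<partial>lborel) < \<infinity>"
    using k by (auto simp: ennreal_mult_less_top less_top)
qed

lemma integrable_lborel_pairI:
  fixes F :: "real \<Rightarrow> 'a::euclidean_space \<Rightarrow> real"
  assumes [measurable]: "case_prod F \<in> borel_measurable (borel \<Otimes>\<^sub>M borel)"
    and "(\<integral>\<^sup>+s. \<integral>\<^sup>+x. ennreal \<bar>F s x\<bar> \<partial>lborel \<partial>lborel) < \<infinity>"
  shows "integrable (lborel \<Otimes>\<^sub>M lborel) (case_prod F)"
proof (rule integrableI_bounded)
  show m: "case_prod F \<in> borel_measurable (lborel \<Otimes>\<^sub>M lborel)"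
    by (simp add: measurable_cong_sets[OF sets_pair_measure_cong[OF sets_lborel sets_lborel] refl])
  have "(\<integral>\<^sup>+z. ennreal (norm (case_prod F z)) \<partial>(lborel \<Otimes>\<^sub>M lborel))
     = (\<integral>\<^sup>+s. \<integral>\<^sup>+x. ennreal (norm (case_prod F (s, x))) \<partial>lborel \<partial>lborel)"
    using m by (intro lborel.nn_integral_fst[symmetric]) measurable
  then show "(\<integral>\<^sup>+z. ennreal (norm (case_prod F z)) \<partial>(lborel \<Otimes>\<^sub>M lborel)) < \<infinity>"
    using assms(2) by simp
qed

section \<open>The divergence of radial test fields\<close>

text \<open>This is \<open>norm x\<close> times the divergence of \<phi> x/|x|. Without the factor
  1/|x| the expression is continuous on the whole space and built from the generator of
  dilations.\<close>

definition radial_div :: "('a::euclidean_space \<Rightarrow> real) \<Rightarrow> 'a \<Rightarrow> real" where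
  "radial_div \<phi> x = frechet_derivative \<phi> (at x) x + (real DIM('a) - 1) * \<phi> x"

text \<open>Smoothness controls derivatives in fixed basis directions, whereas here the direction
  moves with \<open>x\<close>; expanding \<open>x\<close> in the basis reduces the one to the
  other.\<close>

lemma continuous_on_radial_div:
  fixes \<phi> :: "'a::euclidean_space \<Rightarrow> real"
  assumes "smooth_fun \<phi>"
  shows "continuous_on UNIV (radial_div \<phi>)"
proof -
  have diff: "\<phi> differentiable (at x)" for x
    using assms unfolding smooth_fun_def by (auto dest!: spec[of _ "[]"])
  have "(\<lambda>x. frechet_derivative \<phi> (at x) i) differentiable (at x)" if "i \<in> Basis" for i x
    using assms that unfolding smooth_fun_def by (auto dest!: spec[of _ "[i]"])
  then have 1: "continuous_on UNIV (\<lambda>x. frechet_derivative \<phi> (at x) i)" if "i \<in> Basis" for i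
    using that by (intro differentiable_imp_continuous_on) (auto simp: differentiable_on_def)
  have 2: "continuous_on UNIV \<phi>"
    using diff by (intro differentiable_imp_continuous_on) (auto simp: differentiable_on_def)
  have "frechet_derivative \<phi> (at x) x = (\<Sum>i\<in>Basis. (x \<bullet> i) * frechet_derivative \<phi> (at x) i)" for x
  proof -
    have lin: "linear (frechet_derivative \<phi> (at x))" by (rule linear_frechet_derivative[OF diff])
    have "frechet_derivative \<phi> (at x) x = frechet_derivative \<phi> (at x) (\<Sum>i\<in>Basis. (x \<bullet> i) *\<^sub>R i)"
      by (simp only: euclidean_representation)
    also have "\<dots> = (\<Sum>i\<in>Basis. (x \<bullet> i) * frechet_derivative \<phi> (at x) i)"
      by (simp only: linear_sum[OF lin] linear_scale[OF lin] real_scaleR_def)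
    finally show ?thesis .
  qed
  then show ?thesis
    unfolding radial_div_def using 1 2 by (auto intro!: continuous_intros)
qed

lemma radial_div_eq_0:
  assumes "x \<notin> cbox l r"
  shows "radial_div (bump_box l r c) x = 0"
proof -
  have "((\<lambda>_. 0 :: real) has_derivative (\<lambda>_. 0)) (at x)" by simp
  then have "(bump_box l r c has_derivative (\<lambda>_. 0)) (at x)"
    by (rule has_derivative_transform_within_open[where s = "- cbox l r"])
       (use assms bump_box_eq_0[of _ l r c] box_subset_cbox[of l r] in \<open>auto simp: closed_cbox\<close>)
  then have "frechet_derivative (bump_box l r c) (at x) = (\<lambda>_. 0)"
    by (rule frechet_derivative_at[symmetric])
  then show ?thesis
    using assms bump_box_eq_0[of x l r c] box_subset_cbox[of l r] by (auto simp: radial_div_def)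
qed

text \<open>The quadratic (t - l)(r - t) is homogeneous of degree two, so a dilated bump is again a
  bump with \<open>c\<close> rescaled. Dilated bumps are therefore test functions without any chain
  rule for iterated derivatives.\<close>

lemma bump_box_dilation:
  assumes "k > 0"
  shows "bump_box l r c ((1 / k) *\<^sub>R x) = bump_box (k *\<^sub>R l) (k *\<^sub>R r) (k\<^sup>2 * c) x"
proof -
  have "bump a b c 1 0 (t / k) = bump (k * a) (k * b) (k\<^sup>2 * c) 1 0 t" for a b t
  proof -
    have "(t - k * a) * (k * b - t) = k\<^sup>2 * ((t / k - a) * (b - t / k))"
    proof -
      have "t - k * a = k * (t / k - a)" "k * b - t = k * (b - t / k)"
        using assms by (simp_all add: right_diff_distrib)
      then show ?thesis by (simp add: power2_eq_square)
    qed
    moreover have "a < t / k \<and> t / k < b \<longleftrightarrow> k * a < t \<and> t < k * b"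
      using assms by (simp add: pos_less_divide_eq pos_divide_less_eq mult.commute)
    ultimately show ?thesis
      using assms by (simp add: bump_def)
  qed
  then show ?thesis by (simp add: bump_box_def)
qed

text \<open>Differentiation along x commutes with dilations. For \<open>k = 1\<close> this rewrites
  the expression tested in \<open>radial_deriv\<close> as
  \<open>radial_div \<phi> x / norm x\<close>.\<close>

lemma radial_div_dilation:
  fixes \<phi> :: "'a::euclidean_space \<Rightarrow> real"
  assumes "\<And>x. \<phi> differentiable (at x)"
  shows "frechet_derivative (\<lambda>x. \<phi> (k *\<^sub>R x)) (at x) (x /\<^sub>R norm x)
      + (real DIM('a) - 1) / norm x * \<phi> (k *\<^sub>R x) = radial_div \<phi> (k *\<^sub>R x) / norm x"
proof -
  have D: "(\<phi> has_derivative frechet_derivative \<phi> (at (k *\<^sub>R x))) (at (k *\<^sub>R x))"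
    using assms by (simp add: frechet_derivative_works)
  have "((\<lambda>x. \<phi> (k *\<^sub>R x)) has_derivative (\<lambda>v. frechet_derivative \<phi> (at (k *\<^sub>R x)) (k *\<^sub>R v))) (at x)"
    by (rule has_derivative_compose[where g = \<phi> and f = "\<lambda>x. k *\<^sub>R x", OF _ D]) (auto intro!: derivative_eq_intros)
  then have "frechet_derivative (\<lambda>x. \<phi> (k *\<^sub>R x)) (at x) = (\<lambda>v. frechet_derivative \<phi> (at (k *\<^sub>R x)) (k *\<^sub>R v))"
    by (rule frechet_derivative_at[symmetric])
  moreover have "linear (frechet_derivative \<phi> (at (k *\<^sub>R x)))"
    using assms by (rule linear_frechet_derivative)
  ultimately show ?thesis
    by (simp add: radial_div_def linear_scale divide_inverse algebra_simps)
qed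

text \<open>The integrand is an exact derivative: the zeroth-order term of \<open>radial_div\<close>
  is precisely what differentiating the factor \<open>exp (- (N - 1) * s)\<close> produces, with N
  the dimension.\<close>

lemma integral_radial_div_along_ray:
  fixes \<phi> :: "'a::euclidean_space \<Rightarrow> real"
  assumes smooth: "smooth_fun \<phi>" and \<tau>: "0 \<le> \<tau>"
  shows "(LINT s|lborel. indicator {0..\<tau>} s *\<^sub>R (exp (- (real DIM('a) - 1) * s) * radial_div \<phi> (exp (- s) *\<^sub>R y)))
     = \<phi> y - exp (- (real DIM('a) - 1) * \<tau>) * \<phi> (exp (- \<tau>) *\<^sub>R y)"
proof -
  define n where "n = real DIM('a) - 1"
  have diff: "\<phi> differentiable (at x)" for x
    using smooth unfolding smooth_fun_def by (auto dest!: spec[of _ "[]"])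
  have "((\<lambda>s. - (exp (- n * s) * \<phi> (exp (- s) *\<^sub>R y))) has_vector_derivative
      exp (- n * s) * radial_div \<phi> (exp (- s) *\<^sub>R y)) (at s within {0..\<tau>})" for s
  proof -
    define D where "D = frechet_derivative \<phi> (at (exp (- s) *\<^sub>R y))"
    have lin: "linear D" unfolding D_def by (rule linear_frechet_derivative[OF diff])
    have D: "(\<phi> has_derivative D) (at (exp (- s) *\<^sub>R y))"
      using diff by (simp add: frechet_derivative_works D_def)
    have "((\<lambda>s. exp (- s) *\<^sub>R y) has_derivative (\<lambda>h. (- exp (- s) * h) *\<^sub>R y)) (at s)"
      by (auto intro!: derivative_eq_intros)
    from has_derivative_compose[OF this D]
    have "((\<lambda>s. \<phi> (exp (- s) *\<^sub>R y)) has_derivative (\<lambda>h. D ((- exp (- s) * h) *\<^sub>R y))) (at s)" .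
    also have "(\<lambda>h. D ((- exp (- s) * h) *\<^sub>R y)) = (*) (- D (exp (- s) *\<^sub>R y))"
      by (simp only: linear_scale[OF lin] scaleR_scaleR[symmetric] real_scaleR_def) (auto simp: fun_eq_iff linear_scale[OF lin])
    finally have "((\<lambda>s. \<phi> (exp (- s) *\<^sub>R y)) has_real_derivative - D (exp (- s) *\<^sub>R y)) (at s)"
      unfolding has_field_derivative_def .
    then have "((\<lambda>s. - (exp (- n * s) * \<phi> (exp (- s) *\<^sub>R y))) has_real_derivative
        exp (- n * s) * radial_div \<phi> (exp (- s) *\<^sub>R y)) (at s)"
      by (auto intro!: derivative_eq_intros simp: radial_div_def D_def n_def algebra_simps)
    then show ?thesis
      by (simp add: has_field_derivative_at_within has_real_derivative_iff_has_vector_derivative[symmetric])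
  qed
  moreover have "continuous_on {0..\<tau>} (\<lambda>s. exp (- n * s) * radial_div \<phi> (exp (- s) *\<^sub>R y))"
    by (intro continuous_intros continuous_on_compose2[OF continuous_on_radial_div[OF smooth]]) auto
  ultimately show ?thesis
    using \<tau> unfolding n_def[symmetric]
    by (subst integral_FTC_atLeastAtMost) auto
qed

section \<open>Increments along rays\<close>

text \<open>Borel functions and \<open>lborel\<close> instead of their completions, so that
  compositions with \<open>(s, x) \<mapsto> exp s x\<close> are jointly measurable and Fubini's
  theorem applies.\<close>

locale radial_pair =
  fixes u g :: "'a::euclidean_space \<Rightarrow> real"
  assumes borel_u [measurable]: "u \<in> borel_measurable borel"
    and borel_g [measurable]: "g \<in> borel_measurable borel"
    and int_u: "\<And>K. compact K \<Longrightarrow> 0 \<notin> K \<Longrightarrow> set_integrable lborel K u"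
    and int_g: "\<And>K. compact K \<Longrightarrow> 0 \<notin> K \<Longrightarrow> set_integrable lborel K g"
    and pairing: "\<And>\<phi>. test_fun_punct \<phi> \<Longrightarrow>
        (LINT x|lborel. u x * (frechet_derivative \<phi> (at x) (x /\<^sub>R norm x)
             + (real DIM('a) - 1) / norm x * \<phi> x)) = - (LINT x|lborel. g x * \<phi> x)"
begin

lemma pairing_dilated_bump:
  assumes "c > 0" "0 \<notin> cbox l r"
  shows "(LINT y|lborel. u y / norm y * radial_div (bump_box l r c) (exp (- s) *\<^sub>R y))
    = - (LINT y|lborel. g y * bump_box l r c (exp (- s) *\<^sub>R y))"
proof -
  define k where "k = exp s"
  have k: "k > 0" "exp (- s) = 1 / k" by (simp_all add: k_def exp_minus inverse_eq_divide)
  let ?\<phi> = "\<lambda>y. bump_box l r c ((1 / k) *\<^sub>R y)"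
  have "0 \<notin> cbox (k *\<^sub>R l) (k *\<^sub>R r)"
    using assms(2) k(1) by (auto simp: mem_box zero_le_mult_iff mult_le_0_iff)
  then have "test_fun_punct ?\<phi>"
    using assms(1) k(1) by (simp add: bump_box_dilation test_fun_punct_bump_box)
  moreover have diff: "bump_box l r c differentiable (at x)" for x
    using smooth_bump_box[OF assms(1), of l r] unfolding smooth_fun_def by (auto dest!: spec[of _ "[]"])
  ultimately show ?thesis
    using pairing[of ?\<phi>] unfolding k(2) radial_div_dilation[OF diff] by simp
qed

text \<open>For \<open>x\<close> in the box and \<open>s\<close> in \<open>{0..\<tau>}\<close> the
  point \<open>exp s x\<close> stays in a compact annulus off the origin, where \<open>g\<close> is
  integrable. The factor \<open>w\<close> is left general since both bumps and indicators of boxes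
  are needed.\<close>

lemma integrable_ray_pair:
  assumes l: "0 \<notin> cbox l r" and [measurable]: "w \<in> borel_measurable borel"
    and w: "\<And>x. \<bar>w x\<bar> \<le> indicator (cbox l r) x"
  shows "integrable (lborel \<Otimes>\<^sub>M lborel)
    (\<lambda>(s, x). indicator {0..\<tau>} s * (exp s * g (exp s *\<^sub>R x) * w x))"
proof (rule integrable_lborel_pairI)
  obtain d where d: "d > 0" "\<And>x. x \<in> cbox l r \<Longrightarrow> d \<le> norm x"
    using separate_point_closed[OF closed_cbox l] by (auto simp: dist_norm)
  obtain R where R: "\<And>x. x \<in> cbox l r \<Longrightarrow> norm x \<le> R"
    using bounded_cbox[of l r] by (auto simp: bounded_iff)
  define A where "A = {x :: 'a. d \<le> norm x \<and> norm x \<le> exp \<tau> * R}"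
  have "A = cball 0 (exp \<tau> * R) - ball 0 d" by (auto simp: A_def)
  then have "compact A" by (simp add: compact_diff)
  moreover have "0 \<notin> A" using d by (simp add: A_def)
  ultimately have "set_integrable lborel A g" by (rule int_g)
  then have fin: "(\<integral>\<^sup>+x. ennreal \<bar>indicator A x * g x\<bar> \<partial>lborel) < \<infinity>"
    unfolding set_integrable_def integrable_iff_bounded by simp
  have [measurable]: "A \<in> sets borel" by (simp add: A_def)
  have inner: "(\<integral>\<^sup>+x. ennreal \<bar>indicator {0..\<tau>} s * (exp s * g (exp s *\<^sub>R x) * w x)\<bar> \<partial>lborel)
      \<le> ennreal (exp \<tau>) * (\<integral>\<^sup>+x. ennreal \<bar>indicator A x * g x\<bar> \<partial>lborel) * indicator {0..\<tau>} s" for s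
  proof (cases "s \<in> {0..\<tau>}")
    case True
    have "(\<integral>\<^sup>+x. ennreal \<bar>indicator {0..\<tau>} s * (exp s * g (exp s *\<^sub>R x) * w x)\<bar> \<partial>lborel)
       \<le> (\<integral>\<^sup>+x. ennreal (exp \<tau>) * ennreal \<bar>indicator A (exp s *\<^sub>R x) * g (exp s *\<^sub>R x)\<bar> \<partial>lborel)"
    proof (rule nn_integral_mono)
      fix x :: 'a
      have "\<bar>w x\<bar> \<le> indicator A (exp s *\<^sub>R x)"
      proof (cases "x \<in> cbox l r")
        case x: True
        have "1 * d \<le> exp s * norm x" "exp s * norm x \<le> exp \<tau> * R"
          using True d(1) d(2)[OF x] R[OF x] by (intro mult_mono; simp)+
        then have "exp s *\<^sub>R x \<in> A" by (simp add: A_def)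
        then show ?thesis using w[of x] x by simp
      qed (use w[of x] in simp)
      then have "exp s * \<bar>g (exp s *\<^sub>R x)\<bar> * \<bar>w x\<bar>
          \<le> exp \<tau> * \<bar>g (exp s *\<^sub>R x)\<bar> * indicator A (exp s *\<^sub>R x)"
        using True by (intro mult_mono) auto
      then show "ennreal \<bar>indicator {0..\<tau>} s * (exp s * g (exp s *\<^sub>R x) * w x)\<bar>
         \<le> ennreal (exp \<tau>) * ennreal \<bar>indicator A (exp s *\<^sub>R x) * g (exp s *\<^sub>R x)\<bar>"
        using True by (simp add: abs_mult mult_ac flip: ennreal_mult)
    qed
    also have "\<dots> = ennreal (exp \<tau>) * (\<integral>\<^sup>+x. ennreal \<bar>indicator A (exp s *\<^sub>R x) * g (exp s *\<^sub>R x)\<bar> \<partial>lborel)"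
      by (rule nn_integral_cmult) measurable
    \<comment> \<open>The Jacobian of the dilation is at least 1 for s \<ge> 0 and is inserted only
      to allow the change of variables.\<close>
    also have "\<dots> \<le> ennreal (exp \<tau>) * (ennreal (exp s ^ DIM('a)) *
         (\<integral>\<^sup>+x. ennreal \<bar>indicator A (exp s *\<^sub>R x) * g (exp s *\<^sub>R x)\<bar> \<partial>lborel))"
    proof (rule mult_left_mono)
      have "1 \<le> ennreal (exp s ^ DIM('a))" using True by (simp add: one_le_power)
      from mult_right_mono[OF this] show "(\<integral>\<^sup>+x. ennreal \<bar>indicator A (exp s *\<^sub>R x) * g (exp s *\<^sub>R x)\<bar> \<partial>lborel)
          \<le> ennreal (exp s ^ DIM('a)) * (\<integral>\<^sup>+x. ennreal \<bar>indicator A (exp s *\<^sub>R x) * g (exp s *\<^sub>R x)\<bar> \<partial>lborel)"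
        by fastforce
    qed simp
    also have "\<dots> = ennreal (exp \<tau>) * (\<integral>\<^sup>+x. ennreal \<bar>indicator A x * g x\<bar> \<partial>lborel)"
      by (subst (2) nn_integral_lborel_dilation[of _ "exp s"]) auto
    finally show ?thesis using True by simp
  qed simp
  have "(\<integral>\<^sup>+s. \<integral>\<^sup>+x. ennreal \<bar>indicator {0..\<tau>} s * (exp s * g (exp s *\<^sub>R x) * w x)\<bar> \<partial>lborel \<partial>lborel)
      \<le> (\<integral>\<^sup>+s. ennreal (exp \<tau>) * (\<integral>\<^sup>+x. ennreal \<bar>indicator A x * g x\<bar> \<partial>lborel) * indicator {0..\<tau>} s \<partial>lborel)"
    by (intro nn_integral_mono inner)
  also have "\<dots> = ennreal (exp \<tau>) * (\<integral>\<^sup>+x. ennreal \<bar>indicator A x * g x\<bar> \<partial>lborel) * emeasure lborel {0..\<tau>}"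
    by (rule nn_integral_cmult_indicator) simp
  also have "\<dots> < \<infinity>"
    using fin by (auto simp: ennreal_mult_less_top emeasure_lborel_Icc_eq)
  finally show "(\<integral>\<^sup>+s. \<integral>\<^sup>+x. ennreal \<bar>indicator {0..\<tau>} s * (exp s * g (exp s *\<^sub>R x) * w x)\<bar> \<partial>lborel \<partial>lborel) < \<infinity>" .
qed measurable

text \<open>The same annulus serves, now for the image point \<open>y\<close>: the integrand
  vanishes unless \<open>exp (- s) y\<close> lies in the box, and there \<open>radial_div\<close> is
  bounded by compactness while \<open>1 / norm y\<close> is at most \<open>1 / d\<close>.\<close>

lemma integrable_radial_div_pair:
  assumes c: "c > 0" and l: "0 \<notin> cbox l r"
  shows "integrable (lborel \<Otimes>\<^sub>M lborel) (\<lambda>(s, y). indicator {0..\<tau>} s *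
    (exp (- (real DIM('a) - 1) * s) * (u y / norm y * radial_div (bump_box l r c) (exp (- s) *\<^sub>R y))))"
proof (rule integrable_lborel_pairI)
  let ?\<chi> = "radial_div (bump_box l r c)"
  have cont: "continuous_on S ?\<chi>" for S
    by (rule continuous_on_subset[OF continuous_on_radial_div[OF smooth_bump_box[OF c]]]) simp
  have [measurable]: "?\<chi> \<in> borel_measurable borel"
    using cont by (rule borel_measurable_continuous_onI)
  have "compact (?\<chi> ` cbox l r)"
    by (intro compact_continuous_image cont compact_cbox)
  from compact_imp_bounded[OF this] obtain M0 where M0: "\<forall>x\<in>?\<chi> ` cbox l r. norm x \<le> M0"
    unfolding bounded_iff by blast
  define M where "M = max 0 M0"
  have M: "\<bar>?\<chi> x\<bar> \<le> M * indicator (cbox l r) x" "M \<ge> 0" for x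
    using M0 radial_div_eq_0[of x l r c] by (auto simp: M_def indicator_def)
  obtain d where d: "d > 0" "\<And>x. x \<in> cbox l r \<Longrightarrow> d \<le> norm x"
    using separate_point_closed[OF closed_cbox l] by (auto simp: dist_norm)
  obtain R where R: "\<And>x. x \<in> cbox l r \<Longrightarrow> norm x \<le> R"
    using bounded_cbox[of l r] by (auto simp: bounded_iff)
  define A where "A = {x :: 'a. d \<le> norm x \<and> norm x \<le> exp \<tau> * R}"
  have "A = cball 0 (exp \<tau> * R) - ball 0 d" by (auto simp: A_def)
  then have "compact A" by (simp add: compact_diff)
  moreover have "0 \<notin> A" using d by (simp add: A_def)
  ultimately have "set_integrable lborel A u" by (rule int_u)
  then have fin: "(\<integral>\<^sup>+x. ennreal \<bar>indicator A x * u x\<bar> \<partial>lborel) < \<infinity>"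
    unfolding set_integrable_def integrable_iff_bounded by simp
  have [measurable]: "A \<in> sets borel" by (simp add: A_def)
  let ?F = "\<lambda>s y. indicator {0..\<tau>} s *
    (exp (- (real DIM('a) - 1) * s) * (u y / norm y * ?\<chi> (exp (- s) *\<^sub>R y)))"
  show "(\<lambda>(s, y). ?F s y) \<in> borel_measurable (borel \<Otimes>\<^sub>M borel)" by measurable
  have bound: "\<bar>?F s y\<bar> \<le> M / d * \<bar>indicator A y * u y\<bar> * indicator {0..\<tau>} s" for s y
  proof (cases "s \<in> {0..\<tau>} \<and> exp (- s) *\<^sub>R y \<in> cbox l r")
    case True
    define x where "x = exp (- s) *\<^sub>R y"
    have y: "y = exp s *\<^sub>R x" by (simp add: x_def flip: exp_add)
    have x: "x \<in> cbox l r" using True by (simp add: x_def)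
    have "1 * d \<le> exp s * norm x" "exp s * norm x \<le> exp \<tau> * R"
      using True d(1) d(2)[OF x] R[OF x] by (intro mult_mono; simp)+
    then have ny: "d \<le> norm y" and yA: "y \<in> A" by (simp_all add: y A_def)
    have "exp (- (real DIM('a) - 1) * s) \<le> 1"
      using True DIM_ge_Suc0[where 'a = 'a] by (simp add: mult_nonpos_nonneg)
    moreover have "\<bar>u y\<bar> / norm y \<le> \<bar>u y\<bar> / d"
      using ny d(1) by (intro divide_left_mono mult_pos_pos) auto
    moreover have "\<bar>?\<chi> x\<bar> \<le> M" using M(1)[of x] x by simp
    ultimately have "exp (- (real DIM('a) - 1) * s) * (\<bar>u y\<bar> / norm y * \<bar>?\<chi> x\<bar>) \<le> 1 * (\<bar>u y\<bar> / d * M)"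
      using d(1) by (intro mult_mono) auto
    then show ?thesis
      using True yA by (simp add: abs_mult x_def[symmetric] mult_ac)
  next
    case False
    then have 0: "?F s y = 0" using radial_div_eq_0[of "exp (- s) *\<^sub>R y" l r c] by (auto simp: indicator_def)
    show ?thesis unfolding 0 using M(2) d(1) by simp
  qed
  have "(\<integral>\<^sup>+s. \<integral>\<^sup>+y. ennreal \<bar>?F s y\<bar> \<partial>lborel \<partial>lborel)
     \<le> (\<integral>\<^sup>+s. \<integral>\<^sup>+y. ennreal (M / d) * ennreal \<bar>indicator A y * u y\<bar> * indicator {0..\<tau>} s \<partial>lborel \<partial>lborel)"
    using M(2) d(1)
    by (intro nn_integral_mono order_trans[OF ennreal_leI[OF bound]])
       (simp add: indicator_def split: if_splits flip: ennreal_mult)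
  also have "\<dots> = (\<integral>\<^sup>+s. ennreal (M / d) * (\<integral>\<^sup>+y. ennreal \<bar>indicator A y * u y\<bar> \<partial>lborel) * indicator {0..\<tau>} s \<partial>lborel)"
    by (simp add: nn_integral_cmult nn_integral_multc)
  also have "\<dots> = ennreal (M / d) * (\<integral>\<^sup>+x. ennreal \<bar>indicator A x * u x\<bar> \<partial>lborel) * emeasure lborel {0..\<tau>}"
    by (rule nn_integral_cmult_indicator) simp
  also have "\<dots> < \<infinity>"
    using fin by (auto simp: ennreal_mult_less_top emeasure_lborel_Icc_eq)
  finally show "(\<integral>\<^sup>+s. \<integral>\<^sup>+y. ennreal \<bar>?F s y\<bar> \<partial>lborel \<partial>lborel) < \<infinity>" .
qed

section \<open>The fundamental theorem of calculus along rays, in weak form\<close>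

lemma set_integrable_div_norm:
  assumes K: "compact K" "0 \<notin> K" and "set_integrable lborel K f" and [measurable]: "f \<in> borel_measurable borel"
  shows "set_integrable lborel K (\<lambda>x. f x / norm x)"
proof -
  obtain d where d: "d > 0" "\<And>x. x \<in> K \<Longrightarrow> d \<le> norm x"
    using separate_point_closed[OF compact_imp_closed[OF K(1)] K(2)] by (auto simp: dist_norm)
  have [measurable]: "K \<in> sets borel" using K(1) by (simp add: borel_compact)
  have "integrable lborel (\<lambda>x. 1 / d * (indicator K x *\<^sub>R f x))"
    using assms(3) unfolding set_integrable_def by (rule integrable_mult_right)
  then show ?thesis
    unfolding set_integrable_def
  proof (rule Bochner_Integration.integrable_bound)
    show "AE x in lborel. norm (indicator K x *\<^sub>R (f x / norm x)) \<le> norm (1 / d * (indicator K x *\<^sub>R f x))"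
    proof (rule AE_I2)
      fix x
      have "\<bar>f x\<bar> / norm x \<le> \<bar>f x\<bar> / d" if "x \<in> K"
        using d(1) d(2)[OF that] by (intro divide_left_mono mult_pos_pos) auto
      then show "norm (indicator K x *\<^sub>R (f x / norm x)) \<le> norm (1 / d * (indicator K x *\<^sub>R f x))"
        using d(1) by (simp add: indicator_def)
    qed
  qed measurable
qed

lemma set_integrable_dilated:
  assumes K: "compact K" "0 \<notin> K"
  shows "set_integrable lborel K (\<lambda>x. u (exp s *\<^sub>R x))"
proof -
  have "compact ((*\<^sub>R) (exp s) ` K)" using K(1) by (rule compact_scaling)
  moreover have "0 \<notin> (*\<^sub>R) (exp s) ` K" using K(2) by auto
  ultimately have "set_integrable lborel ((*\<^sub>R) (exp s) ` K) u" by (rule int_u)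
  then have "integrable lborel (\<lambda>x. indicator ((*\<^sub>R) (exp s) ` K) (exp s *\<^sub>R x) *\<^sub>R u (exp s *\<^sub>R x))"
    unfolding set_integrable_def by (rule integrable_lborel_dilation) simp
  moreover have "(exp s *\<^sub>R x \<in> (*\<^sub>R) (exp s) ` K) = (x \<in> K)" for x by auto
  ultimately show ?thesis by (simp add: set_integrable_def indicator_def)
qed

lemma integrable_times_bump:
  assumes c: "c > 0" and "set_integrable lborel (cbox l r) f" and [measurable]: "f \<in> borel_measurable borel"
  shows "integrable lborel (\<lambda>x. f x * bump_box l r c x)"
  using assms(2) unfolding set_integrable_def
proof (rule Bochner_Integration.integrable_bound)
  note borel_measurable_bump_box[OF c, of l r, measurable]
  show "(\<lambda>x. f x * bump_box l r c x) \<in> borel_measurable lborel" by measurable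
  show "AE x in lborel. norm (f x * bump_box l r c x) \<le> norm (indicator (cbox l r) x *\<^sub>R f x)"
  proof (rule AE_I2)
    fix x
    show "norm (f x * bump_box l r c x) \<le> norm (indicator (cbox l r) x *\<^sub>R f x)"
      using abs_bump_box_le[OF c, of l r x] mult_left_mono[of "\<bar>bump_box l r c x\<bar>" "indicator (cbox l r) x" "\<bar>f x\<bar>"]
      by (simp add: abs_mult mult.commute)
  qed
qed

text \<open>The pairing with the bump dilated by \<open>exp s\<close> is multiplied by
  \<open>exp (- n * s)\<close> and integrated over \<open>s\<close>. Fubini turns the side of
  \<open>u\<close> into an integral of an exact derivative, whose boundary terms become the
  increment of \<open>u\<close> after a change of variables; the side of \<open>g\<close> becomes
  the integral of \<open>g\<close> along the ray.\<close>

lemma integral_dilated_difference: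
  assumes c: "c > 0" and l: "0 \<notin> cbox l r" and \<tau>: "0 \<le> \<tau>"
  shows "(LINT x|lborel. (u (exp \<tau> *\<^sub>R x) - u x) / norm x * bump_box l r c x)
    = (LINT x|lborel. (LINT s|lborel. indicator {0..\<tau>} s * (exp s * g (exp s *\<^sub>R x))) * bump_box l r c x)"
proof -
  define n where "n = real DIM('a) - 1"
  define \<psi> where "\<psi> = bump_box l r c"
  define \<rho> where "\<rho> = radial_div \<psi>"
  have [measurable]: "\<psi> \<in> borel_measurable borel"
    using c by (simp add: \<psi>_def borel_measurable_bump_box)
  have smooth: "smooth_fun \<psi>" using c by (simp add: \<psi>_def smooth_bump_box)
  \<comment> \<open>The first factor of the Jacobian cancels the weight
    \<open>exp (- n * s)\<close>; the second remains as the speed of the flow in front of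
    \<open>g\<close>.\<close>
  have pow: "exp s ^ DIM('a) = exp (n * s) * exp s" for s
    by (simp add: n_def left_diff_distrib flip: exp_of_nat_mult exp_add)
  define F where "F = (\<lambda>s y. indicator {0..\<tau>} s * (exp (- n * s) * (u y / norm y * \<rho> (exp (- s) *\<^sub>R y))))"
  have F: "integrable (lborel \<Otimes>\<^sub>M lborel) (case_prod F)"
    using integrable_radial_div_pair[OF c l, of \<tau>] by (simp add: F_def n_def \<rho>_def \<psi>_def case_prod_beta')
  define G where "G = (\<lambda>s x. indicator {0..\<tau>} s * (exp s * g (exp s *\<^sub>R x) * \<psi> x))"
  have "integrable (lborel \<Otimes>\<^sub>M lborel)
    (\<lambda>(s, x). indicator {0..\<tau>} s * (exp s * g (exp s *\<^sub>R x) * \<psi> x))"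
    using abs_bump_box_le[OF c, of l r] by (intro integrable_ray_pair[OF l]) (auto simp: \<psi>_def c)
  then have G: "integrable (lborel \<Otimes>\<^sub>M lborel) (case_prod G)"
    by (simp add: G_def)
  have dil: "integrable lborel (\<lambda>x. u (exp s *\<^sub>R x) / norm x * \<psi> x)" for s
    unfolding \<psi>_def using l
    by (intro integrable_times_bump c set_integrable_div_norm set_integrable_dilated compact_cbox) auto
  have dil0: "integrable lborel (\<lambda>x. u x / norm x * \<psi> x)" using dil[of 0] by simp
  have dil_eq: "u (exp \<tau> *\<^sub>R x) / norm (exp \<tau> *\<^sub>R x) * \<psi> (exp (- \<tau>) *\<^sub>R (exp \<tau> *\<^sub>R x))
      = exp (- \<tau>) * (u (exp \<tau> *\<^sub>R x) / norm x * \<psi> x)" for x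
    by (simp add: exp_minus divide_inverse flip: exp_add)
  have "integrable lborel (\<lambda>x. (u (exp \<tau> *\<^sub>R (exp (- \<tau>) *\<^sub>R x)) / norm (exp (- \<tau>) *\<^sub>R x) * \<psi> (exp (- \<tau>) *\<^sub>R x)))"
    by (rule integrable_lborel_dilation[OF dil]) simp
  then have "integrable lborel (\<lambda>x. exp (- \<tau>) * (u (exp \<tau> *\<^sub>R (exp (- \<tau>) *\<^sub>R x)) / norm (exp (- \<tau>) *\<^sub>R x) * \<psi> (exp (- \<tau>) *\<^sub>R x)))"
    by (rule integrable_mult_right)
  then have dil': "integrable lborel (\<lambda>x. u x / norm x * \<psi> (exp (- \<tau>) *\<^sub>R x))"
    by (simp flip: exp_add)
  have "(LINT x|lborel. u x / norm x * \<psi> (exp (- \<tau>) *\<^sub>R x))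
      = exp \<tau> ^ DIM('a) * (LINT x|lborel. exp (- \<tau>) * (u (exp \<tau> *\<^sub>R x) / norm x * \<psi> x))"
    by (subst lborel_integral_dilation[of _ "exp \<tau>"]) (simp_all only: dil_eq exp_gt_zero, measurable)
  also have "\<dots> = exp (n * \<tau>) * (LINT x|lborel. u (exp \<tau> *\<^sub>R x) / norm x * \<psi> x)"
    unfolding pow integral_mult_right_zero by (simp add: exp_minus)
  finally have shift: "(LINT x|lborel. u (exp \<tau> *\<^sub>R x) / norm x * \<psi> x)
      = exp (- n * \<tau>) * (LINT x|lborel. u x / norm x * \<psi> (exp (- \<tau>) *\<^sub>R x))"
    by (simp add: exp_minus)
  have "(LINT x|lborel. (u (exp \<tau> *\<^sub>R x) - u x) / norm x * \<psi> x)
      = (LINT x|lborel. u (exp \<tau> *\<^sub>R x) / norm x * \<psi> x) - (LINT x|lborel. u x / norm x * \<psi> x)"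
    using dil[of \<tau>] dil0 by (subst Bochner_Integration.integral_diff[symmetric])
      (auto simp: diff_divide_distrib left_diff_distrib)
  also have "\<dots> = (LINT x|lborel. exp (- n * \<tau>) * (u x / norm x * \<psi> (exp (- \<tau>) *\<^sub>R x)) - u x / norm x * \<psi> x)"
    by (simp only: shift integral_mult_right_zero
        Bochner_Integration.integral_diff[OF integrable_mult_right[OF dil'] dil0])
  also have "\<dots> = (LINT x|lborel. - (LINT s|lborel. F s x))"
  proof (rule Bochner_Integration.integral_cong[OF refl])
    fix y
    have "(LINT s|lborel. F s y) = (LINT s|lborel. u y / norm y *
        (indicator {0..\<tau>} s *\<^sub>R (exp (- n * s) * \<rho> (exp (- s) *\<^sub>R y))))"
      unfolding F_def by (intro Bochner_Integration.integral_cong) auto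
    also have "\<dots> = u y / norm y * (\<psi> y - exp (- n * \<tau>) * \<psi> (exp (- \<tau>) *\<^sub>R y))"
      unfolding integral_mult_right_zero \<rho>_def n_def integral_radial_div_along_ray[OF smooth \<tau>] ..
    finally show "exp (- n * \<tau>) * (u y / norm y * \<psi> (exp (- \<tau>) *\<^sub>R y)) - u y / norm y * \<psi> y
        = - (LINT s|lborel. F s y)"
      by (simp add: right_diff_distrib)
  qed
  also have "\<dots> = - (LINT s|lborel. LINT x|lborel. F s x)"
    using lborel_pair.Fubini_integral[OF F] by simp
  also have "\<dots> = - (LINT s|lborel. - (LINT x|lborel. G s x))"
  proof (intro arg_cong[where f = uminus] Bochner_Integration.integral_cong[OF refl])
    fix s
    have "(LINT x|lborel. F s x) = indicator {0..\<tau>} s * (exp (- n * s) *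
        (LINT x|lborel. u x / norm x * \<rho> (exp (- s) *\<^sub>R x)))"
      by (simp only: F_def integral_mult_right_zero)
    also have "(LINT x|lborel. u x / norm x * \<rho> (exp (- s) *\<^sub>R x)) = - (LINT x|lborel. g x * \<psi> (exp (- s) *\<^sub>R x))"
      unfolding \<rho>_def \<psi>_def by (rule pairing_dilated_bump[OF c l])
    also have "(LINT x|lborel. g x * \<psi> (exp (- s) *\<^sub>R x))
        = exp s ^ DIM('a) * (LINT x|lborel. g (exp s *\<^sub>R x) * \<psi> (exp (- s) *\<^sub>R exp s *\<^sub>R x))"
      by (rule lborel_integral_dilation) auto
    also have "\<dots> = exp (n * s) * (exp s * (LINT x|lborel. g (exp s *\<^sub>R x) * \<psi> x))"
      unfolding pow by (simp flip: exp_add)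
    finally have "(LINT x|lborel. F s x)
        = - (indicator {0..\<tau>} s * (exp s * (LINT x|lborel. g (exp s *\<^sub>R x) * \<psi> x)))"
      by (simp add: exp_minus)
    also have "\<dots> = - (LINT x|lborel. G s x)"
      by (simp add: G_def mult.assoc)
    finally show "(LINT x|lborel. F s x) = - (LINT x|lborel. G s x)" .
  qed
  also have "\<dots> = (LINT x|lborel. LINT s|lborel. G s x)"
    using lborel_pair.Fubini_integral[OF G] by simp
  also have "\<dots> = (LINT x|lborel. (LINT s|lborel. indicator {0..\<tau>} s * (exp s * g (exp s *\<^sub>R x))) * \<psi> x)"
    unfolding G_def by (simp add: mult.assoc[symmetric])
  finally show ?thesis by (simp add: \<psi>_def)
qed

text \<open>The identity tested against all bumps holds almost everywhere by the fundamental lemma;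
  only the absolute value of the increment is kept.\<close>

lemma dilated_difference_le:
  assumes \<tau>: "0 \<le> \<tau>"
  shows "AE x in lborel. ennreal \<bar>u (exp \<tau> *\<^sub>R x) - u x\<bar>
    \<le> (\<integral>\<^sup>+s. ennreal \<bar>norm x * exp s * g (exp s *\<^sub>R x)\<bar> * indicator {0..\<tau>} s \<partial>lborel)"
proof -
  define J where "J = (\<lambda>x. LINT s|lborel. indicator {0..\<tau>} s * (exp s * g (exp s *\<^sub>R x)))"
  define d where "d = (\<lambda>x. (u (exp \<tau> *\<^sub>R x) - u x) / norm x)"
  have J[measurable]: "J \<in> borel_measurable borel"
    unfolding J_def by measurable
  have d[measurable]: "d \<in> borel_measurable borel"
    unfolding d_def by measurable
  have int_d: "set_integrable lborel (cbox l r) d" if "0 \<notin> cbox l r" for l r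
    unfolding d_def using that set_integrable_dilated[of "cbox l r" 0]
    by (intro set_integrable_div_norm compact_cbox set_integral_diff(1) set_integrable_dilated) auto
  have int_J: "set_integrable lborel (cbox l r) J" if "0 \<notin> cbox l r" for l r
  proof -
    have "integrable (lborel \<Otimes>\<^sub>M lborel)
      (\<lambda>(s, x). indicator {0..\<tau>} s * (exp s * g (exp s *\<^sub>R x) * indicator (cbox l r) x))"
      by (rule integrable_ray_pair[OF that]) auto
    note lborel_pair.integrable_snd[OF this]
    also have "(\<lambda>x. LINT s|lborel. indicator {0..\<tau>} s * (exp s * g (exp s *\<^sub>R x) * indicator (cbox l r) x))
        = (\<lambda>x. indicator (cbox l r) x *\<^sub>R J x)"
      unfolding J_def real_scaleR_def integral_mult_right_zero[symmetric]
      by (intro ext Bochner_Integration.integral_cong) auto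
    finally show ?thesis unfolding set_integrable_def .
  qed
  have "AE x in lborel. d x - J x = 0"
  proof (rule AE_eq_0_if_bump_integrals_eq_0)
    fix l r :: 'a and c :: real assume c: "c > 0" and l: "0 \<notin> cbox l r"
    have "(LINT x|lborel. d x * bump_box l r c x) = (LINT x|lborel. J x * bump_box l r c x)"
      using integral_dilated_difference[OF c l \<tau>] unfolding J_def d_def .
    then show "(LINT x|lborel. (d x - J x) * bump_box l r c x) = 0"
      using integrable_times_bump[OF c int_d[OF l] d] integrable_times_bump[OF c int_J[OF l] J]
      by (simp add: left_diff_distrib)
  qed (use int_d int_J in \<open>auto intro: set_integral_diff\<close>)
  moreover have "AE x in lborel. x \<noteq> (0 :: 'a)"
    by (rule AE_lborel_singleton)
  ultimately show ?thesis
  proof eventually_elim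
    case (elim x)
    have "u (exp \<tau> *\<^sub>R x) - u x = norm x * J x"
      using elim by (simp add: d_def divide_eq_eq)
    also have "\<dots> = (LINT s|lborel. indicator {0..\<tau>} s * (norm x * exp s * g (exp s *\<^sub>R x)))"
      unfolding J_def integral_mult_right_zero[symmetric]
      by (intro Bochner_Integration.integral_cong) auto
    \<comment> \<open>If the integrand is not integrable on this ray, the Bochner integral is 0 by
      convention and the bound is trivial, so finiteness along single rays is not at issue.\<close>
    finally have "ennreal \<bar>u (exp \<tau> *\<^sub>R x) - u x\<bar> \<le>
        (\<integral>\<^sup>+s. ennreal \<bar>indicator {0..\<tau>} s * (norm x * exp s * g (exp s *\<^sub>R x))\<bar> \<partial>lborel)"
      using integral_norm_bound_ennreal[of lborel "\<lambda>s. indicator {0..\<tau>} s * (norm x * exp s * g (exp s *\<^sub>R x))"]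
      by (cases "integrable lborel (\<lambda>s. indicator {0..\<tau>} s * (norm x * exp s * g (exp s *\<^sub>R x)))")
         (auto simp: not_integrable_integral_eq)
    also have "\<dots> = (\<integral>\<^sup>+s. ennreal \<bar>norm x * exp s * g (exp s *\<^sub>R x)\<bar> * indicator {0..\<tau>} s \<partial>lborel)"
      by (intro nn_integral_cong) (auto simp: indicator_def)
    finally show ?case .
  qed
qed

text \<open>Dilations preserve null sets, so \<open>x\<close> may be replaced by
  \<open>exp s x\<close>; shifting the time variable by \<open>s\<close> moves the interval
  accordingly.\<close>

lemma dilated_difference_le_segment:
  "AE x in lborel. ennreal \<bar>u (exp s *\<^sub>R x) - u (exp t *\<^sub>R x)\<bar>
    \<le> (\<integral>\<^sup>+\<sigma>. ennreal \<bar>norm x * exp \<sigma> * g (exp \<sigma> *\<^sub>R x)\<bar> * indicator {min s t..max s t} \<sigma> \<partial>lborel)"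
proof (induction s t rule: linorder_wlog)
  case (sym s t)
  then show ?case by (simp add: abs_minus_commute min.commute max.commute)
next
  case (le s t)
  have "AE x in lborel. ennreal \<bar>u (exp (t - s) *\<^sub>R (exp s *\<^sub>R x)) - u (exp s *\<^sub>R x)\<bar>
    \<le> (\<integral>\<^sup>+\<sigma>. ennreal \<bar>norm (exp s *\<^sub>R x) * exp \<sigma> * g (exp \<sigma> *\<^sub>R (exp s *\<^sub>R x))\<bar> * indicator {0..t - s} \<sigma> \<partial>lborel)"
    using le by (intro AE_lborel_dilation dilated_difference_le) auto
  then show ?case
  proof eventually_elim
    case (elim x)
    have "(\<integral>\<^sup>+\<sigma>. ennreal \<bar>norm x * exp \<sigma> * g (exp \<sigma> *\<^sub>R x)\<bar> * indicator {min s t..max s t} \<sigma> \<partial>lborel)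
        = (\<integral>\<^sup>+\<sigma>. ennreal \<bar>norm x * exp (s + \<sigma>) * g (exp (s + \<sigma>) *\<^sub>R x)\<bar> * indicator {s..t} (s + \<sigma>) \<partial>lborel)"
      using le by (subst nn_integral_real_affine[where c = 1 and t = s]) (auto simp: min_def max_def)
    also have "\<dots> = (\<integral>\<^sup>+\<sigma>. ennreal \<bar>norm (exp s *\<^sub>R x) * exp \<sigma> * g (exp \<sigma> *\<^sub>R (exp s *\<^sub>R x))\<bar> * indicator {0..t - s} \<sigma> \<partial>lborel)"
      by (intro nn_integral_cong) (auto simp: exp_add mult_ac indicator_def)
    finally show ?case
      using elim by (simp add: abs_minus_commute flip: exp_add)
  qed
qed

text \<open>The exceptional set of \<open>x\<close> so far depends on \<open>s\<close> and
  \<open>t\<close>. Fubini's theorem for null sets exchanges the quantifiers, at the price of losing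
  a null set of times on each ray.\<close>

lemma AE_rays_difference_le:
  "AE x in lborel. AE s in lborel. AE t in lborel. ennreal \<bar>u (exp s *\<^sub>R x) - u (exp t *\<^sub>R x)\<bar>
    \<le> (\<integral>\<^sup>+\<sigma>. ennreal \<bar>norm x * exp \<sigma> * g (exp \<sigma> *\<^sub>R x)\<bar> * indicator {min s t..max s t} \<sigma> \<partial>lborel)"
proof -
  \<comment> \<open>An indicator of an interval that depends on \<open>z\<close>, written as a
    condition on the pair of \<open>z\<close> and \<sigma> so that joint measurability can be
    derived.\<close>
  let ?ind = "\<lambda>(z :: real \<times> real) (\<sigma> :: real). if min (fst z) (snd z) \<le> \<sigma> \<and> \<sigma> \<le> max (fst z) (snd z) then 1 else 0 :: ennreal"
  let ?L = "\<lambda>x z. ennreal \<bar>u (exp (fst z) *\<^sub>R x) - u (exp (snd z) *\<^sub>R x)\<bar>"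
  let ?R = "\<lambda>x z. \<integral>\<^sup>+\<sigma>. ennreal \<bar>norm x * exp \<sigma> * g (exp \<sigma> *\<^sub>R x)\<bar> * ?ind z \<sigma> \<partial>lborel"
  have ind: "?ind z \<sigma> = indicator {min (fst z) (snd z)..max (fst z) (snd z)} \<sigma>" for z \<sigma>
    by (auto simp: indicator_def)
  have ind': "(if min s t \<le> \<sigma> \<and> \<sigma> \<le> max s t then 1 else 0 :: ennreal) = indicator {min s t..max s t} \<sigma>"
    for s t \<sigma> :: real
    by (auto simp: indicator_def)
  interpret P: pair_sigma_finite "lborel :: 'a measure" "lborel \<Otimes>\<^sub>M lborel :: (real \<times> real) measure"
    by (intro pair_sigma_finite.intro sigma_finite_lborel lborel_pair.sigma_finite_measure_axioms)
  have L: "(\<lambda>z. ?L (fst z) (snd z)) \<in> borel_measurable (lborel \<Otimes>\<^sub>M (lborel \<Otimes>\<^sub>M lborel))"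
    by measurable
  have "(\<lambda>(z :: 'a \<times> real \<times> real, \<sigma>). ennreal \<bar>norm (fst z) * exp \<sigma> * g (exp \<sigma> *\<^sub>R fst z)\<bar>)
      \<in> borel_measurable ((lborel \<Otimes>\<^sub>M (lborel \<Otimes>\<^sub>M lborel)) \<Otimes>\<^sub>M lborel)"
    by measurable
  moreover have "(\<lambda>(z, \<sigma>). ?ind (snd z) \<sigma>)
      \<in> borel_measurable (((lborel :: 'a measure) \<Otimes>\<^sub>M (lborel \<Otimes>\<^sub>M lborel)) \<Otimes>\<^sub>M lborel)"
    by measurable
  ultimately have "(\<lambda>(z :: 'a \<times> real \<times> real, \<sigma>). ennreal \<bar>norm (fst z) * exp \<sigma> * g (exp \<sigma> *\<^sub>R fst z)\<bar> * ?ind (snd z) \<sigma>)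
      \<in> borel_measurable ((lborel \<Otimes>\<^sub>M (lborel \<Otimes>\<^sub>M lborel)) \<Otimes>\<^sub>M lborel)"
    unfolding case_prod_beta by (rule borel_measurable_times_ennreal)
  then have "(\<lambda>z. ?R (fst z) (snd z)) \<in> borel_measurable (lborel \<Otimes>\<^sub>M (lborel \<Otimes>\<^sub>M lborel))"
    by (rule lborel.borel_measurable_nn_integral)
  with L have "{z \<in> space (lborel \<Otimes>\<^sub>M (lborel \<Otimes>\<^sub>M lborel)). ?L (fst z) (snd z) \<le> ?R (fst z) (snd z)}
      \<in> sets (lborel \<Otimes>\<^sub>M (lborel \<Otimes>\<^sub>M lborel))"
    by (rule borel_measurable_le)
  then have "(AE x in lborel. AE z in lborel \<Otimes>\<^sub>M lborel. ?L x z \<le> ?R x z)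
      \<longleftrightarrow> (AE z in lborel \<Otimes>\<^sub>M lborel. AE x in lborel. ?L x z \<le> ?R x z)"
    by (rule P.AE_commute)
  moreover have "AE z in lborel \<Otimes>\<^sub>M lborel. AE x in lborel. ?L x z \<le> ?R x z"
    by (rule AE_I2) (simp only: ind dilated_difference_le_segment)
  ultimately have "AE x in lborel. AE z in lborel \<Otimes>\<^sub>M lborel. ?L x z \<le> ?R x z"
    by (rule iffD2)
  then show ?thesis
  proof eventually_elim
    case (elim x)
    from lborel_pair.AE_pair[OF this] show ?case by (simp only: fst_conv snd_conv ind')
  qed
qed

end

section \<open>A convolution form of Hardy's inequality\<close>

text \<open>The tangent to the convex function \<open>y powr p\<close> at \<open>m\<close>,
  rearranged so that all terms are nonnegative and can be integrated as
  \<open>ennreal\<close>.\<close>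

lemma Youngs_inequality_scaled:
  fixes m y p :: real
  assumes "m > 0" "y \<ge> 0" "p \<ge> 1"
  shows "p * m powr (p - 1) * y \<le> y powr p + (p - 1) * m powr p"
proof (cases "p = 1")
  case False
  then have p: "p > 1" using assms by simp
  define q where "q = p / (p - 1)"
  have q: "q > 1" "1 / p + 1 / q = 1" "(p - 1) * q = p" using p by (auto simp: q_def divide_simps)
  have "y * m powr (p - 1) \<le> y powr p / p + (m powr (p - 1)) powr q / q"
    using assms p q by (intro Youngs_inequality) auto
  also have "(m powr (p - 1)) powr q = m powr p"
    using q by (simp add: powr_powr)
  also have "m powr p / q = (p - 1) / p * m powr p"
    using p by (simp add: q_def)
  finally have "p * (y * m powr (p - 1)) \<le> p * (y powr p / p + (p - 1) / p * m powr p)"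
    using p by (intro mult_left_mono) auto
  also have "\<dots> = y powr p + (p - 1) * m powr p"
    using p unfolding distrib_left by simp
  finally show ?thesis by (simp only: mult_ac)
qed (use assms in simp)

lemma powr_add_le:
  fixes x y r :: real
  assumes "x \<ge> 0" "y \<ge> 0" "r \<ge> 0"
  shows "(x + y) powr r \<le> 2 powr r * (x powr r + y powr r)"
proof -
  have "(x + y) powr r \<le> (2 * max x y) powr r"
    using assms by (intro powr_mono2) auto
  also have "\<dots> = 2 powr r * max x y powr r"
    using assms by (simp add: powr_mult)
  also have "\<dots> \<le> 2 powr r * (x powr r + y powr r)"
    by (intro mult_left_mono) (auto simp: max_def)
  finally show ?thesis .
qed

text \<open>Jensen's inequality, proved by integrating the tangent-line inequality
  at \<open>m = y / K\<close>, so that no finiteness of the right-hand side is required.\<close>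

lemma powr_le_nn_integral_kernel:
  fixes k f :: "'b \<Rightarrow> real"
  assumes [measurable]: "k \<in> borel_measurable M" "f \<in> borel_measurable M"
    and k: "\<And>x. k x \<ge> 0" and f: "\<And>x. f x \<ge> 0"
    and K: "(\<integral>\<^sup>+x. ennreal (k x) \<partial>M) = ennreal K" "K > 0"
    and y: "y \<ge> 0" "ennreal y \<le> (\<integral>\<^sup>+x. ennreal (k x * f x) \<partial>M)" and p: "p \<ge> 1"
  shows "ennreal (y powr p) \<le> ennreal (K powr (p - 1)) * (\<integral>\<^sup>+x. ennreal (k x * f x powr p) \<partial>M)"
proof (cases "y = 0")
  case False
  define m where "m = y / K"
  have m: "m > 0" "y = K * m" using False y K by (auto simp: m_def)
  define I where "I = (\<integral>\<^sup>+x. ennreal (k x * f x powr p) \<partial>M)"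
  have "ennreal (p * m powr (p - 1) * y) = ennreal (p * m powr (p - 1)) * ennreal y"
    using p y by (intro ennreal_mult) auto
  also have "\<dots> \<le> ennreal (p * m powr (p - 1)) * (\<integral>\<^sup>+x. ennreal (k x * f x) \<partial>M)"
    using y by (intro mult_left_mono) auto
  also have "\<dots> = (\<integral>\<^sup>+x. ennreal (p * m powr (p - 1)) * ennreal (k x * f x) \<partial>M)"
    by (rule nn_integral_cmult[symmetric]) measurable
  also have "\<dots> \<le> (\<integral>\<^sup>+x. ennreal (k x * f x powr p) + ennreal ((p - 1) * m powr p) * ennreal (k x) \<partial>M)"
  proof (intro nn_integral_mono)
    fix x
    have "k x * (p * m powr (p - 1) * f x) \<le> k x * (f x powr p + (p - 1) * m powr p)"
      by (intro mult_left_mono Youngs_inequality_scaled m f k p)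
    then have "p * m powr (p - 1) * (k x * f x) \<le> k x * f x powr p + (p - 1) * m powr p * k x"
      unfolding distrib_left by (simp only: mult_ac)
    then have "ennreal (p * m powr (p - 1) * (k x * f x))
        \<le> ennreal (k x * f x powr p + (p - 1) * m powr p * k x)"
      by (rule ennreal_leI)
    also have "\<dots> = ennreal (k x * f x powr p) + ennreal ((p - 1) * m powr p * k x)"
      using k[of x] p by (intro ennreal_plus) auto
    finally have "ennreal (p * m powr (p - 1) * (k x * f x))
        \<le> ennreal (k x * f x powr p) + ennreal ((p - 1) * m powr p * k x)" .
    moreover have "ennreal (p * m powr (p - 1) * (k x * f x)) = ennreal (p * m powr (p - 1)) * ennreal (k x * f x)"
      using k[of x] f[of x] p by (intro ennreal_mult) auto
    moreover have "ennreal ((p - 1) * m powr p * k x) = ennreal ((p - 1) * m powr p) * ennreal (k x)"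
      using k[of x] p by (intro ennreal_mult) auto
    ultimately show "ennreal (p * m powr (p - 1)) * ennreal (k x * f x)
        \<le> ennreal (k x * f x powr p) + ennreal ((p - 1) * m powr p) * ennreal (k x)"
      by simp
  qed
  also have "\<dots> = I + ennreal ((p - 1) * m powr p) * ennreal K"
    unfolding I_def by (simp add: nn_integral_add nn_integral_cmult K)
  also have "\<dots> = I + ennreal ((p - 1) * m powr p * K)"
    using p K by (simp add: ennreal_mult)
  finally have le: "ennreal (p * m powr (p - 1) * y) \<le> I + ennreal ((p - 1) * m powr p * K)" .
  \<comment> \<open>With \<open>m = y / K\<close> the left-hand side is
    \<open>p * K * m powr p\<close>; cancelling the finite term
    \<open>(p - 1) * m powr p * K\<close> leaves exactly \<open>K * m powr p\<close>.\<close>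
  have "m powr (p - 1) * m = m powr p" using m(1) by (simp add: powr_diff)
  then have "p * m powr (p - 1) * y = K * m powr p + (p - 1) * m powr p * K"
    unfolding m(2) by (simp add: algebra_simps)
  then have "ennreal (K * m powr p) + ennreal ((p - 1) * m powr p * K) \<le> I + ennreal ((p - 1) * m powr p * K)"
    using le p K by (simp flip: ennreal_plus)
  then have le2: "ennreal (K * m powr p) \<le> I"
    by (subst (asm) (1 2) add.commute) (simp add: ennreal_add_left_cancel_le)
  have "y powr p = K powr (p - 1) * (K * m powr p)"
    using m K by (simp add: powr_mult powr_diff)
  then have "ennreal (y powr p) = ennreal (K powr (p - 1)) * ennreal (K * m powr p)"
    using K by (simp add: ennreal_mult)
  also have "\<dots> \<le> ennreal (K powr (p - 1)) * I"
    using le2 by (intro mult_left_mono) auto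
  finally show ?thesis unfolding I_def .
qed simp

lemma nn_integral_exp_kernel:
  assumes "d > 0"
  shows "(\<integral>\<^sup>+t. ennreal (exp (- d * t) * indicator {0..} t) \<partial>lborel) = ennreal (1 / d)"
proof -
  have "LIM t at_top. - (d * t) :> at_bot"
    using assms by (auto intro!: filterlim_tendsto_pos_mult_at_top[OF tendsto_const] filterlim_ident
        simp: filterlim_uminus_at_bot)
  then have "((\<lambda>t. exp (- (d * t))) \<longlongrightarrow> 0) at_top"
    by (rule filterlim_compose[OF exp_at_bot])
  then have lim: "((\<lambda>t. - exp (- d * t) / d) \<longlongrightarrow> 0) at_top"
    using tendsto_divide[OF tendsto_minus tendsto_const, of "\<lambda>t. exp (- (d * t))" 0 at_top d] assms by simp
  have "(\<integral>\<^sup>+t. ennreal (exp (- d * t) * indicator {0..} t) \<partial>lborel)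
      = (\<integral>\<^sup>+t. ennreal (exp (- d * t)) * indicator {0..} t \<partial>lborel)"
    by (intro nn_integral_cong) (auto simp: indicator_def)
  also have "\<dots> = ennreal (0 - (- exp (- d * 0) / d))"
    using assms by (intro nn_integral_FTC_atLeast[OF _ _ _ lim]) (auto intro!: derivative_eq_intros)
  finally show ?thesis by simp
qed

text \<open>The sign \<open>e = 1\<close> integrates towards plus infinity, \<open>e = -1\<close> towards minus infinity.\<close>

lemma hardy_convolution:
  fixes w f :: "real \<Rightarrow> real"
  assumes d: "d > 0" and p: "p \<ge> 1" and e: "\<bar>e\<bar> = 1"
    and [measurable]: "w \<in> borel_measurable borel" "f \<in> borel_measurable borel"
    and f: "\<And>s. f s \<ge> 0"
    and le: "AE s in lborel. ennreal \<bar>w s\<bar> \<le> (\<integral>\<^sup>+t. ennreal (exp (- d * t) * indicator {0..} t * f (s + e * t)) \<partial>lborel)"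
  shows "(\<integral>\<^sup>+s. ennreal (\<bar>w s\<bar> powr p) \<partial>lborel) \<le> ennreal ((1 / d) powr p) * (\<integral>\<^sup>+s. ennreal (f s powr p) \<partial>lborel)"
proof -
  let ?k = "\<lambda>t. exp (- d * t) * indicator {0..} t :: real"
  let ?c = "ennreal ((1 / d) powr (p - 1))"
  let ?I = "\<integral>\<^sup>+s. ennreal (f s powr p) \<partial>lborel"
  have "AE s in lborel. ennreal (\<bar>w s\<bar> powr p) \<le> ?c * (\<integral>\<^sup>+t. ennreal (?k t * f (s + e * t) powr p) \<partial>lborel)"
    using le
  proof eventually_elim
    case (elim s)
    show ?case
      by (rule powr_le_nn_integral_kernel[OF _ _ _ _ nn_integral_exp_kernel[OF d] _ _ elim p])
         (use d f in auto)
  qed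
  then have "(\<integral>\<^sup>+s. ennreal (\<bar>w s\<bar> powr p) \<partial>lborel)
      \<le> (\<integral>\<^sup>+s. ?c * (\<integral>\<^sup>+t. ennreal (?k t * f (s + e * t) powr p) \<partial>lborel) \<partial>lborel)"
    by (rule nn_integral_mono_AE)
  also have "\<dots> = ?c * (\<integral>\<^sup>+s. \<integral>\<^sup>+t. ennreal (?k t * f (s + e * t) powr p) \<partial>lborel \<partial>lborel)"
    by (rule nn_integral_cmult) measurable
  also have "(\<integral>\<^sup>+s. \<integral>\<^sup>+t. ennreal (?k t * f (s + e * t) powr p) \<partial>lborel \<partial>lborel)
      = (\<integral>\<^sup>+t. \<integral>\<^sup>+s. ennreal (?k t * f (s + e * t) powr p) \<partial>lborel \<partial>lborel)"
    by (rule lborel_pair.Fubini') measurable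
  also have "\<dots> = (\<integral>\<^sup>+t. ennreal (?k t) * ?I \<partial>lborel)"
  proof (rule nn_integral_cong)
    fix t
    have "?I = (\<integral>\<^sup>+s. ennreal (f (s + e * t) powr p) \<partial>lborel)"
      by (subst nn_integral_real_affine[where c = 1 and t = "e * t"]) (auto simp: add.commute)
    then show "(\<integral>\<^sup>+s. ennreal (?k t * f (s + e * t) powr p) \<partial>lborel) = ennreal (?k t) * ?I"
      by (simp add: ennreal_mult nn_integral_cmult)
  qed
  also have "\<dots> = ennreal (1 / d) * ?I"
    by (subst nn_integral_multc) (simp_all only: nn_integral_exp_kernel[OF d], measurable)
  finally have "(\<integral>\<^sup>+s. ennreal (\<bar>w s\<bar> powr p) \<partial>lborel) \<le> ?c * (ennreal (1 / d) * ?I)" .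
  \<comment> \<open>One power of \<open>1 / d\<close> is the mass of the kernel after translation
    invariance, the other \<open>p - 1\<close> come from Jensen's inequality.\<close>
  also have "\<dots> = ennreal ((1 / d) powr (p - 1) * (1 / d)) * ?I"
    using d by (subst mult.assoc[symmetric], subst ennreal_mult[symmetric]) auto
  also have "(1 / d) powr (p - 1) * (1 / d) = (1 / d) powr p"
    using d by (simp add: powr_diff)
  finally show ?thesis .
qed

section \<open>The one-dimensional estimate\<close>

definition increments_le :: "(real \<Rightarrow> real) \<Rightarrow> (real \<Rightarrow> real) \<Rightarrow> bool" where
  "increments_le w h \<longleftrightarrow> w \<in> borel_measurable borel \<and> h \<in> borel_measurable borel \<and>
    (AE s in lborel. AE t in lborel. ennreal \<bar>w s - w t\<bar> \<le> (\<integral>\<^sup>+\<sigma>. ennreal \<bar>h \<sigma>\<bar> * indicator {min s t..max s t} \<sigma> \<partial>lborel))"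

definition exp_int :: "real \<Rightarrow> real \<Rightarrow> (real \<Rightarrow> real) \<Rightarrow> ennreal" where
  "exp_int A q w = (\<integral>\<^sup>+s. ennreal (exp (A * s) * \<bar>w s\<bar> powr q) \<partial>lborel)"

lemma increments_le_uminus:
  assumes "increments_le w h"
  shows "increments_le (\<lambda>s. w (- s)) (\<lambda>s. h (- s))"
proof -
  have uminus: "AE s in lborel. P (- s)" if "AE s in lborel. P s" for P :: "real \<Rightarrow> bool"
  proof -
    have "AE s in distr lborel borel uminus. P s" using that by (simp only: lborel_distr_uminus)
    from AE_distrD[OF _ this] show ?thesis by simp
  qed
  have [measurable]: "w \<in> borel_measurable borel" "h \<in> borel_measurable borel"
    using assms by (auto simp: increments_le_def)
  have eq: "(\<integral>\<^sup>+\<sigma>. ennreal \<bar>h \<sigma>\<bar> * indicator {min (- s) (- t)..max (- s) (- t)} \<sigma> \<partial>lborel)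
      = (\<integral>\<^sup>+\<sigma>. ennreal \<bar>h (- \<sigma>)\<bar> * indicator {min s t..max s t} \<sigma> \<partial>lborel)" for s t :: real
    by (subst nn_integral_real_affine[where c = "-1" and t = 0])
       (auto intro!: nn_integral_cong simp: indicator_def)
  have "AE s in lborel. AE t in lborel. ennreal \<bar>w s - w t\<bar> \<le> (\<integral>\<^sup>+\<sigma>. ennreal \<bar>h \<sigma>\<bar> * indicator {min s t..max s t} \<sigma> \<partial>lborel)"
    using assms by (simp add: increments_le_def)
  from uminus[OF this] have "AE s in lborel. AE t in lborel. ennreal \<bar>w (- s) - w (- t)\<bar>
      \<le> (\<integral>\<^sup>+\<sigma>. ennreal \<bar>h \<sigma>\<bar> * indicator {min (- s) (- t)..max (- s) (- t)} \<sigma> \<partial>lborel)"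
    by eventually_elim (rule uminus)
  then show ?thesis unfolding increments_le_def eq by auto
qed

lemma exp_int_uminus:
  assumes [measurable]: "w \<in> borel_measurable borel"
  shows "exp_int (- A) q (\<lambda>s. w (- s)) = exp_int A q w"
  unfolding exp_int_def
  by (subst (2) nn_integral_real_affine[where c = "-1" and t = 0]) auto

section \<open>Hardy's inequality from infinity\<close>

lemma nn_integral_ge_const_infinite:
  fixes f :: "real \<Rightarrow> ennreal"
  assumes "AE t in lborel. t \<ge> a \<longrightarrow> f t \<ge> c" "c > 0"
  shows "(\<integral>\<^sup>+t. f t \<partial>lborel) = \<infinity>"
proof -
  have "emeasure lborel {a..} = \<infinity>"
  proof (rule ccontr)
    assume "emeasure lborel {a..} \<noteq> \<infinity>"
    then obtain x where x: "emeasure lborel {a..} = ennreal x" "x \<ge> 0"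
      by (cases "emeasure lborel {a..}") auto
    have "ennreal (x + 1) = emeasure lborel {a..a + (x + 1)}"
      using x by simp
    also have "\<dots> \<le> emeasure lborel {a..}"
      by (rule emeasure_mono) auto
    finally show False using x by simp
  qed
  then have "\<infinity> = c * emeasure lborel {a..}"
    using assms(2) by (simp add: ennreal_mult_top less_le)
  also have "\<dots> = (\<integral>\<^sup>+t. c * indicator {a..} t \<partial>lborel)"
    by (rule nn_integral_cmult_indicator[symmetric]) simp
  also have "\<dots> \<le> (\<integral>\<^sup>+t. f t \<partial>lborel)"
    using assms(1) by (intro nn_integral_mono_AE) (auto elim!: eventually_mono simp: indicator_def)
  finally show ?thesis by (simp add: top_unique)
qed

text \<open>If |w s| exceeded the tail integral, the increments would keep |w| above a positive
  constant near plus infinity, and for A \<ge> 0 the weighted integral would diverge. So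
  \<open>w\<close> may be treated as if it vanished at infinity.\<close>

lemma abs_le_tail_integral:
  assumes inc: "increments_le w h" and A: "A \<ge> 0" and q: "q > 0" and fin: "exp_int A q w < \<infinity>"
  shows "AE s in lborel. ennreal \<bar>w s\<bar> \<le> (\<integral>\<^sup>+\<sigma>. ennreal \<bar>h \<sigma>\<bar> * indicator {s..} \<sigma> \<partial>lborel)"
proof -
  have "AE s in lborel. AE t in lborel. ennreal \<bar>w s - w t\<bar> \<le> (\<integral>\<^sup>+\<sigma>. ennreal \<bar>h \<sigma>\<bar> * indicator {min s t..max s t} \<sigma> \<partial>lborel)"
    using inc by (simp add: increments_le_def)
  then show ?thesis
  proof eventually_elim
    case (elim s)
    define I where "I = (\<integral>\<^sup>+\<sigma>. ennreal \<bar>h \<sigma>\<bar> * indicator {s..} \<sigma> \<partial>lborel)"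
    show ?case
    proof (rule ccontr)
      assume "\<not> ?case"
      then have less: "I < ennreal \<bar>w s\<bar>" by (simp add: I_def)
      then obtain i where i: "I = ennreal i" "i \<ge> 0"
        by (cases I) auto
      define \<epsilon> where "\<epsilon> = \<bar>w s\<bar> - i"
      have \<epsilon>: "\<epsilon> > 0" using less i by (simp add: \<epsilon>_def ennreal_less_iff)
      \<comment> \<open>Beyond \<open>s\<close> the interval from \<open>s\<close> to
        \<open>t\<close> lies in the tail, and beyond 0 the weight \<open>exp (A * t)\<close> is at
        least 1.\<close>
      have "AE t in lborel. t \<ge> max s 0 \<longrightarrow> ennreal (exp (A * t) * \<bar>w t\<bar> powr q) \<ge> ennreal (\<epsilon> powr q)"
        using elim
      proof eventually_elim
        case (elim t)
        show ?case
        proof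
          assume t: "t \<ge> max s 0"
          note elim
          also have "(\<integral>\<^sup>+\<sigma>. ennreal \<bar>h \<sigma>\<bar> * indicator {min s t..max s t} \<sigma> \<partial>lborel) \<le> I"
            unfolding I_def using t by (intro nn_integral_mono) (auto simp: indicator_def)
          finally have "\<bar>w s - w t\<bar> \<le> i" using i by simp
          then have "\<epsilon> \<le> \<bar>w t\<bar>" by (simp add: \<epsilon>_def)
          then have "1 * \<epsilon> powr q \<le> exp (A * t) * \<bar>w t\<bar> powr q"
            using \<epsilon> q A t by (intro mult_mono powr_mono2) auto
          then show "ennreal (exp (A * t) * \<bar>w t\<bar> powr q) \<ge> ennreal (\<epsilon> powr q)"
            by (intro ennreal_leI) simp
        qed
      qed
      then have "exp_int A q w = \<infinity>"
        unfolding exp_int_def using \<epsilon>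
        by (intro nn_integral_ge_const_infinite[of "max s 0" "ennreal (\<epsilon> powr q)"]) auto
      with fin show False by simp
    qed
  qed
qed

lemma exp_times_powr:
  fixes B p s x y :: real
  assumes "exp (B / p * s) * y = x" "p > 0" "y \<ge> 0"
  shows "x powr p = exp (B * s) * y powr p"
proof -
  have "x powr p = exp (B / p * s) powr p * y powr p"
    unfolding assms(1)[symmetric] by (rule powr_mult)
  also have "exp (B / p * s) powr p = exp (B * s)"
    using assms(2) by (simp add: exp_powr_real)
  finally show ?thesis .
qed

text \<open>Splitting the weight at distance \<open>t\<close> as exp(Bs/p) = exp(-Bt/p)
  exp(B(s+t)/p) turns the tail bound into a convolution with a kernel of mass
  \<open>p / B\<close>.\<close>

lemma hardy_at_infinity:
  assumes inc: "increments_le w h" and A: "A \<ge> 0" and q: "q > 0" and fin: "exp_int A q w < \<infinity>"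
    and B: "B > 0" and p: "p \<ge> 1"
  shows "exp_int B p w \<le> ennreal ((p / B) powr p) * exp_int B p h"
proof -
  have [measurable]: "w \<in> borel_measurable borel" "h \<in> borel_measurable borel"
    using inc by (auto simp: increments_le_def)
  define f where "f = (\<lambda>s. exp (B / p * s) * \<bar>h s\<bar>)"
  have [measurable]: "f \<in> borel_measurable borel" unfolding f_def by measurable
  have "AE s in lborel. ennreal \<bar>exp (B / p * s) * w s\<bar>
      \<le> (\<integral>\<^sup>+t. ennreal (exp (- (B / p) * t) * indicator {0..} t * f (s + 1 * t)) \<partial>lborel)"
    using abs_le_tail_integral[OF inc A q fin]
  proof eventually_elim
    case (elim s)
    have "ennreal \<bar>exp (B / p * s) * w s\<bar> = ennreal (exp (B / p * s)) * ennreal \<bar>w s\<bar>"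
      by (simp add: abs_mult ennreal_mult)
    also have "\<dots> \<le> ennreal (exp (B / p * s)) * (\<integral>\<^sup>+\<sigma>. ennreal \<bar>h \<sigma>\<bar> * indicator {s..} \<sigma> \<partial>lborel)"
      by (intro mult_left_mono elim) simp
    also have "\<dots> = (\<integral>\<^sup>+\<sigma>. ennreal (exp (B / p * s)) * (ennreal \<bar>h \<sigma>\<bar> * indicator {s..} \<sigma>) \<partial>lborel)"
      by (rule nn_integral_cmult[symmetric]) measurable
    also have "\<dots> = (\<integral>\<^sup>+t. ennreal (exp (B / p * s)) * (ennreal \<bar>h (s + 1 * t)\<bar> * indicator {s..} (s + 1 * t)) \<partial>lborel)"
      by (subst nn_integral_real_affine[where c = 1 and t = s]) auto
    also have "\<dots> = (\<integral>\<^sup>+t. ennreal (exp (- (B / p) * t) * indicator {0..} t * f (s + 1 * t)) \<partial>lborel)"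
    proof (intro nn_integral_cong)
      fix t
      have "exp (- (B / p) * t) * f (s + t) = exp (B / p * s) * \<bar>h (s + t)\<bar>"
        by (simp add: f_def distrib_left add_divide_distrib flip: exp_add)
      then show "ennreal (exp (B / p * s)) * (ennreal \<bar>h (s + 1 * t)\<bar> * indicator {s..} (s + 1 * t))
          = ennreal (exp (- (B / p) * t) * indicator {0..} t * f (s + 1 * t))"
        by (auto simp: indicator_def ennreal_mult[symmetric])
    qed
    finally show ?case .
  qed
  then have "(\<integral>\<^sup>+s. ennreal (\<bar>exp (B / p * s) * w s\<bar> powr p) \<partial>lborel)
      \<le> ennreal ((1 / (B / p)) powr p) * (\<integral>\<^sup>+s. ennreal (f s powr p) \<partial>lborel)"
    using B p by (intro hardy_convolution[where e = 1]) (auto simp: f_def)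
  moreover have "\<bar>exp (B / p * s) * w s\<bar> powr p = exp (B * s) * \<bar>w s\<bar> powr p" for s
    using p by (intro exp_times_powr) (auto simp: abs_mult)
  moreover have "f s powr p = exp (B * s) * \<bar>h s\<bar> powr p" for s
    using p by (intro exp_times_powr) (auto simp: f_def)
  ultimately show ?thesis by (simp add: exp_int_def)
qed

text \<open>The two power terms balance at \<open>y = exp (\<beta> * s)\<close>. Above this
  threshold the left-hand side is at most the \<open>q\<close>-term; below it, at most
  \<open>exp ((C + r * \<beta>) * s)\<close>. The strict inequality C < rA/q says exactly that this
  exponent is negative.\<close>

lemma Young_exp_bound:
  fixes r q A C :: real
  assumes "0 < r" "r \<le> q" "C < r * A / q"
  shows "\<exists>\<eta>>0. \<forall>s\<ge>0. \<forall>y\<ge>0. exp (C * s) * y powr r \<le> exp (A * s) * y powr q + exp (- \<eta> * s)"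
proof (cases "r = q")
  case True
  then have "C \<le> A" using assms by auto
  then have "exp (C * s) * y powr r \<le> exp (A * s) * y powr q" if "s \<ge> 0" for s y
    using True that by (intro mult_mono) (auto intro: mult_right_mono)
  then have "exp (C * s) * y powr r \<le> exp (A * s) * y powr q + exp (- 1 * s)" if "s \<ge> 0" for s y
    using that by (simp add: add_increasing2)
  \<comment> \<open>For equal exponents the \<open>q\<close>-term alone dominates, so the decay rate
    1 is arbitrary.\<close>
  then show ?thesis by (intro exI[of _ 1]) simp
next
  case False
  then have rq: "r < q" using assms by simp
  define \<beta> where "\<beta> = (C - A) / (q - r)"
  have \<beta>: "\<beta> * (q - r) = C - A"
    using rq by (simp add: \<beta>_def)
  define \<eta> where "\<eta> = - (C + r * \<beta>)"
  have "\<eta> * (q - r) = - (C * (q - r)) - r * (\<beta> * (q - r))"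
    by (simp add: \<eta>_def algebra_simps)
  also note \<beta>
  finally have "\<eta> * (q - r) = r * A - C * q"
    by (simp add: algebra_simps)
  moreover have "r * A - C * q > 0"
    using assms by (simp add: pos_less_divide_eq)
  ultimately have "0 < \<eta> * (q - r)" by (simp only:)
  then have \<eta>: "\<eta> > 0" using rq unfolding zero_less_mult_iff by linarith
  have "exp (C * s) * y powr r \<le> exp (A * s) * y powr q + exp (- \<eta> * s)" if s: "s \<ge> 0" and y: "y \<ge> 0" for s y
  proof (cases "y \<le> exp (\<beta> * s)")
    case True
    have "exp (C * s) * y powr r \<le> exp (C * s) * exp (\<beta> * s) powr r"
      using True y assms by (intro mult_left_mono powr_mono2) auto
    also have "\<dots> = exp (- \<eta> * s)"
      unfolding exp_powr_real exp_add[symmetric] \<eta>_def by (simp add: algebra_simps)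
    finally show ?thesis by (simp add: add_increasing)
  next
    case False
    then have y0: "y > exp (\<beta> * s)" by simp
    then have ypos: "y > 0" using exp_gt_zero less_trans by blast
    have "exp ((C - A) * s) = exp (\<beta> * s) powr (q - r)"
      unfolding exp_powr_real \<beta>[symmetric] by (simp only: mult_ac)
    also have "\<dots> \<le> y powr (q - r)"
      using y0 rq by (intro powr_mono2) auto
    finally have "exp (A * s) * (exp ((C - A) * s) * y powr r) \<le> exp (A * s) * (y powr (q - r) * y powr r)"
      by (intro mult_left_mono mult_right_mono) auto
    also have "y powr (q - r) * y powr r = y powr q"
      using ypos by (simp flip: powr_add)
    also have "exp (A * s) * (exp ((C - A) * s) * y powr r) = exp (C * s) * y powr r"
      unfolding mult.assoc[symmetric] exp_add[symmetric] by (simp add: left_diff_distrib)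
    finally show ?thesis by (simp add: add_increasing2)
  qed
  then show ?thesis using \<eta> by blast
qed

text \<open>The right-hand side integrates over the whole line, so a base point may be taken to the
  left of 0. The other half-line is covered by the same predicate with \<open>A\<close>,
  \<open>B\<close>, \<open>C\<close> negated.\<close>

definition half_line_bound :: "real \<Rightarrow> real \<Rightarrow> real \<Rightarrow> real \<Rightarrow> real \<Rightarrow> real \<Rightarrow> bool" where
  "half_line_bound A q B p C r \<longleftrightarrow> (\<exists>K>0. \<forall>w h. increments_le w h \<longrightarrow>
     (\<integral>\<^sup>+s. ennreal (exp (C * s) * \<bar>w s\<bar> powr r) * indicator {0..} s \<partial>lborel)
       \<le> ennreal K * (1 + exp_int A q w + exp_int B p h))"

definition line_bound :: "real \<Rightarrow> real \<Rightarrow> real \<Rightarrow> real \<Rightarrow> real \<Rightarrow> real \<Rightarrow> bool" where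
  "line_bound A q B p C r \<longleftrightarrow> (\<exists>K>0. \<forall>w h. increments_le w h \<longrightarrow>
     exp_int C r w \<le> ennreal K * (1 + exp_int A q w + exp_int B p h))"

lemma line_bound_if_half_line_bounds:
  assumes "half_line_bound A q B p C r" "half_line_bound (- A) q (- B) p (- C) r"
  shows "line_bound A q B p C r"
proof -
  obtain K where K: "K > 0" "\<And>w h. increments_le w h \<Longrightarrow>
     (\<integral>\<^sup>+s. ennreal (exp (C * s) * \<bar>w s\<bar> powr r) * indicator {0..} s \<partial>lborel)
       \<le> ennreal K * (1 + exp_int A q w + exp_int B p h)"
    using assms(1) unfolding half_line_bound_def by blast
  obtain L where L: "L > 0" "\<And>w h. increments_le w h \<Longrightarrow>
     (\<integral>\<^sup>+s. ennreal (exp (- C * s) * \<bar>w s\<bar> powr r) * indicator {0..} s \<partial>lborel)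
       \<le> ennreal L * (1 + exp_int (- A) q w + exp_int (- B) p h)"
    using assms(2) unfolding half_line_bound_def by blast
  have "exp_int C r w \<le> ennreal (K + L) * (1 + exp_int A q w + exp_int B p h)" if inc: "increments_le w h" for w h
  proof -
    have m[measurable]: "w \<in> borel_measurable borel" "h \<in> borel_measurable borel"
      using inc by (auto simp: increments_le_def)
    let ?f = "\<lambda>s. ennreal (exp (C * s) * \<bar>w s\<bar> powr r)"
    have "exp_int C r w \<le> (\<integral>\<^sup>+s. ?f s * indicator {0..} s + ?f s * indicator {..0} s \<partial>lborel)"
      unfolding exp_int_def by (intro nn_integral_mono) (auto simp: indicator_def)
    also have "\<dots> = (\<integral>\<^sup>+s. ?f s * indicator {0..} s \<partial>lborel) + (\<integral>\<^sup>+s. ?f s * indicator {..0} s \<partial>lborel)"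
      by (rule nn_integral_add) measurable
    also have "(\<integral>\<^sup>+s. ?f s * indicator {..0} s \<partial>lborel)
        = (\<integral>\<^sup>+s. ennreal (exp (- C * s) * \<bar>w (- s)\<bar> powr r) * indicator {0..} s \<partial>lborel)"
      by (subst nn_integral_real_affine[where c = "-1" and t = 0])
         (auto intro!: nn_integral_cong simp: indicator_def)
    also have "(\<integral>\<^sup>+s. ?f s * indicator {0..} s \<partial>lborel) + \<dots>
        \<le> ennreal K * (1 + exp_int A q w + exp_int B p h) + ennreal L * (1 + exp_int A q w + exp_int B p h)"
      using K(2)[OF inc] L(2)[OF increments_le_uminus[OF inc], unfolded m[THEN exp_int_uminus]]
      by (rule add_mono)
    also have "\<dots> = ennreal (K + L) * (1 + exp_int A q w + exp_int B p h)"
      using K(1) L(1) by (subst ennreal_plus) (simp_all only: distrib_right less_imp_le)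
    finally show ?thesis .
  qed
  then show ?thesis
    unfolding line_bound_def using K(1) L(1) by (intro exI[of _ "K + L"]) auto
qed

section \<open>Bounds on a half-line\<close>

lemma nn_integral_exp_half_line:
  assumes "d > 0"
  shows "(\<integral>\<^sup>+s. ennreal (exp (- d * s)) * indicator {0..} s \<partial>lborel) = ennreal (1 / d)"
  unfolding nn_integral_exp_kernel[OF assms, symmetric]
  by (intro nn_integral_cong) (auto simp: indicator_def)

lemma half_line_Young:
  assumes "0 < r" "r \<le> q" "C < r * A / q"
  shows "\<exists>K>0. \<forall>y. y \<in> borel_measurable borel \<longrightarrow>
     (\<integral>\<^sup>+s. ennreal (exp (C * s) * \<bar>y s\<bar> powr r) * indicator {0..} s \<partial>lborel)
       \<le> (\<integral>\<^sup>+s. ennreal (exp (A * s) * \<bar>y s\<bar> powr q) * indicator {0..} s \<partial>lborel) + ennreal K"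
proof -
  obtain \<eta> where \<eta>: "\<eta> > 0" "\<And>s y. s \<ge> 0 \<Longrightarrow> y \<ge> 0 \<Longrightarrow>
      exp (C * s) * y powr r \<le> exp (A * s) * y powr q + exp (- \<eta> * s)"
    using Young_exp_bound[OF assms] by blast
  have "(\<integral>\<^sup>+s. ennreal (exp (C * s) * \<bar>y s\<bar> powr r) * indicator {0..} s \<partial>lborel)
       \<le> (\<integral>\<^sup>+s. ennreal (exp (A * s) * \<bar>y s\<bar> powr q) * indicator {0..} s \<partial>lborel) + ennreal (1 / \<eta>)"
    if [measurable]: "y \<in> borel_measurable borel" for y
  proof -
    have "(\<integral>\<^sup>+s. ennreal (exp (C * s) * \<bar>y s\<bar> powr r) * indicator {0..} s \<partial>lborel)
       \<le> (\<integral>\<^sup>+s. ennreal (exp (A * s) * \<bar>y s\<bar> powr q) * indicator {0..} s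
            + ennreal (exp (- \<eta> * s)) * indicator {0..} s \<partial>lborel)"
    proof (rule nn_integral_mono)
      fix s :: real
      show "ennreal (exp (C * s) * \<bar>y s\<bar> powr r) * indicator {0..} s
        \<le> ennreal (exp (A * s) * \<bar>y s\<bar> powr q) * indicator {0..} s + ennreal (exp (- \<eta> * s)) * indicator {0..} s"
        using \<eta>(2)[of s "\<bar>y s\<bar>"] by (cases "s \<ge> 0") (auto simp: ennreal_plus[symmetric] simp del: ennreal_plus intro!: ennreal_leI)
    qed
    also have "\<dots> = (\<integral>\<^sup>+s. ennreal (exp (A * s) * \<bar>y s\<bar> powr q) * indicator {0..} s \<partial>lborel) + ennreal (1 / \<eta>)"
      unfolding nn_integral_exp_half_line[OF \<eta>(1), symmetric]
      by (rule nn_integral_add) measurable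
    finally show ?thesis .
  qed
  then show ?thesis using \<eta>(1) by (intro exI[of _ "1 / \<eta>"]) auto
qed

lemma ennreal_affine_le:
  fixes X Y :: ennreal
  assumes "a \<ge> 0" "b \<ge> 0" "c \<ge> 0"
  shows "ennreal a + ennreal b * X + ennreal c * Y \<le> ennreal (a + b + c) * (1 + X + Y)"
proof -
  have "ennreal a \<le> ennreal (a + b + c) * 1"
    using assms by (simp add: ennreal_leI)
  moreover have "ennreal b * X \<le> ennreal (a + b + c) * X" "ennreal c * Y \<le> ennreal (a + b + c) * Y"
    using assms by (intro mult_right_mono ennreal_leI; simp)+
  ultimately show ?thesis
    unfolding distrib_left by (intro add_mono)
qed

text \<open>The favourable end: the weight of \<open>w\<close> itself dominates, and Young's
  inequality alone lowers the exponent from \<open>q\<close> to \<open>r\<close>.\<close>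

lemma half_line_bound_by_weight:
  assumes "0 < r" "r \<le> q" "C < r * A / q"
  shows "half_line_bound A q B p C r"
proof -
  obtain K where K: "K > 0" "\<And>y. y \<in> borel_measurable borel \<Longrightarrow>
     (\<integral>\<^sup>+s. ennreal (exp (C * s) * \<bar>y s\<bar> powr r) * indicator {0..} s \<partial>lborel)
       \<le> (\<integral>\<^sup>+s. ennreal (exp (A * s) * \<bar>y s\<bar> powr q) * indicator {0..} s \<partial>lborel) + ennreal K"
    using half_line_Young[OF assms] by blast
  have "(\<integral>\<^sup>+s. ennreal (exp (C * s) * \<bar>w s\<bar> powr r) * indicator {0..} s \<partial>lborel)
       \<le> ennreal (K + 1) * (1 + exp_int A q w + exp_int B p h)" if "increments_le w h" for w h
  proof -
    have "(\<integral>\<^sup>+s. ennreal (exp (C * s) * \<bar>w s\<bar> powr r) * indicator {0..} s \<partial>lborel)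
      \<le> (\<integral>\<^sup>+s. ennreal (exp (A * s) * \<bar>w s\<bar> powr q) * indicator {0..} s \<partial>lborel) + ennreal K"
      using that by (intro K(2)) (simp add: increments_le_def)
    also have "\<dots> \<le> exp_int A q w + ennreal K"
      unfolding exp_int_def by (intro add_right_mono nn_integral_mono) (auto simp: indicator_def)
    also have "\<dots> = ennreal K + ennreal 1 * exp_int A q w + ennreal 0 * exp_int B p h"
      by (simp add: add.commute)
    also have "\<dots> \<le> ennreal (K + 1 + 0) * (1 + exp_int A q w + exp_int B p h)"
      using K(1) by (intro ennreal_affine_le) auto
    finally show ?thesis unfolding add_0_right .
  qed
  then show ?thesis
    unfolding half_line_bound_def using K(1) by (intro exI[of _ "K + 1"]) auto
qed

text \<open>Constants are excluded since A \<ge> 0: Hardy's inequality from infinity controls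
  \<open>w\<close> with exponent \<open>p\<close> and weight \<open>B\<close>, and Young's
  inequality passes to \<open>r\<close> and \<open>C\<close>. An infinite integral of
  \<open>w\<close> makes the right-hand side infinite.\<close>

lemma half_line_bound_vanishing:
  assumes A: "A \<ge> 0" and q: "q > 0" and B: "B > 0" and p: "p \<ge> 1" and r: "0 < r" "r \<le> p" and C: "C < r * B / p"
  shows "half_line_bound A q B p C r"
proof -
  obtain K where K: "K > 0" "\<And>y. y \<in> borel_measurable borel \<Longrightarrow>
     (\<integral>\<^sup>+s. ennreal (exp (C * s) * \<bar>y s\<bar> powr r) * indicator {0..} s \<partial>lborel)
       \<le> (\<integral>\<^sup>+s. ennreal (exp (B * s) * \<bar>y s\<bar> powr p) * indicator {0..} s \<partial>lborel) + ennreal K"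
    using half_line_Young[OF r C] by blast
  define L where "L = (p / B) powr p"
  have L: "L \<ge> 0" by (simp add: L_def)
  have "(\<integral>\<^sup>+s. ennreal (exp (C * s) * \<bar>w s\<bar> powr r) * indicator {0..} s \<partial>lborel)
       \<le> ennreal (K + L) * (1 + exp_int A q w + exp_int B p h)" if inc: "increments_le w h" for w h
  proof (cases "exp_int A q w < \<infinity>")
    case True
    have "(\<integral>\<^sup>+s. ennreal (exp (C * s) * \<bar>w s\<bar> powr r) * indicator {0..} s \<partial>lborel)
      \<le> (\<integral>\<^sup>+s. ennreal (exp (B * s) * \<bar>w s\<bar> powr p) * indicator {0..} s \<partial>lborel) + ennreal K"
      using inc by (intro K(2)) (simp add: increments_le_def)
    also have "\<dots> \<le> exp_int B p w + ennreal K"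
      unfolding exp_int_def by (intro add_right_mono nn_integral_mono) (auto simp: indicator_def)
    also have "\<dots> \<le> ennreal L * exp_int B p h + ennreal K"
      unfolding L_def by (intro add_right_mono hardy_at_infinity[OF inc A q True B p])
    also have "\<dots> = ennreal K + ennreal 0 * exp_int A q w + ennreal L * exp_int B p h"
      by (simp add: add.commute)
    also have "\<dots> \<le> ennreal (K + 0 + L) * (1 + exp_int A q w + exp_int B p h)"
      using K(1) L by (intro ennreal_affine_le) auto
    finally show ?thesis unfolding add_0_right .
  next
    case False
    then have "exp_int A q w = \<infinity>" by (metis infinity_ennreal_def top.not_eq_extremum)
    moreover have "ennreal (K + L) \<noteq> 0" using K(1) L by (simp add: ennreal_eq_0_iff)
    ultimately have "ennreal (K + L) * (1 + exp_int A q w + exp_int B p h) = \<infinity>"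
      by (simp add: ennreal_mult_top del: ennreal_plus)
    then show ?thesis by simp
  qed
  then show ?thesis
    unfolding half_line_bound_def using K(1) L by (intro exI[of _ "K + L"]) auto
qed

text \<open>An averaging argument: were the bound to fail at almost every \<open>t\<close> of an
  interval of length one, integrating would give \<open>1 + P \<le> P\<close> for a finite
  \<open>P\<close>. The factor \<open>exp \<bar>A\<bar>\<close> bounds the inverse of the weight on
  \<open>{-1..0}\<close>.\<close>

lemma increments_le_base_point:
  assumes inc: "increments_le w h" and q: "q > 0" and fin: "exp_int A q w < \<infinity>"
  shows "\<exists>t\<in>{-1..0}. ennreal (\<bar>w t\<bar> powr q) \<le> ennreal (exp \<bar>A\<bar>) * (1 + exp_int A q w) \<and>
    (AE s in lborel. ennreal \<bar>w s - w t\<bar> \<le> (\<integral>\<^sup>+\<sigma>. ennreal \<bar>h \<sigma>\<bar> * indicator {min s t..max s t} \<sigma> \<partial>lborel))"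
proof (rule ccontr)
  assume contr: "\<not> ?thesis"
  define P where "P = exp_int A q w"
  have [measurable]: "w \<in> borel_measurable borel" "h \<in> borel_measurable borel"
    using inc by (auto simp: increments_le_def)
  have "AE t in lborel. AE s in lborel. ennreal \<bar>w t - w s\<bar> \<le> (\<integral>\<^sup>+\<sigma>. ennreal \<bar>h \<sigma>\<bar> * indicator {min t s..max t s} \<sigma> \<partial>lborel)"
    using inc by (simp add: increments_le_def)
  then have "AE t in lborel. (1 + P) * indicator {-1..0} t \<le> ennreal (exp (A * t) * \<bar>w t\<bar> powr q)"
  proof eventually_elim
    case (elim t)
    show ?case
    proof (cases "t \<in> {-1..0}")
      case True
      have "ennreal (exp \<bar>A\<bar>) * (1 + P) < ennreal (\<bar>w t\<bar> powr q)"
        using contr True elim unfolding P_def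
        by (auto simp: min.commute max.commute abs_minus_commute not_le)
      then have "ennreal (exp (- \<bar>A\<bar>)) * (ennreal (exp \<bar>A\<bar>) * (1 + P)) \<le> ennreal (exp (- \<bar>A\<bar>)) * ennreal (\<bar>w t\<bar> powr q)"
        by (intro mult_left_mono) auto
      also have "ennreal (exp (- \<bar>A\<bar>)) * (ennreal (exp \<bar>A\<bar>) * (1 + P)) = 1 + P"
        unfolding mult.assoc[symmetric] by (simp add: ennreal_mult[symmetric] exp_minus)
      also have "ennreal (exp (- \<bar>A\<bar>)) * ennreal (\<bar>w t\<bar> powr q) \<le> ennreal (exp (A * t) * \<bar>w t\<bar> powr q)"
      proof -
        have "\<bar>A * t\<bar> \<le> \<bar>A\<bar> * 1" using True unfolding abs_mult by (intro mult_left_mono) auto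
        then have "exp (- \<bar>A\<bar>) * \<bar>w t\<bar> powr q \<le> exp (A * t) * \<bar>w t\<bar> powr q"
          by (intro mult_right_mono) auto
        then show ?thesis by (simp add: ennreal_mult[symmetric] ennreal_leI)
      qed
      finally show ?thesis using True by simp
    qed simp
  qed
  from nn_integral_mono_AE[OF this]
  have "(\<integral>\<^sup>+t. (1 + P) * indicator {-1..0 :: real} t \<partial>lborel) \<le> P"
    by (simp only: P_def exp_int_def)
  then have "1 + P \<le> P"
    by (subst (asm) nn_integral_cmult_indicator) auto
  moreover obtain x where "P = ennreal x" "x \<ge> 0"
    using fin unfolding P_def by (cases "exp_int A q w") auto
  ultimately show False
    by (simp add: ennreal_1[symmetric] ennreal_plus[symmetric] del: ennreal_1 ennreal_plus)
qed

text \<open>Integration now runs forward from the base point, and the kernel decays only for a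
  negative weight, hence \<open>C'\<close> in place of \<open>B\<close>. The cut-off at -1 pays for
  this exchange: for s \<ge> -1 the ratio of the weights, \<open>exp ((C' - B) * s)\<close>, is at
  most \<open>exp (B - C')\<close>.\<close>

lemma hardy_from_base_point:
  assumes inc: "increments_le w h" and p: "p \<ge> 1" and C': "C' < 0" "C' \<le> B"
    and y[measurable]: "y \<in> borel_measurable borel" and y_nonneg: "\<And>s. y s \<ge> 0"
    and le: "AE s in lborel. s \<ge> 0 \<longrightarrow> ennreal (y s) \<le> (\<integral>\<^sup>+\<sigma>. ennreal \<bar>h \<sigma>\<bar> * indicator {-1..s} \<sigma> \<partial>lborel)"
  shows "(\<integral>\<^sup>+s. ennreal (exp (C' * s) * \<bar>y s\<bar> powr p) * indicator {0..} s \<partial>lborel)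
    \<le> ennreal ((p / - C') powr p * exp (B - C')) * exp_int B p h"
proof -
  have [measurable]: "h \<in> borel_measurable borel" using inc by (simp add: increments_le_def)
  define f where "f = (\<lambda>s. exp (C' / p * s) * (\<bar>h s\<bar> * indicator {-1..} s))"
  define Y where "Y = (\<lambda>s. exp (C' / p * s) * (y s * indicator {0..} s))"
  have [measurable]: "f \<in> borel_measurable borel" "Y \<in> borel_measurable borel"
    unfolding f_def Y_def by measurable
  have "AE s in lborel. ennreal \<bar>Y s\<bar>
      \<le> (\<integral>\<^sup>+t. ennreal (exp (- (- C' / p) * t) * indicator {0..} t * f (s + (-1) * t)) \<partial>lborel)"
    using le
  proof eventually_elim
    case (elim s)
    show ?case
    proof (cases "s \<ge> 0")
      case True
      have "ennreal \<bar>Y s\<bar> = ennreal (exp (C' / p * s)) * ennreal (y s)"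
        using True y_nonneg[of s] by (simp add: Y_def ennreal_mult)
      also have "\<dots> \<le> ennreal (exp (C' / p * s)) * (\<integral>\<^sup>+\<sigma>. ennreal \<bar>h \<sigma>\<bar> * indicator {-1..s} \<sigma> \<partial>lborel)"
        using elim True by (intro mult_left_mono) auto
      also have "\<dots> = (\<integral>\<^sup>+\<sigma>. ennreal (exp (C' / p * s)) * (ennreal \<bar>h \<sigma>\<bar> * indicator {-1..s} \<sigma>) \<partial>lborel)"
        by (rule nn_integral_cmult[symmetric]) measurable
      also have "\<dots> = (\<integral>\<^sup>+t. ennreal (exp (C' / p * s)) * (ennreal \<bar>h (s + (-1) * t)\<bar> * indicator {-1..s} (s + (-1) * t)) \<partial>lborel)"
        by (subst nn_integral_real_affine[where c = "-1" and t = s]) auto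
      also have "\<dots> = (\<integral>\<^sup>+t. ennreal (exp (- (- C' / p) * t) * indicator {0..} t * f (s + (-1) * t)) \<partial>lborel)"
      proof (intro nn_integral_cong)
        fix t
        have "exp (- (- C' / p) * t) * exp (C' / p * (s + (-1) * t)) = exp (C' / p * s)"
          unfolding exp_add[symmetric] by (simp add: right_diff_distrib diff_divide_distrib)
        then have "exp (- (- C' / p) * t) * indicator {0..} t * f (s + (-1) * t)
            = exp (C' / p * s) * (\<bar>h (s + (-1) * t)\<bar> * (indicator {0..} t * indicator {-1..} (s + (-1) * t)))"
          unfolding f_def by (simp only: mult_ac)
        also have "indicator {0..} t * indicator {-1..} (s + (-1) * t) = (indicator {-1..s} (s + (-1) * t) :: real)"
          by (auto simp: indicator_def)
        finally have eq: "exp (- (- C' / p) * t) * indicator {0..} t * f (s + (-1) * t)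
            = exp (C' / p * s) * (\<bar>h (s + (-1) * t)\<bar> * indicator {-1..s} (s + (-1) * t))" .
        show "ennreal (exp (C' / p * s)) * (ennreal \<bar>h (s + (-1) * t)\<bar> * indicator {-1..s} (s + (-1) * t))
            = ennreal (exp (- (- C' / p) * t) * indicator {0..} t * f (s + (-1) * t))"
          unfolding eq by (simp add: ennreal_mult ennreal_indicator)
      qed
      finally show ?thesis .
    qed (simp add: Y_def)
  qed
  then have "(\<integral>\<^sup>+s. ennreal (\<bar>Y s\<bar> powr p) \<partial>lborel)
      \<le> ennreal ((1 / (- C' / p)) powr p) * (\<integral>\<^sup>+s. ennreal (f s powr p) \<partial>lborel)"
    using C' p by (intro hardy_convolution[where e = "-1"]) (auto simp: f_def intro!: divide_neg_pos)
  also have "(\<integral>\<^sup>+s. ennreal (f s powr p) \<partial>lborel) \<le> (\<integral>\<^sup>+s. ennreal (exp (B - C')) * ennreal (exp (B * s) * \<bar>h s\<bar> powr p) \<partial>lborel)"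
  proof (rule nn_integral_mono)
    fix s
    have "f s powr p \<le> exp (B - C') * (exp (B * s) * \<bar>h s\<bar> powr p)"
    proof (cases "s \<ge> -1")
      case True
      have "f s powr p = exp (C' * s) * \<bar>h s\<bar> powr p"
        using p True by (intro exp_times_powr) (auto simp: f_def)
      also have "exp (C' * s) \<le> exp (B - C') * exp (B * s)"
      proof -
        have "0 \<le> (B - C') * (s + 1)" using C' True by (intro mult_nonneg_nonneg) auto
        then show ?thesis unfolding exp_add[symmetric] by (simp add: algebra_simps)
      qed
      finally show ?thesis by (simp add: mult_right_mono mult.assoc)
    qed (simp add: f_def)
    then show "ennreal (f s powr p) \<le> ennreal (exp (B - C')) * ennreal (exp (B * s) * \<bar>h s\<bar> powr p)"
      by (simp add: ennreal_mult[symmetric] ennreal_leI)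
  qed
  also have "\<dots> = ennreal (exp (B - C')) * exp_int B p h"
    unfolding exp_int_def by (rule nn_integral_cmult) measurable
  finally have "(\<integral>\<^sup>+s. ennreal (\<bar>Y s\<bar> powr p) \<partial>lborel)
      \<le> ennreal ((p / - C') powr p * exp (B - C')) * exp_int B p h"
    by (simp add: mult_left_mono mult.assoc ennreal_mult)
  moreover have "ennreal (exp (C' * s) * \<bar>y s\<bar> powr p) * indicator {0..} s = ennreal (\<bar>Y s\<bar> powr p)" for s
  proof (cases "s \<ge> 0")
    case True
    have "\<bar>Y s\<bar> powr p = exp (C' * s) * \<bar>y s\<bar> powr p"
      using p True by (intro exp_times_powr) (auto simp: Y_def abs_mult)
    then show ?thesis using True by simp
  qed (simp add: Y_def)
  ultimately show ?thesis by simp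
qed

text \<open>Since C < 0, constants have finite integral on the half-line. So \<open>w\<close> is
  split into its value at a good base point, bounded through the integral of \<open>w\<close>, and
  the increment from there, bounded through \<open>h\<close> by Hardy's and Young's
  inequalities.\<close>

lemma half_line_bound_decaying:
  assumes q: "r \<le> q" and p: "p \<ge> 1" and r: "0 < r" "r \<le> p" and C: "C < 0" "C < r * B / p"
  shows "half_line_bound A q B p C r"
proof -
  \<comment> \<open>The auxiliary weight must satisfy C < rC'/p for Young's inequality, and C' < 0
    and C' \<le> B for Hardy's. The two assumptions on \<open>C\<close> leave room between
    \<open>X\<close> and \<open>min 0 B\<close>.\<close>
  define X where "X = C * p / r"
  have X: "X < min 0 B"
    using C r p by (simp add: X_def divide_less_eq mult_neg_pos pos_less_divide_eq mult.commute)
  obtain C' where C': "X < C'" "C' < 0" "C' \<le> B"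
    using dense[OF X] by auto
  then have CC: "C < r * C' / p"
    using r p by (simp add: X_def pos_divide_less_eq pos_less_divide_eq mult.commute)
  obtain K where K: "K > 0" "\<And>y. y \<in> borel_measurable borel \<Longrightarrow>
     (\<integral>\<^sup>+s. ennreal (exp (C * s) * \<bar>y s\<bar> powr r) * indicator {0..} s \<partial>lborel)
       \<le> (\<integral>\<^sup>+s. ennreal (exp (C' * s) * \<bar>y s\<bar> powr p) * indicator {0..} s \<partial>lborel) + ennreal K"
    using half_line_Young[OF r CC] by blast
  define E where "E = exp \<bar>A\<bar>"
  define L where "L = (p / - C') powr p * exp (B - C')"
  define D where "D = 1 / - C"
  have D: "D \<ge> 0" using C(1) by (simp add: D_def)
  define a b c where "a = 2 powr r * (K + (1 + E) * D)" and "b = 2 powr r * (E * D)" and "c = 2 powr r * L"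
  have E: "E > 0" and L: "L \<ge> 0" by (simp_all add: E_def L_def)
  have nonneg: "a > 0" "b \<ge> 0" "c \<ge> 0"
    using K(1) E L D by (simp_all add: a_def b_def c_def add_pos_nonneg)
  have "(\<integral>\<^sup>+s. ennreal (exp (C * s) * \<bar>w s\<bar> powr r) * indicator {0..} s \<partial>lborel)
       \<le> ennreal (a + b + c) * (1 + exp_int A q w + exp_int B p h)" if inc: "increments_le w h" for w h
  proof (cases "exp_int A q w < \<infinity>")
    case True
    have [measurable]: "w \<in> borel_measurable borel" "h \<in> borel_measurable borel"
      using inc by (auto simp: increments_le_def)
    define P where "P = exp_int A q w"
    have q0: "q > 0" using q r by simp
    obtain t where t: "t \<in> {-1..0}" "ennreal (\<bar>w t\<bar> powr q) \<le> ennreal E * (1 + P)"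
      and AE_t: "AE s in lborel. ennreal \<bar>w s - w t\<bar> \<le> (\<integral>\<^sup>+\<sigma>. ennreal \<bar>h \<sigma>\<bar> * indicator {min s t..max s t} \<sigma> \<partial>lborel)"
      using increments_le_base_point[OF inc q0 True] unfolding E_def P_def by blast
    define y where "y = (\<lambda>s. \<bar>w s - w t\<bar>)"
    have y[measurable]: "y \<in> borel_measurable borel" unfolding y_def by measurable
    have "AE s in lborel. s \<ge> 0 \<longrightarrow> ennreal (y s) \<le> (\<integral>\<^sup>+\<sigma>. ennreal \<bar>h \<sigma>\<bar> * indicator {-1..s} \<sigma> \<partial>lborel)"
      using AE_t
    proof eventually_elim
      case (elim s)
      have "(\<integral>\<^sup>+\<sigma>. ennreal \<bar>h \<sigma>\<bar> * indicator {min s t..max s t} \<sigma> \<partial>lborel)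
          \<le> (\<integral>\<^sup>+\<sigma>. ennreal \<bar>h \<sigma>\<bar> * indicator {-1..s} \<sigma> \<partial>lborel)" if "s \<ge> 0"
        using t(1) that by (intro nn_integral_mono) (auto simp: indicator_def)
      then show ?case using elim by (auto simp: y_def)
    qed
    from hardy_from_base_point[OF inc p C'(2,3) y _ this]
    have hardy: "(\<integral>\<^sup>+s. ennreal (exp (C' * s) * \<bar>y s\<bar> powr p) * indicator {0..} s \<partial>lborel) \<le> ennreal L * exp_int B p h"
      by (simp add: y_def L_def)
    \<comment> \<open>The base point is controlled with exponent \<open>q\<close>; since r \<le> q,
      passing to \<open>r\<close> costs the additive 1 that covers values of modulus at most
      1.\<close>
    have wt: "ennreal (\<bar>w t\<bar> powr r) \<le> 1 + ennreal E * (1 + P)"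
    proof (cases "\<bar>w t\<bar> \<le> 1")
      case True
      then have "\<bar>w t\<bar> powr r \<le> 1 powr r" using r by (intro powr_mono2) auto
      then have "ennreal (\<bar>w t\<bar> powr r) \<le> 1" by simp
      then show ?thesis by (rule order_trans) simp
    next
      case False
      then have "\<bar>w t\<bar> powr r \<le> \<bar>w t\<bar> powr q" using q by (intro powr_mono) auto
      then have "ennreal (\<bar>w t\<bar> powr r) \<le> ennreal E * (1 + P)"
        using t(2) by (meson ennreal_leI order_trans)
      then show ?thesis by (rule order_trans) simp
    qed
    let ?e = "\<lambda>s. ennreal (exp (- (- C) * s)) * indicator {0..} s"
    let ?y = "\<lambda>s. ennreal (exp (C * s) * \<bar>y s\<bar> powr r) * indicator {0..} s"
    have "(\<integral>\<^sup>+s. ennreal (exp (C * s) * \<bar>w s\<bar> powr r) * indicator {0..} s \<partial>lborel)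
        \<le> (\<integral>\<^sup>+s. ennreal (2 powr r) * (ennreal (\<bar>w t\<bar> powr r) * ?e s + ?y s) \<partial>lborel)"
    proof (rule nn_integral_mono)
      fix s :: real
      have "\<bar>w s\<bar> powr r \<le> (\<bar>w t\<bar> + y s) powr r"
        using r by (intro powr_mono2) (auto simp: y_def)
      also have "\<dots> \<le> 2 powr r * (\<bar>w t\<bar> powr r + y s powr r)"
        using r by (intro powr_add_le) (auto simp: y_def)
      finally have "exp (C * s) * \<bar>w s\<bar> powr r \<le> exp (C * s) * (2 powr r * (\<bar>w t\<bar> powr r + y s powr r))"
        by (intro mult_left_mono) auto
      also have "\<dots> = 2 powr r * (\<bar>w t\<bar> powr r * exp (- (- C) * s) + exp (C * s) * \<bar>y s\<bar> powr r)"
        by (simp add: y_def algebra_simps)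
      finally have "ennreal (exp (C * s) * \<bar>w s\<bar> powr r) \<le> \<dots>"
        by (rule ennreal_leI)
      also have "\<dots> = ennreal (2 powr r) * (ennreal (\<bar>w t\<bar> powr r) * ennreal (exp (- (- C) * s)) + ennreal (exp (C * s) * \<bar>y s\<bar> powr r))"
        by (simp add: ennreal_mult ennreal_plus)
      finally show "ennreal (exp (C * s) * \<bar>w s\<bar> powr r) * indicator {0..} s \<le> ennreal (2 powr r) * (ennreal (\<bar>w t\<bar> powr r) * ?e s + ?y s)"
        by (cases "s \<ge> 0") auto
    qed
    also have "\<dots> = ennreal (2 powr r) * (ennreal (\<bar>w t\<bar> powr r) * (\<integral>\<^sup>+s. ?e s \<partial>lborel) + (\<integral>\<^sup>+s. ?y s \<partial>lborel))"
      by (simp add: nn_integral_cmult nn_integral_add)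
    also have "(\<integral>\<^sup>+s. ?e s \<partial>lborel) = ennreal (1 / - C)"
      using C(1) by (intro nn_integral_exp_half_line) simp
    also have "(\<integral>\<^sup>+s. ?y s \<partial>lborel) \<le> ennreal L * exp_int B p h + ennreal K"
      by (rule order_trans[OF K(2)[OF y] add_right_mono[OF hardy]])
    also note wt
    finally have "(\<integral>\<^sup>+s. ennreal (exp (C * s) * \<bar>w s\<bar> powr r) * indicator {0..} s \<partial>lborel)
        \<le> ennreal (2 powr r) * ((1 + ennreal E * (1 + P)) * ennreal (1 / - C) + (ennreal L * exp_int B p h + ennreal K))"
      by (simp add: mult_left_mono mult_right_mono add_mono)
    also have "\<dots> = ennreal a + ennreal b * P + ennreal c * exp_int B p h"
    proof -
      have "ennreal a = ennreal (2 powr r) * (ennreal K + (1 + ennreal E) * ennreal D)"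
        using K(1) E D by (simp add: a_def ennreal_mult[symmetric] ennreal_plus[symmetric]
            ennreal_1[symmetric] del: ennreal_1 ennreal_plus)
      moreover have "ennreal b = ennreal (2 powr r) * (ennreal E * ennreal D)"
        using E D by (simp add: b_def ennreal_mult)
      moreover have "ennreal c = ennreal (2 powr r) * ennreal L"
        using L by (simp add: c_def ennreal_mult)
      ultimately show ?thesis
        unfolding D_def[symmetric] by (simp add: distrib_left distrib_right mult_ac add_ac)
    qed
    also have "\<dots> \<le> ennreal (a + b + c) * (1 + exp_int A q w + exp_int B p h)"
      unfolding P_def using nonneg by (intro ennreal_affine_le) auto
    finally show ?thesis .
  next
    case False
    then have "exp_int A q w = \<infinity>" by (metis infinity_ennreal_def top.not_eq_extremum)
    moreover have "ennreal (a + b + c) \<noteq> 0" using nonneg by (simp add: ennreal_eq_0_iff)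
    ultimately have "ennreal (a + b + c) * (1 + exp_int A q w + exp_int B p h) = \<infinity>"
      by (simp add: ennreal_mult_top del: ennreal_plus)
    then show ?thesis by simp
  qed
  then show ?thesis
    unfolding half_line_bound_def using nonneg by (intro exI[of _ "a + b + c"]) auto
qed

section \<open>Bounds on the whole line\<close>

lemma line_bound_refl:
  assumes "r = q" "C = A"
  shows "line_bound A q B p C r"
proof -
  have "exp_int C r w \<le> ennreal (0 + 1 + 0) * (1 + exp_int A q w + exp_int B p h)" for w h
    using ennreal_affine_le[of 0 1 0 "exp_int A q w" "exp_int B p h"] assms by simp
  then show ?thesis unfolding line_bound_def by (intro exI[of _ 1]) auto
qed

text \<open>Young's inequality cannot reach the endpoint weight, but for \<open>r = p\<close> no
  exponent has to be lowered: Hardy's inequality is global, taken from plus infinity if B > 0 and,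
  after reflection, from minus infinity if B < 0.\<close>

lemma line_bound_hardy:
  assumes q: "q > 0" and p: "p \<ge> 1" and "r = p" "C = B" and "A \<ge> 0 \<and> B > 0 \<or> A \<le> 0 \<and> B < 0"
  shows "line_bound A q B p C r"
proof -
  define L where "L = (p / \<bar>B\<bar>) powr p"
  have L: "L > 0" using assms by (auto simp: L_def)
  have "exp_int C r w \<le> ennreal (0 + 0 + L) * (1 + exp_int A q w + exp_int B p h)" if inc: "increments_le w h" for w h
  proof (cases "exp_int A q w < \<infinity>")
    case True
    have m: "w \<in> borel_measurable borel" "h \<in> borel_measurable borel"
      using inc by (auto simp: increments_le_def)
    from assms(5) have "exp_int B p w \<le> ennreal L * exp_int B p h"
    proof
      assume "A \<ge> 0 \<and> B > 0"
      then show ?thesis using hardy_at_infinity[OF inc _ q True _ p] by (simp add: L_def)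
    next
      assume AB: "A \<le> 0 \<and> B < 0"
      have "exp_int (- B) p (\<lambda>s. w (- s)) \<le> ennreal ((p / - B) powr p) * exp_int (- B) p (\<lambda>s. h (- s))"
        using AB True by (intro hardy_at_infinity[OF increments_le_uminus[OF inc] _ q, of "- A"])
          (auto simp: p exp_int_uminus[OF m(1)])
      then show ?thesis using AB by (simp only: m[THEN exp_int_uminus] L_def abs_of_neg)
    qed
    also have "\<dots> = ennreal 0 + ennreal 0 * exp_int A q w + ennreal L * exp_int B p h"
      by simp
    also have "\<dots> \<le> ennreal (0 + 0 + L) * (1 + exp_int A q w + exp_int B p h)"
      using L by (intro ennreal_affine_le) auto
    finally show ?thesis using assms(3,4) by simp
  next
    case False
    then have "exp_int A q w = \<infinity>" by (metis infinity_ennreal_def top.not_eq_extremum)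
    moreover have "ennreal L \<noteq> 0" using L by (simp add: ennreal_eq_0_iff)
    ultimately have "ennreal L * (1 + exp_int A q w + exp_int B p h) = \<infinity>"
      by (simp add: ennreal_mult_top)
    then show ?thesis by simp
  qed
  then show ?thesis
    unfolding line_bound_def using L by (intro exI[of _ L]) auto
qed

lemma line_bound_cases:
  assumes r: "1 \<le> r" "r \<le> p" "r \<le> q"
    and cases: "((A \<le> 0 \<and> B \<le> 0 \<or> A \<ge> 0 \<and> B \<ge> 0) \<and> A / q \<noteq> B / p
          \<and> min (r * A / q) (r * B / p) < C \<and> C < max (r * A / q) (r * B / p))
      \<or> ((A < 0 \<and> B > 0 \<or> A > 0 \<and> B < 0) \<and> min (r * A / q) 0 < C \<and> C < max (r * A / q) 0)
      \<or> (r = q \<and> C = A)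
      \<or> (r = p \<and> (A \<le> 0 \<and> B < 0 \<or> A \<ge> 0 \<and> B > 0) \<and> C = B)"
  shows "line_bound A q B p C r"
proof -
  have pos: "r > 0" "p \<ge> 1" "p > 0" "q > 0" using r by auto
  have sgn: "A \<ge> 0 \<Longrightarrow> r * A / q \<ge> 0" "A \<le> 0 \<Longrightarrow> r * A / q \<le> 0"
    "B \<ge> 0 \<Longrightarrow> r * B / p \<ge> 0" "B \<le> 0 \<Longrightarrow> r * B / p \<le> 0"
    "r * B / p > 0 \<Longrightarrow> B > 0" "r * B / p < 0 \<Longrightarrow> B < 0"
    using pos by (auto simp: zero_less_mult_iff zero_less_divide_iff divide_less_0_iff mult_less_0_iff
      intro!: divide_nonneg_pos divide_nonpos_pos mult_nonneg_nonpos mult_nonneg_nonneg)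
  note W = half_line_bound_by_weight[OF pos(1) r(3), where B = B and p = p, of C A]
  note W' = half_line_bound_by_weight[OF pos(1) r(3), where B = "- B" and p = p, of "- C" "- A", simplified]
  note V = half_line_bound_vanishing[OF _ pos(4) _ pos(2) pos(1) r(2), of A B C]
  note V' = half_line_bound_vanishing[OF _ pos(4) _ pos(2) pos(1) r(2), of "- A" "- B" "- C", simplified]
  note D = half_line_bound_decaying[OF r(3) pos(2) pos(1) r(2), of C B A]
  note D' = half_line_bound_decaying[OF r(3) pos(2) pos(1) r(2), of "- C" "- B" "- A", simplified]
  from cases show ?thesis
  proof (elim disjE)
    assume i: "(A \<le> 0 \<and> B \<le> 0 \<or> A \<ge> 0 \<and> B \<ge> 0) \<and> A / q \<noteq> B / p
          \<and> min (r * A / q) (r * B / p) < C \<and> C < max (r * A / q) (r * B / p)"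
    then consider "r * A / q < C" "C < r * B / p" | "r * B / p < C" "C < r * A / q"
      by linarith
    then show ?thesis
    proof cases
      case 1
      have "half_line_bound A q B p C r"
      proof (cases "A \<ge> 0 \<and> B \<ge> 0")
        case True
        then have "B > 0" using 1 sgn by linarith
        then show ?thesis using True 1 by (intro V) auto
      next
        case False
        then have "C < 0" using i 1 sgn by linarith
        then show ?thesis using 1 by (intro D)
      qed
      moreover have "half_line_bound (- A) q (- B) p (- C) r" using 1 by (intro W')
      ultimately show ?thesis by (rule line_bound_if_half_line_bounds)
    next
      case 2
      have "half_line_bound (- A) q (- B) p (- C) r"
      proof (cases "A \<le> 0 \<and> B \<le> 0")
        case True
        then have "B < 0" using 2 sgn by linarith
        then show ?thesis using True 2 by (intro V') auto
      next
        case False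
        then have "C > 0" using i 2 sgn by linarith
        then show ?thesis using 2 by (intro D')
      qed
      moreover have "half_line_bound A q B p C r" using 2 by (intro W)
      ultimately show ?thesis using line_bound_if_half_line_bounds by blast
    qed
  next
    assume ii: "(A < 0 \<and> B > 0 \<or> A > 0 \<and> B < 0) \<and> min (r * A / q) 0 < C \<and> C < max (r * A / q) 0"
    show ?thesis
    proof (cases "A < 0")
      case True
      then have "C < 0" "r * A / q < C" "C < r * B / p" using ii sgn by linarith+
      then show ?thesis by (intro line_bound_if_half_line_bounds D W')
    next
      case False
      then have "C > 0" "C < r * A / q" "r * B / p < C" using ii sgn by linarith+
      then show ?thesis by (intro line_bound_if_half_line_bounds D' W)
    qed
  next
    assume "r = q \<and> C = A"
    then show ?thesis by (intro line_bound_refl) auto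
  next
    assume "r = p \<and> (A \<le> 0 \<and> B < 0 \<or> A \<ge> 0 \<and> B > 0) \<and> C = B"
    then show ?thesis using pos by (intro line_bound_hardy) auto
  qed
qed

section \<open>Integration along the dilation flow\<close>

definition shell :: "'a::euclidean_space set" where
  "shell = {x. 1 \<le> norm x \<and> norm x < exp 1}"

lemma shell_borel [measurable]: "shell \<in> sets borel"
  unfolding shell_def by measurable

text \<open>Finiteness lets the additive 1 of the bound on each ray survive integration over the
  rays.\<close>

lemma emeasure_shell: "emeasure lborel (shell :: 'a::euclidean_space set) < \<infinity>"
proof -
  have "emeasure lborel (shell :: 'a set) \<le> emeasure lborel (cball (0 :: 'a) (exp 1))"
    by (rule emeasure_mono) (auto simp: shell_def)
  also have "\<dots> < \<infinity>"
    by (intro emeasure_bounded_finite bounded_cball)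
  finally show ?thesis .
qed

text \<open>Stands in for polar coordinates: the flow of dilations meets the shell for a time interval of
  length one, so the shell can play the role of the unit sphere.\<close>

lemma nn_integral_dilation_flow:
  fixes F :: "'a::euclidean_space \<Rightarrow> ennreal"
  assumes [measurable]: "F \<in> borel_measurable borel"
  shows "(\<integral>\<^sup>+x. F x \<partial>lborel)
    = (\<integral>\<^sup>+x. (\<integral>\<^sup>+s. ennreal (exp (real DIM('a) * s)) * F (exp s *\<^sub>R x) \<partial>lborel) * indicator shell x \<partial>lborel)"
proof -
  have "AE y in lborel. y \<noteq> (0::'a)" by (rule AE_lborel_singleton)
  then have "(\<integral>\<^sup>+y. F y \<partial>lborel) = (\<integral>\<^sup>+y. \<integral>\<^sup>+s. F y * indicator shell (exp (- s) *\<^sub>R y) \<partial>lborel \<partial>lborel)"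
  proof (intro nn_integral_cong_AE, eventually_elim)
    case (elim y)
    have "(\<integral>\<^sup>+s. F y * indicator shell (exp (- s) *\<^sub>R y) \<partial>lborel)
        = F y * (\<integral>\<^sup>+s. indicator shell (exp (- s) *\<^sub>R y) \<partial>lborel)"
      by (rule nn_integral_cmult) measurable
    also have "(\<integral>\<^sup>+s. indicator shell (exp (- s) *\<^sub>R y) \<partial>lborel) = (\<integral>\<^sup>+s. indicator {ln (norm y) - 1<..ln (norm y)} s \<partial>lborel)"
    proof (rule nn_integral_cong)
      fix s
      have "norm (exp (- s) *\<^sub>R y) = exp (ln (norm y) - s)"
        using elim by (simp add: exp_diff exp_minus divide_inverse mult.commute)
      then have "exp (- s) *\<^sub>R y \<in> shell \<longleftrightarrow> exp 0 \<le> exp (ln (norm y) - s) \<and> exp (ln (norm y) - s) < exp 1"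
        by (simp add: shell_def)
      also have "\<dots> \<longleftrightarrow> s \<in> {ln (norm y) - 1<..ln (norm y)}"
        unfolding exp_le_cancel_iff exp_less_cancel_iff by auto
      finally show "indicator shell (exp (- s) *\<^sub>R y) = (indicator {ln (norm y) - 1<..ln (norm y)} s :: ennreal)"
        by (simp add: indicator_def)
    qed
    also have "\<dots> = 1" by simp
    finally show ?case by simp
  qed
  also have "\<dots> = (\<integral>\<^sup>+s. \<integral>\<^sup>+y. F y * indicator shell (exp (- s) *\<^sub>R y) \<partial>lborel \<partial>lborel)"
    by (rule lborel_pair.Fubini') measurable
  also have "\<dots> = (\<integral>\<^sup>+s. \<integral>\<^sup>+x. ennreal (exp (real DIM('a) * s)) * F (exp s *\<^sub>R x) * indicator shell x \<partial>lborel \<partial>lborel)"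
  proof (rule nn_integral_cong)
    fix s
    have "(\<integral>\<^sup>+y. F y * indicator shell (exp (- s) *\<^sub>R y) \<partial>lborel)
        = ennreal (exp s ^ DIM('a)) * (\<integral>\<^sup>+x. F (exp s *\<^sub>R x) * indicator shell (exp (- s) *\<^sub>R exp s *\<^sub>R x) \<partial>lborel)"
      by (rule nn_integral_lborel_dilation) auto
    also have "\<dots> = (\<integral>\<^sup>+x. ennreal (exp s ^ DIM('a)) * (F (exp s *\<^sub>R x) * indicator shell x) \<partial>lborel)"
      by (subst nn_integral_cmult[symmetric]) (auto simp flip: exp_add)
    finally show "(\<integral>\<^sup>+y. F y * indicator shell (exp (- s) *\<^sub>R y) \<partial>lborel)
        = (\<integral>\<^sup>+x. ennreal (exp (real DIM('a) * s)) * F (exp s *\<^sub>R x) * indicator shell x \<partial>lborel)"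
      by (simp add: mult.assoc exp_of_nat_mult)
  qed
  also have "\<dots> = (\<integral>\<^sup>+x. \<integral>\<^sup>+s. ennreal (exp (real DIM('a) * s)) * F (exp s *\<^sub>R x) * indicator shell x \<partial>lborel \<partial>lborel)"
    by (rule lborel_pair.Fubini') measurable
  also have "\<dots> = (\<integral>\<^sup>+x. (\<integral>\<^sup>+s. ennreal (exp (real DIM('a) * s)) * F (exp s *\<^sub>R x) \<partial>lborel) * indicator shell x \<partial>lborel)"
    by (intro nn_integral_cong nn_integral_multc) measurable
  finally show ?thesis .
qed

text \<open>The Jacobian of the flow shifts the exponent of the weight by the dimension. The factor
  \<open>norm x powr d\<close> that remains is harmless on the shell.\<close>

lemma exp_int_ray:
  fixes u :: "'a::euclidean_space \<Rightarrow> real"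
  assumes [measurable]: "u \<in> borel_measurable borel" and x: "x \<noteq> 0"
  shows "(\<integral>\<^sup>+s. ennreal (exp (real DIM('a) * s)) * ennreal (norm (exp s *\<^sub>R x) powr d * \<bar>u (exp s *\<^sub>R x)\<bar> powr q) \<partial>lborel)
    = ennreal (norm x powr d) * exp_int (d + real DIM('a)) q (\<lambda>s. u (exp s *\<^sub>R x))"
proof -
  have "exp (real DIM('a) * s) * (norm (exp s *\<^sub>R x) powr d * \<bar>u (exp s *\<^sub>R x)\<bar> powr q)
      = norm x powr d * (exp ((d + real DIM('a)) * s) * \<bar>u (exp s *\<^sub>R x)\<bar> powr q)" for s
  proof -
    have "norm (exp s *\<^sub>R x) powr d = exp (d * s) * norm x powr d"
      by (simp add: powr_mult exp_powr_real mult.commute)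
    moreover have "exp ((d + real DIM('a)) * s) = exp (d * s) * exp (real DIM('a) * s)"
      by (simp only: distrib_right exp_add)
    ultimately show ?thesis by (simp only: mult_ac)
  qed
  then show ?thesis
    unfolding exp_int_def
    by (subst nn_integral_cmult[symmetric]) (auto intro!: nn_integral_cong simp flip: ennreal_mult)
qed

lemma wint_eq_shell_integral:
  fixes u :: "'a::euclidean_space \<Rightarrow> real"
  assumes [measurable]: "u \<in> borel_measurable borel"
  shows "wint d q u = (\<integral>\<^sup>+x. ennreal (norm x powr d) * exp_int (d + real DIM('a)) q (\<lambda>s. u (exp s *\<^sub>R x)) * indicator shell x \<partial>lborel)"
proof -
  have "wint d q u = (\<integral>\<^sup>+x. ennreal (norm x powr d * \<bar>u x\<bar> powr q) \<partial>lborel)"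
    unfolding wint_def by (rule nn_integral_completion) measurable
  also have "\<dots> = (\<integral>\<^sup>+x. (\<integral>\<^sup>+s. ennreal (exp (real DIM('a) * s)) *
      ennreal (norm (exp s *\<^sub>R x) powr d * \<bar>u (exp s *\<^sub>R x)\<bar> powr q) \<partial>lborel) * indicator shell x \<partial>lborel)"
    by (rule nn_integral_dilation_flow) measurable
  also have "\<dots> = (\<integral>\<^sup>+x. ennreal (norm x powr d) * exp_int (d + real DIM('a)) q (\<lambda>s. u (exp s *\<^sub>R x)) * indicator shell x \<partial>lborel)"
  proof (rule nn_integral_cong)
    fix x :: 'a
    show "(\<integral>\<^sup>+s. ennreal (exp (real DIM('a) * s)) *
      ennreal (norm (exp s *\<^sub>R x) powr d * \<bar>u (exp s *\<^sub>R x)\<bar> powr q) \<partial>lborel) * indicator shell x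
      = ennreal (norm x powr d) * exp_int (d + real DIM('a)) q (\<lambda>s. u (exp s *\<^sub>R x)) * indicator shell x"
    proof (cases "x \<in> shell")
      case True
      then have "x \<noteq> 0" by (auto simp: shell_def)
      show ?thesis unfolding exp_int_ray[OF assms \<open>x \<noteq> 0\<close>] ..
    qed simp
  qed
  finally show ?thesis .
qed

lemma norm_powr_shell: "x \<in> shell \<Longrightarrow> norm x powr d \<le> exp \<bar>d\<bar>"
proof -
  assume "x \<in> shell"
  then have n: "1 \<le> norm x" "norm x < exp 1" by (simp_all add: shell_def)
  then have "norm x > 0" by linarith
  moreover from this have "ln (norm x) < ln (exp 1)" using n by (simp only: ln_less_cancel_iff exp_gt_zero)
  ultimately have x: "norm x > 0" "0 \<le> ln (norm x)" "ln (norm x) < 1"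
    using n by simp_all
  have "d * ln (norm x) \<le> \<bar>d\<bar> * 1"
    using x by (intro mult_mono) auto
  then show ?thesis using x by (simp add: powr_def)
qed

text \<open>The line bound is applied to almost every ray and integrated over the shell. The factor
  \<open>norm x * exp s\<close> in \<open>h\<close> contributes \<open>p\<close> to the exponent, so
  the weight \<open>b - p + N\<close> for \<open>h\<close> is the weight \<open>b + N\<close> for
  \<open>g\<close>.\<close>

lemma (in radial_pair) wint_le:
  assumes bound: "\<And>w h. increments_le w h \<Longrightarrow>
      exp_int (c + real DIM('a)) r w \<le> ennreal K * (1 + exp_int (a + real DIM('a)) q w + exp_int (b - p + real DIM('a)) p h)"
    and K: "K \<ge> 0"
  shows "wint c r u \<le> ennreal (exp \<bar>c\<bar> * K * exp \<bar>a\<bar> * exp \<bar>p - b\<bar>) * (emeasure lborel (shell :: 'a set) + wint a q u + wint b p g)"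
proof -
  let ?N = "real DIM('a)"
  let ?w = "\<lambda>x s. u (exp s *\<^sub>R x)" and ?g = "\<lambda>x s. g (exp s *\<^sub>R x)"
  \<comment> \<open>The exponentials compare powers of \<open>norm x\<close> with 1 on the shell:
    from above for \<open>c\<close> and \<open>p - b\<close>, from below for \<open>a\<close>. Using
    the product for all terms allows it to be factored out.\<close>
  define L where "L = exp \<bar>c\<bar> * K * exp \<bar>a\<bar> * exp \<bar>p - b\<bar>"
  have w[measurable]: "(\<lambda>x. exp_int d e (?w x)) \<in> borel_measurable borel" for d e
    unfolding exp_int_def by measurable
  have g[measurable]: "(\<lambda>x. exp_int d e (?g x)) \<in> borel_measurable borel" for d e
    unfolding exp_int_def by measurable
  define X where "X = (\<lambda>x. ennreal (norm x powr a) * exp_int (a + ?N) q (?w x))"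
  define Y where "Y = (\<lambda>x. ennreal (norm x powr b) * exp_int (b + ?N) p (?g x))"
  have [measurable]: "X \<in> borel_measurable borel" "Y \<in> borel_measurable borel"
    unfolding X_def Y_def by measurable
  have "AE x in lborel. increments_le (?w x) (\<lambda>s. norm x * exp s * g (exp s *\<^sub>R x))"
    using AE_rays_difference_le unfolding increments_le_def by eventually_elim (intro conjI; measurable)
  then have "AE x in lborel. ennreal (norm x powr c) * exp_int (c + ?N) r (?w x) * indicator shell x
      \<le> ennreal L * (1 + X x + Y x) * indicator shell x"
  proof eventually_elim
    case (elim x)
    show ?case
    proof (cases "x \<in> shell")
      case True
      then have x: "x \<noteq> 0" by (auto simp: shell_def)
      have "exp_int (a + ?N) q (?w x) \<le> ennreal (exp \<bar>a\<bar>) * X x"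
      proof -
        have "1 \<le> exp \<bar>a\<bar> * norm x powr a"
          using norm_powr_shell[OF True, of "- a"] x by (simp add: powr_minus field_simps)
        then have "ennreal 1 * exp_int (a + ?N) q (?w x) \<le> ennreal (exp \<bar>a\<bar> * norm x powr a) * exp_int (a + ?N) q (?w x)"
          by (intro mult_right_mono ennreal_leI) auto
        then show ?thesis by (simp add: X_def ennreal_mult mult.assoc)
      qed
      also have "\<dots> \<le> ennreal (exp \<bar>a\<bar> * exp \<bar>p - b\<bar>) * X x"
        by (intro mult_right_mono ennreal_leI) auto
      finally have 1: "exp_int (a + ?N) q (?w x) \<le> ennreal (exp \<bar>a\<bar> * exp \<bar>p - b\<bar>) * X x" .
      have "exp_int (b - p + ?N) p (\<lambda>s. norm x * exp s * g (exp s *\<^sub>R x)) = ennreal (norm x powr (p - b)) * Y x"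
      proof -
        have "exp ((b - p + ?N) * s) * \<bar>norm x * exp s * g (exp s *\<^sub>R x)\<bar> powr p
            = norm x powr (p - b) * norm x powr b * (exp ((b + ?N) * s) * \<bar>g (exp s *\<^sub>R x)\<bar> powr p)" for s
        proof -
          have "\<bar>norm x * exp s * g (exp s *\<^sub>R x)\<bar> powr p = norm x powr p * exp (p * s) * \<bar>g (exp s *\<^sub>R x)\<bar> powr p"
            by (simp add: abs_mult powr_mult exp_powr_real mult.commute)
          moreover have "exp ((b - p + ?N) * s) * exp (p * s) = exp ((b + ?N) * s)"
            unfolding exp_add[symmetric] by (simp add: algebra_simps)
          moreover have "norm x powr (p - b) * norm x powr b = norm x powr p"
            using x by (simp flip: powr_add)
          moreover have "e1 * (n1 * e2 * G) = n1 * (e1 * e2 * G)" for e1 n1 e2 G :: real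
            by (simp only: mult_ac)
          ultimately show ?thesis by (simp only:)
        qed
        then have "exp_int (b - p + ?N) p (\<lambda>s. norm x * exp s * g (exp s *\<^sub>R x))
            = ennreal (norm x powr (p - b) * norm x powr b) * exp_int (b + ?N) p (?g x)"
          unfolding exp_int_def by (simp add: ennreal_mult nn_integral_cmult)
        then show ?thesis by (simp add: Y_def ennreal_mult mult.assoc)
      qed
      also have "\<dots> \<le> ennreal (exp \<bar>a\<bar> * exp \<bar>p - b\<bar>) * Y x"
      proof (intro mult_right_mono ennreal_leI)
        have "1 * norm x powr (p - b) \<le> exp \<bar>a\<bar> * exp \<bar>p - b\<bar>"
          by (intro mult_mono norm_powr_shell True) auto
        then show "norm x powr (p - b) \<le> exp \<bar>a\<bar> * exp \<bar>p - b\<bar>" by simp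
      qed simp
      finally have 2: "exp_int (b - p + ?N) p (\<lambda>s. norm x * exp s * g (exp s *\<^sub>R x)) \<le> ennreal (exp \<bar>a\<bar> * exp \<bar>p - b\<bar>) * Y x" .
      have 3: "1 \<le> ennreal (exp \<bar>a\<bar> * exp \<bar>p - b\<bar>) * 1"
        by (simp flip: exp_add)
      have "exp_int (c + ?N) r (?w x) \<le> ennreal K * (ennreal (exp \<bar>a\<bar> * exp \<bar>p - b\<bar>) * 1
          + ennreal (exp \<bar>a\<bar> * exp \<bar>p - b\<bar>) * X x + ennreal (exp \<bar>a\<bar> * exp \<bar>p - b\<bar>) * Y x)"
        by (rule order_trans[OF bound[OF elim] mult_left_mono[OF add_mono[OF add_mono[OF 3 1] 2]]]) simp
      also have "\<dots> = ennreal K * (ennreal (exp \<bar>a\<bar> * exp \<bar>p - b\<bar>) * (1 + X x + Y x))"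
        by (simp only: distrib_left)
      finally have "ennreal (norm x powr c) * exp_int (c + ?N) r (?w x)
          \<le> ennreal (exp \<bar>c\<bar>) * (ennreal K * (ennreal (exp \<bar>a\<bar> * exp \<bar>p - b\<bar>) * (1 + X x + Y x)))"
        by (intro mult_mono ennreal_leI norm_powr_shell True) auto
      also have "\<dots> = ennreal L * (1 + X x + Y x)"
        unfolding L_def using K by (simp add: ennreal_mult mult.assoc)
      finally show ?thesis using True by simp
    qed simp
  qed
  then have "wint c r u \<le> (\<integral>\<^sup>+x. ennreal L * (1 + X x + Y x) * indicator shell x \<partial>lborel)"
    unfolding wint_eq_shell_integral[OF borel_u] by (rule nn_integral_mono_AE)
  also have "\<dots> = (\<integral>\<^sup>+x. ennreal L * (indicator shell x + X x * indicator shell x + Y x * indicator shell x) \<partial>lborel)"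
    by (intro nn_integral_cong) (simp add: distrib_left distrib_right mult.assoc)
  also have "\<dots> = ennreal L * (emeasure lborel (shell :: 'a set) + wint a q u + wint b p g)"
    unfolding wint_eq_shell_integral[OF borel_u] wint_eq_shell_integral[OF borel_g] X_def[symmetric] Y_def[symmetric]
    by (simp add: nn_integral_cmult nn_integral_add) (simp add: X_def Y_def nn_integral_add)
  finally show ?thesis unfolding L_def .
qed

section \<open>The embedding\<close>

text \<open>Integrability on compact sets and the pairing depend only on almost-everywhere classes,
  and every Lebesgue measurable function has a Borel version.\<close>

lemma radial_pair_borel_version:
  fixes u g :: "'a::euclidean_space \<Rightarrow> real"
  assumes u: "loc_int_punct u" and ug: "radial_deriv u g"
  shows "\<exists>u' g'. radial_pair u' g' \<and> (AE x in lebesgue. u x = u' x) \<and> (AE x in lebesgue. g x = g' x)"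
proof -
  have g: "loc_int_punct g" using ug by (simp add: radial_deriv_def)
  have mu: "u \<in> borel_measurable lebesgue" and mg: "g \<in> borel_measurable lebesgue"
    using u g by (simp_all add: loc_int_punct_def)
  obtain u' where u'[measurable]: "u' \<in> borel_measurable lborel" and eu: "AE x in lebesgue. u x = u' x"
    using completion_ex_borel_measurable_real[OF mu] AE_completion by blast
  obtain g' where g'[measurable]: "g' \<in> borel_measurable lborel" and eg: "AE x in lebesgue. g x = g' x"
    using completion_ex_borel_measurable_real[OF mg] AE_completion by blast
  have LINT_eq: "(LINT x|lebesgue. v x * f x) = (LINT x|lborel. v' x * f x)"
    if v: "v \<in> borel_measurable lebesgue" and v': "v' \<in> borel_measurable lborel"
      and ev: "AE x in lebesgue. v x = v' x" and f: "f \<in> borel_measurable lborel" for v v' f :: "'a \<Rightarrow> real"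
  proof -
    have "(LINT x|lebesgue. v x * f x) = (LINT x|lebesgue. v' x * f x)"
    proof (rule integral_cong_AE)
      show "AE x in lebesgue. v x * f x = v' x * f x"
        using ev by eventually_elim simp
    qed (use v measurable_completion[OF v'] measurable_completion[OF f] in \<open>auto intro!: borel_measurable_times\<close>)
    also have "\<dots> = (LINT x|lborel. v' x * f x)"
      by (rule integral_completion) (intro borel_measurable_times v' f)
    finally show ?thesis .
  qed
  have set_int: "set_integrable lborel K v'"
    if v: "loc_int_punct v" and v': "v' \<in> borel_measurable lborel"
      and ev: "AE x in lebesgue. v x = v' x" and K: "compact K" "0 \<notin> K" for v v' :: "'a \<Rightarrow> real" and K
  proof -
    have [measurable]: "K \<in> sets borel" using K(1) by (simp add: borel_compact)
    have m: "(\<lambda>x. indicator K x *\<^sub>R v' x) \<in> borel_measurable lborel"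
      using v' by measurable
    have "integrable lebesgue (\<lambda>x. indicator K x *\<^sub>R v x)"
      using v K unfolding loc_int_punct_def set_integrable_def by blast
    then have "integrable lebesgue (\<lambda>x. indicator K x *\<^sub>R v' x)"
    proof (rule Bochner_Integration.integrable_cong_AE_imp)
      show "(\<lambda>x. indicator K x *\<^sub>R v' x) \<in> borel_measurable lebesgue"
        by (rule measurable_completion[OF m])
      show "AE x in lebesgue. indicator K x *\<^sub>R v x = indicator K x *\<^sub>R v' x"
        using ev by eventually_elim simp
    qed
    then show ?thesis
      unfolding set_integrable_def by (simp only: integrable_completion[OF m])
  qed
  have "radial_pair u' g'"
  proof (rule radial_pair.intro)
    show "u' \<in> borel_measurable borel" "g' \<in> borel_measurable borel"
      using u' g' by simp_all
  next
    fix K :: "'a set" assume K: "compact K" "0 \<notin> K"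
    show "set_integrable lborel K u'" by (rule set_int[OF u u' eu K])
    show "set_integrable lborel K g'" by (rule set_int[OF g g' eg K])
  next
    fix \<phi> :: "'a \<Rightarrow> real" assume \<phi>: "test_fun_punct \<phi>"
    then have smooth: "smooth_fun \<phi>" by (simp add: test_fun_punct_def)
    then have diff: "\<phi> differentiable (at x)" for x
      unfolding smooth_fun_def by (auto dest!: spec[of _ "[]"])
    have "continuous_on UNIV \<phi>"
      using diff by (intro differentiable_imp_continuous_on) (auto simp: differentiable_on_def)
    then have m\<phi>: "\<phi> \<in> borel_measurable lborel"
      by (simp add: borel_measurable_continuous_onI)
    have [measurable]: "radial_div \<phi> \<in> borel_measurable borel"
      by (rule borel_measurable_continuous_onI[OF continuous_on_radial_div[OF smooth]])
    \<comment> \<open>By \<open>radial_div_dilation\<close> with factor 1 this quotient is the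
      tested expression, and its measurability is visible because \<open>radial_div\<close> is
      continuous.\<close>
    have "(\<lambda>x. radial_div \<phi> x / norm x) \<in> borel_measurable lborel"
      by measurable
    then have m: "(\<lambda>x. frechet_derivative \<phi> (at x) (x /\<^sub>R norm x) + (real DIM('a) - 1) / norm x * \<phi> x)
        \<in> borel_measurable lborel"
      unfolding radial_div_dilation[OF diff, of 1, unfolded scaleR_one] .
    have "(LINT x|lebesgue. u x * (frechet_derivative \<phi> (at x) (x /\<^sub>R norm x)
             + (real DIM('a) - 1) / norm x * \<phi> x)) = - (LINT x|lebesgue. g x * \<phi> x)"
      using ug \<phi> unfolding radial_deriv_def by blast
    then show "(LINT x|lborel. u' x * (frechet_derivative \<phi> (at x) (x /\<^sub>R norm x)
             + (real DIM('a) - 1) / norm x * \<phi> x)) = - (LINT x|lborel. g' x * \<phi> x)"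
      unfolding LINT_eq[OF mu u' eu m] LINT_eq[OF mg g' eg m\<phi>] .
  qed
  with eu eg show ?thesis by blast
qed

section \<open>Homogeneity and the norm inequality\<close>

lemma wint_cong_AE:
  assumes "AE x in lebesgue. u x = v x"
  shows "wint d s u = wint d s v"
  unfolding wint_def by (rule nn_integral_cong_AE) (use assms in eventually_elim, simp)

lemma wint_scale:
  fixes u :: "'a::euclidean_space \<Rightarrow> real"
  assumes u: "u \<in> borel_measurable lebesgue" and k: "k > 0"
  shows "wint d s (\<lambda>x. k * u x) = ennreal (k powr s) * wint d s u"
proof -
  have [measurable]: "(\<lambda>x :: 'a. norm x) \<in> borel_measurable lebesgue"
    by (intro measurable_completion) simp
  note u[measurable]
  have "ennreal (norm x powr d * \<bar>k * u x\<bar> powr s) = ennreal (k powr s) * ennreal (norm x powr d * \<bar>u x\<bar> powr s)" for x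
    using k by (simp add: abs_mult powr_mult mult_ac flip: ennreal_mult)
  then show ?thesis
    unfolding wint_def by (simp add: nn_integral_cmult)
qed

lemma in_Wtilde_scale:
  fixes u g :: "'a::euclidean_space \<Rightarrow> real"
  assumes "in_Wtilde q p a b u g" and k: "k > 0"
  shows "in_Wtilde q p a b (\<lambda>x. k * u x) (\<lambda>x. k * g x)"
proof -
  have loc: "loc_int_punct (\<lambda>x. k * v x)" if "loc_int_punct v" for v :: "'a \<Rightarrow> real"
    using that unfolding loc_int_punct_def by (auto intro!: set_integrable_mult_right)
  have "radial_deriv (\<lambda>x. k * u x) (\<lambda>x. k * g x)"
    using assms(1) loc[of g] unfolding in_Wtilde_def radial_deriv_def by (simp add: mult.assoc)
  moreover have "wint a q (\<lambda>x. k * u x) < \<infinity>" "wint b p (\<lambda>x. k * g x) < \<infinity>"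
    using assms(1) k by (auto simp: in_Wtilde_def radial_deriv_def loc_int_punct_def wint_scale ennreal_mult_less_top)
  ultimately show ?thesis
    using assms(1) loc[of u] by (simp add: in_Wtilde_def)
qed

text \<open>Scaling \<open>u\<close> and \<open>g\<close> by \<open>1 / t\<close> turns the inhomogeneous bound into a norm inequality.
  Letting \<open>t\<close> decrease to the sum of the norms also covers the case where that sum vanishes.\<close>

lemma norm_bound_if_wint_bound:
  assumes bound: "\<And>u g. in_Wtilde q p a b (u :: 'a::euclidean_space \<Rightarrow> real) g \<Longrightarrow>
      wint c r u \<le> ennreal L * (1 + wint a q u + wint b p g)"
    and L: "L > 0" and pos: "p > 0" "q > 0" "r > 0"
  shows "\<exists>C. \<forall>(u::'a \<Rightarrow> real) g. in_Wtilde q p a b u g \<longrightarrow>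
     wint c r u < \<infinity> \<and> wnorm c r u \<le> C * (wnorm a q u + wnorm b p g)"
proof (intro exI allI impI conjI)
  fix u g :: "'a \<Rightarrow> real" assume W: "in_Wtilde q p a b u g"
  have fin_u: "wint a q u < \<infinity>" and fin_g: "wint b p g < \<infinity>" and mu: "u \<in> borel_measurable lebesgue"
    and mg: "g \<in> borel_measurable lebesgue"
    using W by (auto simp: in_Wtilde_def loc_int_punct_def radial_deriv_def)
  have "ennreal L * (1 + wint a q u + wint b p g) < \<infinity>"
    using fin_u fin_g by (simp add: ennreal_mult_less_top)
  with bound[OF W] show fin: "wint c r u < \<infinity>" by (rule le_less_trans)
  define S where "S = wnorm a q u + wnorm b p g"
  \<comment> \<open>After scaling by \<open>1 / t\<close> each of the three summands is at most 1,
    whence \<open>3 * L\<close>; the root undoes the power in \<open>wint\<close>.\<close>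
  define C where "C = (3 * L) powr (1 / r)"
  have C: "C > 0" using L by (simp add: C_def)
  have small: "ennreal ((1 / t) powr s) * wint d s v \<le> 1"
    if t: "t > 0" "wnorm d s v \<le> t" and v: "wint d s v < \<infinity>" and s: "s > 0" for t s d and v :: "'a \<Rightarrow> real"
  proof -
    define x where "x = enn2real (wint d s v)"
    have x: "wint d s v = ennreal x" "x \<ge> 0" using v by (simp_all add: x_def)
    have "x = (x powr (1 / s)) powr s" using x s by (simp add: powr_powr)
    also have "\<dots> \<le> t powr s" using t s by (intro powr_mono2) (auto simp: wnorm_def x_def)
    finally have "(1 / t) powr s * x \<le> (1 / t) powr s * t powr s"
      by (intro mult_left_mono) auto
    also have "\<dots> = 1" using t by (simp flip: powr_mult)
    finally show ?thesis using x by (simp add: ennreal_mult[symmetric])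
  qed
  have "wnorm c r u / C \<le> t" if t: "t > S" for t
  proof -
    have nonneg: "wnorm a q u \<ge> 0" "wnorm b p g \<ge> 0" by (simp_all add: wnorm_def)
    then have t0: "t > 0" "wnorm a q u \<le> t" "wnorm b p g \<le> t" using t by (auto simp: S_def)
    define x where "x = enn2real (wint c r u)"
    have x: "wint c r u = ennreal x" "x \<ge> 0" using fin by (simp_all add: x_def)
    have "ennreal ((1 / t) powr r) * wint c r u = wint c r (\<lambda>x. 1 / t * u x)"
      using t0 mu by (intro wint_scale[symmetric]) auto
    also have "\<dots> \<le> ennreal L * (1 + wint a q (\<lambda>x. 1 / t * u x) + wint b p (\<lambda>x. 1 / t * g x))"
      using t0 by (intro bound in_Wtilde_scale[OF W]) simp
    also have "wint a q (\<lambda>x. 1 / t * u x) = ennreal ((1 / t) powr q) * wint a q u"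
      using t0 mu by (intro wint_scale) auto
    also have "wint b p (\<lambda>x. 1 / t * g x) = ennreal ((1 / t) powr p) * wint b p g"
      using t0 mg by (intro wint_scale) auto
    also have "ennreal L * (1 + ennreal ((1 / t) powr q) * wint a q u + ennreal ((1 / t) powr p) * wint b p g)
        \<le> ennreal L * (1 + 1 + 1)"
      using t0 fin_u fin_g pos by (intro mult_left_mono add_mono small order_refl) auto
    also have "\<dots> = ennreal (3 * L)"
    proof -
      have "(1 + 1 + 1 :: ennreal) = 3" by simp
      then show ?thesis using L by (simp add: ennreal_mult mult.commute)
    qed
    finally have "(1 / t) powr r * x \<le> 3 * L"
      using L x by (simp add: ennreal_mult[symmetric])
    then have "((1 / t) powr r * x) powr (1 / r) \<le> C"
      unfolding C_def using x pos by (intro powr_mono2) auto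
    moreover have "((1 / t) powr r * x) powr (1 / r) = 1 / t * x powr (1 / r)"
      using t0 pos by (simp add: powr_mult powr_powr)
    ultimately have "x powr (1 / r) \<le> C * t"
      using t0 by (simp add: divide_le_eq)
    then show ?thesis using C by (simp add: wnorm_def x_def divide_le_eq mult.commute)
  qed
  then have "wnorm c r u / C \<le> S" by (rule dense_ge)
  then show "wnorm c r u \<le> C * (wnorm a q u + wnorm b p g)"
    using C by (simp add: S_def divide_le_eq mult.commute)
qed

theorem theorem5p2:
  fixes a b c p q r :: real
  defines "N \<equiv> real DIM('a::euclidean_space)"
  defines "c0 \<equiv> r * (a + N) / q - N"
  defines "c1 \<equiv> r * (b - p + N) / p - N"
  assumes r1: "1 \<le> r" and rp: "r \<le> p" and rq: "r \<le> q"
  assumes cases: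
    "(((a \<le> -N \<and> b - p \<le> -N) \<or> (a \<ge> -N \<and> b - p \<ge> -N))
        \<and> (a + N) / q \<noteq> (b - p + N) / p \<and> min c0 c1 < c \<and> c < max c0 c1)
     \<or> (((a < -N \<and> b - p > -N) \<or> (a > -N \<and> b - p < -N))
        \<and> min c0 (-N) < c \<and> c < max c0 (-N))
     \<or> (r = q \<and> q \<le> p \<and> c = a)
     \<or> (r = p \<and> p \<le> q \<and> ((a \<le> -N \<and> b - p < -N) \<or> (a \<ge> -N \<and> b - p > -N)) \<and> c = b - p)"
  shows "\<exists>C. \<forall>(u::'a \<Rightarrow> real) g. in_Wtilde q p a b u g \<longrightarrow>
           wint c r u < \<infinity> \<and> wnorm c r u \<le> C * (wnorm a q u + wnorm b p g)"
proof -
  \<comment> \<open>Adding \<open>N\<close> moves the critical values \<open>c0\<close>,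
    \<open>c1\<close>, \<open>- N\<close> to the values rA/q, rB/p, 0 of the one-dimensional
    problem.\<close>
  have shift: "min (r * (a + N) / q) (r * (b - p + N) / p) < c + N \<longleftrightarrow> min c0 c1 < c"
    "c + N < max (r * (a + N) / q) (r * (b - p + N) / p) \<longleftrightarrow> c < max c0 c1"
    "min (r * (a + N) / q) 0 < c + N \<longleftrightarrow> min c0 (- N) < c"
    "c + N < max (r * (a + N) / q) 0 \<longleftrightarrow> c < max c0 (- N)"
    unfolding c0_def c1_def by linarith+
  have conv: "a + N \<le> 0 \<longleftrightarrow> a \<le> - N" "a + N \<ge> 0 \<longleftrightarrow> a \<ge> - N" "a + N < 0 \<longleftrightarrow> a < - N" "a + N > 0 \<longleftrightarrow> a > - N"
    "b - p + N \<le> 0 \<longleftrightarrow> b - p \<le> - N" "b - p + N \<ge> 0 \<longleftrightarrow> b - p \<ge> - N"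
    "b - p + N < 0 \<longleftrightarrow> b - p < - N" "b - p + N > 0 \<longleftrightarrow> b - p > - N"
    "c + N = a + N \<longleftrightarrow> c = a" "c + N = b - p + N \<longleftrightarrow> c = b - p"
    by linarith+
  have "line_bound (a + N) q (b - p + N) p (c + N) r"
    by (rule line_bound_cases[OF r1 rp rq], unfold shift conv) (use cases in blast)
  then obtain K where K: "K > 0" "\<And>w h. increments_le w h \<Longrightarrow>
      exp_int (c + N) r w \<le> ennreal K * (1 + exp_int (a + N) q w + exp_int (b - p + N) p h)"
    unfolding line_bound_def by blast
  define V where "V = measure lborel (shell :: 'a set)"
  have V: "emeasure lborel (shell :: 'a set) = ennreal V" "V \<ge> 0"
    using emeasure_shell[where 'a = 'a] by (simp_all add: V_def emeasure_eq_ennreal_measure less_top)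
  define L where "L = exp \<bar>c\<bar> * K * exp \<bar>a\<bar> * exp \<bar>p - b\<bar>"
  have L: "L > 0" using K(1) by (simp add: L_def)
  have "L * V \<ge> 0" using L V by simp
  show ?thesis
  proof (rule norm_bound_if_wint_bound)
    fix u g :: "'a \<Rightarrow> real" assume W: "in_Wtilde q p a b u g"
    then obtain u' g' where ug': "radial_pair u' g'"
      and eq: "AE x in lebesgue. u x = u' x" "AE x in lebesgue. g x = g' x"
      using radial_pair_borel_version[of u g] by (auto simp: in_Wtilde_def)
    have "wint c r u \<le> ennreal L * (ennreal V + wint a q u + wint b p g)"
      unfolding wint_cong_AE[OF eq(1)] wint_cong_AE[OF eq(2)] L_def V(1)[symmetric]
      by (rule radial_pair.wint_le[OF ug']) (use K in \<open>auto simp: N_def\<close>)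
    also have "\<dots> = ennreal (L * V) + ennreal L * wint a q u + ennreal L * wint b p g"
      using L V by (simp add: distrib_left ennreal_mult)
    \<comment> \<open>The measure of the shell is absorbed into the constant, which restores the
      additive 1 that the scaling argument expects.\<close>
    also have "\<dots> \<le> ennreal (L * V + L + L) * (1 + wint a q u + wint b p g)"
      using L V by (intro ennreal_affine_le) auto
    finally show "wint c r u \<le> ennreal (L * V + L + L) * (1 + wint a q u + wint b p g)" .
  qed (use L \<open>L * V \<ge> 0\<close> r1 rp rq in linarith)+
qed

end
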